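(* Let $K$ be a field, let $\Delta$ be the cyclic quiver with $s\geq 1$ vertices and $s$ arrows, let $n\geq 2$, and let $A=K\Delta/R_\Delta^n$. Let $\alpha:A\times A\to D(A)$ be a $2$-cocycle and write $[\alpha]=\sum_{q=n}^{2n-1}[\beta_q]$, where each $\beta_q:A\times A\to D(A)$ is a $2$-cocycle whose cohomology class $[\beta_q]$ belongs to $\Theta(D(HH_{2,q}(A)))$. Then $$\Delta_{T_\alpha(A)}=\begin{cases}\Delta_{T_0(A)} & \text{if } [\beta_{2n-1}]=0,\\ \Delta & \text{if } [\beta_{2n-1}]\neq 0.\end{cases}$$
   Context: All algebras are finite dimensional over the field $K$; $D=\mathrm{Hom}_K(-,K)$, and $D(A)$ is an $A$-bimodule via $(a\varphi b)(c)=\varphi(bca)$. **Quiver.** $\Delta$ has vertices $1,\dots,s$ and arrows $x_i$ from $i$ to $i+1$, with indices modulo $s$. Paths are written left to right: a path $x$ satisfies $x=s(x)\,x\,t(x)$, where $s(x),t(x)$ are the trivial paths at its source and target; $e_i$ is the trivial path at $i$. $\Delta_i$ is the set of paths of length $i$, and $K\Delta_i$ is the $K$-space with basis $\Delta_i$. $R_\Delta$ is the arrow ideal, so $R_\Delta^n$ is the ideal of $K\Delta$ generated by the paths of length $n$. The paths of length $<n$ form a basis of $A$; $p^*\in D(A)$ denotes the dual basis element of such a path $p$. **Hochschild extensions.** A $2$-cocycle is a $K$-bilinear map $\alpha:A\times A\to D(A)$ with $a\,\alpha(b,c)-\alpha(ab,c)+\alpha(a,bc)-\alpha(a,b)\,c=0$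 for all $a,b,c\in A$. $[\alpha]$ is its class in the Hochschild cohomology group $H^2(A,D(A))$, i.e. modulo coboundaries $(a,b)\mapsto a f(b)-f(ab)+f(a)b$ with $f\in\mathrm{Hom}_K(A,D(A))$. The Hochschild extension algebra $T_\alpha(A)$ is the $K$-space $A\oplus D(A)$ with multiplication $(a,x)(b,y)=(ab,\ ay+xb+\alpha(a,b))$ and identity $(1,-\alpha(1,1))$. $T_0(A)$ is the trivial extension algebra. **Ordinary quivers.** A complete set of primitive orthogonal idempotents $e_1,\dots,e_s$ of $A$ lifts along $T_\alpha(A)\to A$ to such a set $\mathbf e_1,\dots,\mathbf e_s$ in $T=T_\alpha(A)$. The ordinary quiver $\Delta_T$ has vertices $1,\dots,s$, and the number of arrows from $i$ to $j$ is $\dim_K \mathbf e_iJ(T)\mathbf e_j/\mathbf e_iJ^2(T)\mathbf e_j$, where $J$ is the Jacobson radical. Equality of quivers means equality of these numbers for all $i,j$ (with the identified vertices). **Grading on $HH_2(A)$.** For $i\geq 1$, $A\otimes_{K\Delta_0^e}K\Delta_i$ has as basis the elements $u\otimes v$ with $u$ a path of length $<n$, $v$ a path of length $i$, and $uv$ a cycle, i.e. $t(u)=s(v)$ and $t(v)=s(u)$. Its degree $q$ part $(\ )_q$ is spanned by those with total length $q$. In the following formulas, paths of length $\geq n$ in the $A$-factor are zero. Define $$(\tilde d_3)_q:(A\otimes_{K\Delta_0^e}K\Delta_{n+1})_q\to(A\otimes_{K\Delta_0^e}K\Delta_n)_q,$$ $$a_1\cdots a_{q-n-1}\otimes a_{q-n}\cdots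 a_q\mapsto a_1\cdots a_{q-n}\otimes a_{q-n+1}\cdots a_q-a_qa_1\cdots a_{q-n-1}\otimes a_{q-n}\cdots a_{q-1},$$ and $$(\tilde d_2)_q:(A\otimes_{K\Delta_0^e}K\Delta_n)_q\to(A\otimes_{K\Delta_0^e}K\Delta_1)_q,$$ $$a_1\cdots a_{q-n}\otimes a_{q-n+1}\cdots a_q\mapsto\sum_{j=0}^{n-1}a_{j+q-n+2}\cdots a_qa_1\cdots a_{j+q-n}\otimes a_{j+q-n+1}.$$ Set $HH_{2,q}(A)=\mathrm{Ker}(\tilde d_2)_q/\mathrm{Im}(\tilde d_3)_q$. The second Hochschild homology group satisfies $HH_2(A)=\bigoplus_q HH_{2,q}(A)$ (and $HH_{2,q}(A)=0$ unless $n\leq q\leq 2n-1$), and $D(HH_{2,q}(A))\cong \mathrm{Ker}\,D((\tilde d_3)_q)/\mathrm{Im}\,D((\tilde d_2)_q)$. **The map $\Theta$.** For a basis element $u=a_{n+1}\cdots a_r\otimes a_1\cdots a_n$ of $A\otimes_{K\Delta_0^e}K\Delta_n$ ($a_i$ arrows), with dual basis element $u^*$, let $\Theta(u^* ):A\times A\to D(A)$ be the bilinear map given, on nonzero paths $b_1\cdots b_{m_1}$ and $b_{m_1+1}\cdots b_{m_1+m_2}$ of $A$ ($b_i$ arrows), by $$(b_1\cdots b_{m_1},\ b_{m_1+1}\cdots b_{m_1+m_2})\mapsto (a_{m_1+m_2+1}\cdots a_r)^*$$ if $n\leq m_1+m_2\leq r$ and $b_t=a_t$ for $1\leq t\leq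 m_1+m_2$, and by $0$ otherwise (including when one of the two paths is trivial). When $m_1+m_2=r$, the value is $(t(a_r))^*$, the dual of the trivial path. Extended linearly, $\Theta$ induces an isomorphism, also denoted $\Theta$, from $\bigoplus_qD(HH_{2,q}(A))\cong D(HH_2(A))$ to $H^2(A,D(A))$; $\Theta(D(HH_{2,q}(A)))$ is the image of the degree $q$ summand. *)

theory Defs
  imports
    "HOL-Library.Function_Algebras"
    "HOL-Library.Product_Plus"
    "Graph_Theory.Arc_Walk"
begin

section \<open>Spaces of functions and their duals\<close>

text \<open>
  Vector spaces are subspaces of ambient types of class \<open>ab_group_add\<close>. The space with basis
  \<open>B\<close> consists of the finitely supported coefficient functions on \<open>B\<close>, extended by zero.
\<close>

definition fscale :: "'k::field \<Rightarrow> ('x \<Rightarrow> 'k) \<Rightarrow> 'x \<Rightarrow> 'k" where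
  "fscale c f = (\<lambda>x. c * f x)"

definition free_space :: "'x set \<Rightarrow> ('x \<Rightarrow> 'k::field) set" where
  "free_space B = {f. finite {x. f x \<noteq> 0} \<and> (\<forall>x. f x \<noteq> 0 \<longrightarrow> x \<in> B)}"

definition single :: "'x \<Rightarrow> 'x \<Rightarrow> 'k::field" where
  "single x = (\<lambda>y. if y = x then 1 else 0)"

definition lin_ext :: "'x set \<Rightarrow> ('x \<Rightarrow> 'y \<Rightarrow> 'k::field) \<Rightarrow> ('x \<Rightarrow> 'k) \<Rightarrow> 'y \<Rightarrow> 'k" where
  "lin_ext B F f = (\<Sum>x\<in>B. fscale (f x) (F x))"

definition k_linear ::
  "('k::field \<Rightarrow> 'v::ab_group_add \<Rightarrow> 'v) \<Rightarrow> ('k \<Rightarrow> 'w::ab_group_add \<Rightarrow> 'w) \<Rightarrow>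
    'v set \<Rightarrow> 'w set \<Rightarrow> ('v \<Rightarrow> 'w) \<Rightarrow> bool" where
  "k_linear sV sW V W f \<longleftrightarrow>
    (\<forall>x\<in>V. f x \<in> W) \<and>
    (\<forall>x\<in>V. \<forall>y\<in>V. f (x + y) = f x + f y) \<and>
    (\<forall>c. \<forall>x\<in>V. f (sV c x) = sW c (f x))"

text \<open>
  Functionals on \<open>V\<close> are normalised to vanish outside \<open>V\<close>, so that equality of functionals
  is equality of functions.
\<close>

definition dual_space :: "('k::field \<Rightarrow> 'v::ab_group_add \<Rightarrow> 'v) \<Rightarrow> 'v set \<Rightarrow> ('v \<Rightarrow> 'k) set" where
  "dual_space sV V = {\<phi>. k_linear sV (*) V UNIV \<phi> \<and> (\<forall>x. x \<notin> V \<longrightarrow> \<phi> x = 0)}"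

definition dual_map :: "'v set \<Rightarrow> ('v \<Rightarrow> 'w) \<Rightarrow> ('w \<Rightarrow> 'k::field) \<Rightarrow> 'v \<Rightarrow> 'k" where
  "dual_map V d \<phi> = (\<lambda>x. if x \<in> V then \<phi> (d x) else 0)"

definition dual_basis :: "'x set \<Rightarrow> 'x \<Rightarrow> ('x \<Rightarrow> 'k::field) \<Rightarrow> 'k" where
  "dual_basis B b = (\<lambda>f. if f \<in> free_space B then f b else 0)"

text \<open>\<open>basis_mod s B V W\<close>: the classes of the elements of \<open>B\<close> form a finite basis of \<open>V / W\<close>.\<close>

definition basis_mod ::
  "('k::field \<Rightarrow> 'v::ab_group_add \<Rightarrow> 'v) \<Rightarrow> 'v set \<Rightarrow> 'v set \<Rightarrow> 'v set \<Rightarrow> bool" where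
  "basis_mod s B V W \<longleftrightarrow> finite B \<and> B \<subseteq> V \<and>
    (\<forall>v\<in>V. \<exists>!c. (\<forall>b. b \<notin> B \<longrightarrow> c b = 0) \<and> v - (\<Sum>b\<in>B. s (c b) b) \<in> W)"

definition dim_quot :: "('k::field \<Rightarrow> 'v::ab_group_add \<Rightarrow> 'v) \<Rightarrow> 'v set \<Rightarrow> 'v set \<Rightarrow> nat" where
  "dim_quot s V W = card (SOME B. basis_mod s B V W)"


section \<open>Algebras over a field\<close>

text \<open>Addition is that of the ambient type.\<close>

record ('k, 'v) kalg =
  kspace :: "'v set"
  kscale :: "'k \<Rightarrow> 'v \<Rightarrow> 'v"
  kmul :: "'v \<Rightarrow> 'v \<Rightarrow> 'v"
  kone :: 'v

definition right_ideal :: "('k, 'v::ab_group_add) kalg \<Rightarrow> 'v set \<Rightarrow> bool" where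
  "right_ideal T I \<longleftrightarrow> I \<subseteq> kspace T \<and> 0 \<in> I \<and> (\<forall>x\<in>I. \<forall>y\<in>I. x - y \<in> I) \<and>
    (\<forall>x\<in>I. \<forall>r\<in>kspace T. kmul T x r \<in> I)"

definition maximal_right_ideal :: "('k, 'v::ab_group_add) kalg \<Rightarrow> 'v set \<Rightarrow> bool" where
  "maximal_right_ideal T I \<longleftrightarrow> right_ideal T I \<and> I \<noteq> kspace T \<and>
    (\<forall>J. right_ideal T J \<and> I \<subseteq> J \<longrightarrow> J = I \<or> J = kspace T)"

definition jacobson_radical :: "('k, 'v::ab_group_add) kalg \<Rightarrow> 'v set" where
  "jacobson_radical T = kspace T \<inter> \<Inter>{I. maximal_right_ideal T I}"

definition ideal_square :: "('k::field, 'v::ab_group_add) kalg \<Rightarrow> 'v set \<Rightarrow> 'v set" where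
  "ideal_square T J = module.span (kscale T) {kmul T x y | x y. x \<in> J \<and> y \<in> J}"

definition idempotent :: "('k, 'v::ab_group_add) kalg \<Rightarrow> 'v \<Rightarrow> bool" where
  "idempotent T e \<longleftrightarrow> e \<in> kspace T \<and> kmul T e e = e"

definition primitive_idempotent :: "('k, 'v::ab_group_add) kalg \<Rightarrow> 'v \<Rightarrow> bool" where
  "primitive_idempotent T e \<longleftrightarrow> idempotent T e \<and> e \<noteq> 0 \<and>
    (\<forall>f g. idempotent T f \<and> idempotent T g \<and> kmul T f g = 0 \<and> kmul T g f = 0 \<and> e = f + g
      \<longrightarrow> f = 0 \<or> g = 0)"

definition complete_primitive_orthogonal ::
  "('k, 'v::ab_group_add) kalg \<Rightarrow> 'i set \<Rightarrow> ('i \<Rightarrow> 'v) \<Rightarrow> bool" where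
  "complete_primitive_orthogonal T I e \<longleftrightarrow>
    (\<forall>i\<in>I. primitive_idempotent T (e i)) \<and>
    (\<forall>i\<in>I. \<forall>j\<in>I. i \<noteq> j \<longrightarrow> kmul T (e i) (e j) = 0) \<and>
    (\<Sum>i\<in>I. e i) = kone T"

definition corner :: "('k, 'v) kalg \<Rightarrow> 'v \<Rightarrow> 'v set \<Rightarrow> 'v \<Rightarrow> 'v set" where
  "corner T e S f = {kmul T (kmul T e x) f | x. x \<in> S}"

definition arrow_number :: "('k::field, 'v::ab_group_add) kalg \<Rightarrow> ('i \<Rightarrow> 'v) \<Rightarrow> 'i \<Rightarrow> 'i \<Rightarrow> nat" where
  "arrow_number T e i j =
    dim_quot (kscale T) (corner T (e i) (jacobson_radical T) (e j))
      (corner T (e i) (ideal_square T (jacobson_radical T)) (e j))"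


section \<open>Hochschild cohomology with values in the dual bimodule, and extensions\<close>

definition D :: "('k::field, 'v::ab_group_add) kalg \<Rightarrow> ('v \<Rightarrow> 'k) set" where
  "D A = dual_space (kscale A) (kspace A)"

definition lact :: "('k::field, 'v) kalg \<Rightarrow> 'v \<Rightarrow> ('v \<Rightarrow> 'k) \<Rightarrow> 'v \<Rightarrow> 'k" where
  "lact A a \<phi> = (\<lambda>c. if c \<in> kspace A then \<phi> (kmul A c a) else 0)"

definition ract :: "('k::field, 'v) kalg \<Rightarrow> ('v \<Rightarrow> 'k) \<Rightarrow> 'v \<Rightarrow> 'v \<Rightarrow> 'k" where
  "ract A \<phi> b = (\<lambda>c. if c \<in> kspace A then \<phi> (kmul A b c) else 0)"

definition cocycles2 ::
  "('k::field, 'v::ab_group_add) kalg \<Rightarrow> ('v \<Rightarrow> 'v \<Rightarrow> 'v \<Rightarrow> 'k) set" where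
  "cocycles2 A = {\<alpha>.
    (\<forall>a\<in>kspace A. k_linear (kscale A) fscale (kspace A) (D A) (\<lambda>b. \<alpha> a b)) \<and>
    (\<forall>b\<in>kspace A. k_linear (kscale A) fscale (kspace A) (D A) (\<lambda>a. \<alpha> a b)) \<and>
    (\<forall>a\<in>kspace A. \<forall>b\<in>kspace A. \<forall>c\<in>kspace A.
      lact A a (\<alpha> b c) - \<alpha> (kmul A a b) c + \<alpha> a (kmul A b c) - ract A (\<alpha> a b) c = 0)}"

definition coboundary2 ::
  "('k::field, 'v::ab_group_add) kalg \<Rightarrow> ('v \<Rightarrow> 'v \<Rightarrow> 'k) \<Rightarrow> 'v \<Rightarrow> 'v \<Rightarrow> 'v \<Rightarrow> 'k" where
  "coboundary2 A f = (\<lambda>a b. lact A a (f b) - f (kmul A a b) + ract A (f a) b)"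

text \<open>Only the values of a cocycle on \<open>kspace A\<close> matter, so these are the only ones compared.\<close>

definition cohomologous ::
  "('k::field, 'v::ab_group_add) kalg \<Rightarrow> (('v \<Rightarrow> 'v \<Rightarrow> 'v \<Rightarrow> 'k) \<times> ('v \<Rightarrow> 'v \<Rightarrow> 'v \<Rightarrow> 'k)) set" where
  "cohomologous A = {(\<alpha>, \<beta>). \<alpha> \<in> cocycles2 A \<and> \<beta> \<in> cocycles2 A \<and>
    (\<exists>f. k_linear (kscale A) fscale (kspace A) (D A) f \<and>
      (\<forall>a\<in>kspace A. \<forall>b\<in>kspace A. \<alpha> a b - \<beta> a b = coboundary2 A f a b))}"

definition coh_class ::
  "('k::field, 'v::ab_group_add) kalg \<Rightarrow> ('v \<Rightarrow> 'v \<Rightarrow> 'v \<Rightarrow> 'k) \<Rightarrow> ('v \<Rightarrow> 'v \<Rightarrow> 'v \<Rightarrow> 'k) set" where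
  "coh_class A \<alpha> = cohomologous A `` {\<alpha>}"

definition hochschild_ext ::
  "('k::field, 'v::ab_group_add) kalg \<Rightarrow> ('v \<Rightarrow> 'v \<Rightarrow> 'v \<Rightarrow> 'k) \<Rightarrow> ('k, 'v \<times> ('v \<Rightarrow> 'k)) kalg" where
  "hochschild_ext A \<alpha> =
    \<lparr>kspace = kspace A \<times> D A,
     kscale = (\<lambda>c (a, x). (kscale A c a, fscale c x)),
     kmul = (\<lambda>(a, x) (b, y). (kmul A a b, lact A a y + ract A x b + \<alpha> a b)),
     kone = (kone A, - \<alpha> (kone A) (kone A))\<rparr>"

text \<open>
  The number of arrows from \<open>i\<close> to \<open>j\<close> in the ordinary quiver of the extension, whose vertices
  are identified with those of \<open>A\<close> by lifting the idempotents \<open>e\<close> of \<open>A\<close>; it does not depend on the lift.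
\<close>

definition ordinary_quiver_ext ::
  "('k::field, 'v::ab_group_add) kalg \<Rightarrow> 'i set \<Rightarrow> ('i \<Rightarrow> 'v) \<Rightarrow> ('v \<Rightarrow> 'v \<Rightarrow> 'v \<Rightarrow> 'k)
    \<Rightarrow> 'i \<Rightarrow> 'i \<Rightarrow> nat" where
  "ordinary_quiver_ext A I e \<alpha> i j = (THE d. \<exists>e'.
    complete_primitive_orthogonal (hochschild_ext A \<alpha>) I e' \<and> (\<forall>v\<in>I. fst (e' v) = e v) \<and>
    d = arrow_number (hochschild_ext A \<alpha>) e' i j)"


section \<open>Path algebras\<close>

text \<open>A path is given by its source and its list of arrows, written left to right.\<close>

type_synonym ('a, 'b) path = "'a \<times> 'b list"

definition paths :: "('a, 'b) pre_digraph \<Rightarrow> ('a, 'b) path set" where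
  "paths G = {(u, es). \<exists>v. pre_digraph.awalk G u es v}"

definition plen :: "('a, 'b) path \<Rightarrow> nat" where
  "plen p = length (snd p)"

definition ptarget :: "('a, 'b) pre_digraph \<Rightarrow> ('a, 'b) path \<Rightarrow> 'a" where
  "ptarget G p = pre_digraph.awlast G (fst p) (snd p)"

definition short_paths :: "('a, 'b) pre_digraph \<Rightarrow> nat \<Rightarrow> ('a, 'b) path set" where
  "short_paths G n = {p \<in> paths G. plen p < n}"

text \<open>The coefficient of a path \<open>r\<close> in a product is the sum over all factorisations \<open>r = pq\<close>.\<close>

definition path_mul :: "('a, 'b) pre_digraph \<Rightarrow> (('a, 'b) path \<Rightarrow> 'k::field) \<Rightarrow>
    (('a, 'b) path \<Rightarrow> 'k) \<Rightarrow> ('a, 'b) path \<Rightarrow> 'k" where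
  "path_mul G f g = (\<lambda>(u, es). \<Sum>k\<le>length es.
    f (u, take k es) * g (ptarget G (u, take k es), drop k es))"

definition path_one :: "('a, 'b) pre_digraph \<Rightarrow> ('a, 'b) path \<Rightarrow> 'k::field" where
  "path_one G = (\<Sum>v\<in>verts G. single (v, []))"

definition path_algebra :: "('a, 'b) pre_digraph \<Rightarrow> ('k::field, ('a, 'b) path \<Rightarrow> 'k) kalg" where
  "path_algebra G = \<lparr>kspace = free_space (paths G), kscale = fscale,
     kmul = path_mul G, kone = path_one G\<rparr>"

text \<open>
  \<open>KG / R\<^sup>n\<close> is realised on the span of the paths of length less than \<open>n\<close>; the lemma
  \<open>trunc_quotient\<close> below shows that it is the quotient of the path algebra by \<open>R\<^sup>n\<close>.
\<close>

definition trunc :: "nat \<Rightarrow> (('a, 'b) path \<Rightarrow> 'k::field) \<Rightarrow> ('a, 'b) path \<Rightarrow> 'k" where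
  "trunc n f = (\<lambda>p. if plen p < n then f p else 0)"

definition truncated_path_algebra ::
  "('a, 'b) pre_digraph \<Rightarrow> nat \<Rightarrow> ('k::field, ('a, 'b) path \<Rightarrow> 'k) kalg" where
  "truncated_path_algebra G n = \<lparr>kspace = free_space (short_paths G n), kscale = fscale,
     kmul = (\<lambda>f g. trunc n (path_mul G f g)), kone = trunc n (path_one G)\<rparr>"

definition ideal_generated :: "('k::field, 'v::ab_group_add) kalg \<Rightarrow> 'v set \<Rightarrow> 'v set" where
  "ideal_generated T S = \<Inter>{I. S \<subseteq> I \<and> right_ideal T I \<and>
    (\<forall>x\<in>I. \<forall>r\<in>kspace T. kmul T r x \<in> I)}"

lemma sum_fun_apply: "(\<Sum>i\<in>I. F i) x = (\<Sum>i\<in>I. F i x)"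
  by (induction I rule: infinite_finite_induct) auto

lemma free_space_diff:
  assumes "f \<in> free_space B" and "g \<in> free_space B"
  shows "f - g \<in> free_space B"
proof -
  have "{x. (f - g) x \<noteq> 0} \<subseteq> {x. f x \<noteq> 0} \<union> {x. g x \<noteq> 0}" by auto
  moreover have "finite ({x. f x \<noteq> 0} \<union> {x. g x \<noteq> 0})"
    using assms by (simp add: free_space_def)
  ultimately have "finite {x. (f - g) x \<noteq> 0}" by (rule finite_subset)
  moreover have "x \<in> B" if "(f - g) x \<noteq> 0" for x
    using that assms by (cases "f x = 0") (auto simp: free_space_def)
  ultimately show ?thesis by (simp add: free_space_def)
qed

lemma path_splitE:
  assumes "wf_digraph G" and "(u, es) \<in> paths G" and "k \<le> length es"
  shows "(u, take k es) \<in> paths G" "(ptarget G (u, take k es), drop k es) \<in> paths G"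
proof -
  interpret wf_digraph G by fact
  from assms(2) obtain v where "awalk u (take k es @ drop k es) v"
    by (auto simp: paths_def)
  then have "awalk u (take k es) (awlast u (take k es))" "awalk (awlast u (take k es)) (drop k es) v"
    unfolding awalk_append_iff by auto
  then show "(u, take k es) \<in> paths G" "(ptarget G (u, take k es), drop k es) \<in> paths G"
    by (auto simp: paths_def ptarget_def)
qed

lemma path_joinI:
  assumes "wf_digraph G" and "(u, es) \<in> paths G" and "(ptarget G (u, es), fs) \<in> paths G"
  shows "(u, es @ fs) \<in> paths G"
proof -
  interpret wf_digraph G by fact
  from assms(2) obtain v where v: "awalk u es v" by (auto simp: paths_def)
  then have "awlast u es = v" by auto
  with assms(3) obtain w where "awalk v fs w" by (auto simp: paths_def ptarget_def)
  with v have "awalk u (es @ fs) w" by auto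
  then show ?thesis by (auto simp: paths_def)
qed

lemma path_mul_free_space:
  assumes "wf_digraph G" and "f \<in> free_space (paths G)" and "g \<in> free_space (paths G)"
  shows "path_mul G f g \<in> free_space (paths G)"
proof -
  have *: "\<exists>k\<le>length (snd p). f (fst p, take k (snd p)) \<noteq> 0 \<and>
      g (ptarget G (fst p, take k (snd p)), drop k (snd p)) \<noteq> 0" if "path_mul G f g p \<noteq> 0" for p
  proof (rule ccontr)
    assume "\<not> ?thesis"
    then have "path_mul G f g p = 0"
      by (auto simp: path_mul_def split_beta intro!: sum.neutral)
    with that show False by simp
  qed
  have "{p. path_mul G f g p \<noteq> 0} \<subseteq>
      (\<lambda>(p, q). (fst p, snd p @ snd q)) ` ({p. f p \<noteq> 0} \<times> {q. g q \<noteq> 0})"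
  proof
    fix p assume "p \<in> {p. path_mul G f g p \<noteq> 0}"
    with * obtain k where "f (fst p, take k (snd p)) \<noteq> 0"
      "g (ptarget G (fst p, take k (snd p)), drop k (snd p)) \<noteq> 0" by blast
    then show "p \<in> (\<lambda>(p, q). (fst p, snd p @ snd q)) ` ({p. f p \<noteq> 0} \<times> {q. g q \<noteq> 0})"
      by (intro image_eqI[of _ _ "((fst p, take k (snd p)),
        (ptarget G (fst p, take k (snd p)), drop k (snd p)))"]) auto
  qed
  moreover have "finite ({p. f p \<noteq> 0} \<times> {q. g q \<noteq> 0})"
    using assms by (auto simp: free_space_def)
  ultimately have "finite {p. path_mul G f g p \<noteq> 0}"
    by (meson finite_imageI finite_subset)
  moreover have "p \<in> paths G" if "path_mul G f g p \<noteq> 0" for p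
  proof -
    from *[OF that] obtain k where k: "f (fst p, take k (snd p)) \<noteq> 0"
      "g (ptarget G (fst p, take k (snd p)), drop k (snd p)) \<noteq> 0" by blast
    with assms(2,3) have "(fst p, take k (snd p)) \<in> paths G"
      "(ptarget G (fst p, take k (snd p)), drop k (snd p)) \<in> paths G"
      by (auto simp: free_space_def)
    from path_joinI[OF assms(1) this] show ?thesis by simp
  qed
  ultimately show ?thesis by (simp add: free_space_def)
qed

lemma path_mul_single:
  "path_mul G (single (u, es)) (fscale c (single (ptarget G (u, es), fs))) =
    fscale c (single (u, es @ fs))"
proof
  fix p :: "'a \<times> 'b list"
  obtain w gs where p: "p = (w, gs)" by (cases p)
  have "path_mul G (single (u, es)) (fscale c (single (ptarget G (u, es), fs))) p =
    (\<Sum>k\<le>length gs. if k = length es \<and> w = u \<and> gs = es @ fs then c else 0)"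
    unfolding p path_mul_def prod.case
  proof (rule sum.cong[OF refl])
    fix k assume "k \<in> {..length gs}"
    then have "take k gs = es \<and> drop k gs = fs \<longleftrightarrow> k = length es \<and> gs = es @ fs"
      by (metis append_eq_conv_conj append_take_drop_id atMost_iff length_take min.absorb2)
    then show "single (u, es) (w, take k gs) *
        fscale c (single (ptarget G (u, es), fs)) (ptarget G (w, take k gs), drop k gs) =
        (if k = length es \<and> w = u \<and> gs = es @ fs then c else 0)"
      by (auto simp: single_def fscale_def)
  qed
  also have "\<dots> = fscale c (single (u, es @ fs)) p"
    by (cases "w = u \<and> gs = es @ fs") (auto simp: p single_def fscale_def)
  finally show "path_mul G (single (u, es)) (fscale c (single (ptarget G (u, es), fs))) p =
    fscale c (single (u, es @ fs)) p" .
qed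

lemma trunc_path_mul: "trunc n (path_mul G f g) = trunc n (path_mul G (trunc n f) (trunc n g))"
proof
  fix p :: "'a \<times> 'b list"
  show "trunc n (path_mul G f g) p = trunc n (path_mul G (trunc n f) (trunc n g)) p"
    by (cases p) (auto simp: trunc_def path_mul_def plen_def intro!: sum.cong)
qed

text \<open>
  Truncation is a surjective homomorphism of algebras onto the truncated path algebra, whose
  kernel is the ideal \<open>R\<^sup>n\<close> generated by the paths of length \<open>n\<close>.
\<close>

lemma trunc_quotient:
  fixes G :: "('a, 'b) pre_digraph" and n :: nat and f g :: "('a, 'b) path \<Rightarrow> 'k::field"
  defines "P \<equiv> (path_algebra G :: ('k, ('a, 'b) path \<Rightarrow> 'k) kalg)"
    and "A \<equiv> (truncated_path_algebra G n :: ('k, ('a, 'b) path \<Rightarrow> 'k) kalg)"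
  assumes G: "wf_digraph G"
  shows "trunc n ` kspace P = kspace A"
    and "trunc n (f + g) = trunc n f + trunc n g"
    and "trunc n (kscale P c f) = kscale A c (trunc n f)"
    and "trunc n (kmul P f g) = kmul A (trunc n f) (trunc n g)"
    and "trunc n (kone P) = kone A"
    and "{h \<in> kspace P. trunc n h = 0} = ideal_generated P {single p | p. p \<in> paths G \<and> plen p = n}"
proof -
  show "trunc n ` kspace P = kspace A"
  proof
    show "trunc n ` kspace P \<subseteq> kspace A"
    proof safe
      fix h assume h: "h \<in> kspace P"
      have "{p. trunc n h p \<noteq> 0} \<subseteq> {p. h p \<noteq> 0}" by (auto simp: trunc_def)
      moreover have "finite {p. h p \<noteq> 0}" using h by (simp add: P_def path_algebra_def free_space_def)
      ultimately have "finite {p. trunc n h p \<noteq> 0}" by (rule finite_subset)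
      with h show "trunc n h \<in> kspace A"
        by (simp add: P_def A_def path_algebra_def truncated_path_algebra_def free_space_def
            short_paths_def trunc_def)
    qed
    show "kspace A \<subseteq> trunc n ` kspace P"
    proof
      fix h assume h: "h \<in> kspace A"
      then have "h \<in> kspace P" "h = trunc n h"
        by (simp_all add: P_def A_def path_algebra_def truncated_path_algebra_def free_space_def
            short_paths_def trunc_def fun_eq_iff) blast
      then show "h \<in> trunc n ` kspace P" by (metis image_eqI)
    qed
  qed
  show "trunc n (f + g) = trunc n f + trunc n g"
    by (auto simp: trunc_def)
  show "trunc n (kscale P c f) = kscale A c (trunc n f)"
    by (auto simp: P_def A_def path_algebra_def truncated_path_algebra_def trunc_def fscale_def)
  show "trunc n (kmul P f g) = kmul A (trunc n f) (trunc n g)"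
    by (simp add: P_def A_def path_algebra_def truncated_path_algebra_def flip: trunc_path_mul)
  show "trunc n (kone P) = kone A"
    by (simp add: P_def A_def path_algebra_def truncated_path_algebra_def)
  let ?K = "{h \<in> kspace P. trunc n h = 0}" and ?S = "{single p | p. p \<in> paths G \<and> plen p = n}"
  have zero: "trunc n h = 0 \<longleftrightarrow> (\<forall>p. plen p < n \<longrightarrow> h p = 0)" for h :: "('a, 'b) path \<Rightarrow> 'k"
    by (auto simp: trunc_def fun_eq_iff)
  show "?K = ideal_generated P ?S"
  proof
    show "?K \<subseteq> ideal_generated P ?S"
    proof
      fix h assume h: "h \<in> ?K"
      show "h \<in> ideal_generated P ?S"
        unfolding ideal_generated_def
      proof safe
        fix I assume S: "?S \<subseteq> I" and I: "right_ideal P I" and "\<forall>x\<in>I. \<forall>r\<in>kspace P. kmul P r x \<in> I"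
        have I0: "0 \<in> I" and Id: "\<And>x y. x \<in> I \<Longrightarrow> y \<in> I \<Longrightarrow> x - y \<in> I"
          and Im: "\<And>x r. x \<in> I \<Longrightarrow> r \<in> kspace P \<Longrightarrow> kmul P x r \<in> I"
          using I by (auto simp: right_ideal_def)
        have Ia: "x + y \<in> I" if "x \<in> I" "y \<in> I" for x y
          using Id[OF that(1) Id[OF I0 that(2)]] by simp
        have mono: "fscale (h p) (single p) \<in> I" if p: "h p \<noteq> 0" for p
        proof -
          obtain u es where ues: "p = (u, es)" by (cases p)
          from p h have path: "p \<in> paths G" and len: "n \<le> length es"
            by (auto simp: zero P_def path_algebra_def free_space_def ues plen_def not_less[symmetric])
          let ?t = "ptarget G (u, take n es)"
          have sp: "(u, take n es) \<in> paths G" "(?t, drop n es) \<in> paths G"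
            using path_splitE[OF G path[unfolded ues] len] .
          have "single (u, take n es) \<in> I"
            by (intro subsetD[OF S] CollectI exI[of _ "(u, take n es)"]) (use sp(1) len in \<open>simp add: plen_def\<close>)
          moreover have "fscale (h p) (single (?t, drop n es)) \<in> kspace P"
            using sp(2) by (auto simp: P_def path_algebra_def free_space_def fscale_def single_def)
          ultimately have "kmul P (single (u, take n es)) (fscale (h p) (single (?t, drop n es))) \<in> I"
            by (rule Im)
          also have "kmul P (single (u, take n es)) (fscale (h p) (single (?t, drop n es))) =
              fscale (h p) (single p)"
            by (simp add: P_def path_algebra_def path_mul_single ues)
          finally show ?thesis .
        qed
        have fin: "finite {p. h p \<noteq> 0}"
          using h by (auto simp: P_def path_algebra_def free_space_def)
        have hsum: "h = (\<Sum>p | h p \<noteq> 0. fscale (h p) (single p))"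
        proof
          fix q
          have "(\<Sum>p | h p \<noteq> 0. fscale (h p) (single p)) q = (\<Sum>p | h p \<noteq> 0. if p = q then h p else 0)"
            by (subst sum_fun_apply) (auto simp: fscale_def single_def intro!: sum.cong)
          also have "\<dots> = h q" using fin by (simp add: sum.delta)
          finally show "h q = (\<Sum>p | h p \<noteq> 0. fscale (h p) (single p)) q" by simp
        qed
        have "(\<Sum>p\<in>Q. fscale (h p) (single p)) \<in> I" if "finite Q" "Q \<subseteq> {p. h p \<noteq> 0}" for Q
          using that by (induction Q) (auto intro!: Ia mono simp: I0)
        from this[OF fin subset_refl] have "(\<Sum>p | h p \<noteq> 0. fscale (h p) (single p)) \<in> I" .
        then show "h \<in> I" by (rule back_subst[of "\<lambda>x. x \<in> I", OF _ hsum[symmetric]])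
      qed
    qed
    have P0: "0 \<in> kspace P" by (simp add: P_def path_algebra_def free_space_def)
    have Pd: "x - y \<in> kspace P" if "x \<in> kspace P" "y \<in> kspace P" for x y
      using that by (simp add: P_def path_algebra_def free_space_diff)
    have mul: "kmul P x r \<in> kspace P" if "x \<in> kspace P" "r \<in> kspace P" for x r
      using that path_mul_free_space[OF G] by (simp add: P_def path_algebra_def)
    have mull: "kmul P x r p = 0" if "\<forall>p. plen p < n \<longrightarrow> x p = 0" "plen p < n" for x r p
      using that by (cases p) (auto simp: P_def path_algebra_def path_mul_def plen_def intro!: sum.neutral)
    have mulr: "kmul P r x p = 0" if "\<forall>p. plen p < n \<longrightarrow> x p = 0" "plen p < n" for x r p
      using that by (cases p) (auto simp: P_def path_algebra_def path_mul_def plen_def intro!: sum.neutral)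
    have "right_ideal P ?K"
      unfolding right_ideal_def zero
    proof (intro conjI ballI)
      fix x y assume "x \<in> {h \<in> kspace P. \<forall>p. plen p < n \<longrightarrow> h p = 0}"
        "y \<in> {h \<in> kspace P. \<forall>p. plen p < n \<longrightarrow> h p = 0}"
      then show "x - y \<in> {h \<in> kspace P. \<forall>p. plen p < n \<longrightarrow> h p = 0}" using Pd by simp
    next
      fix x r assume "x \<in> {h \<in> kspace P. \<forall>p. plen p < n \<longrightarrow> h p = 0}" "r \<in> kspace P"
      then show "kmul P x r \<in> {h \<in> kspace P. \<forall>p. plen p < n \<longrightarrow> h p = 0}"
        using mul mull by blast
    qed (use P0 in auto)
    moreover have "\<forall>x\<in>?K. \<forall>r\<in>kspace P. kmul P r x \<in> ?K"
      using mul mulr unfolding zero by blast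
    moreover have "?S \<subseteq> ?K"
    proof safe
      fix p :: "('a, 'b) path" assume "p \<in> paths G" "n = plen p"
      then show "single p \<in> kspace P" by (simp add: P_def path_algebra_def free_space_def single_def)
      show "trunc (plen p) (single p) = 0" by (auto simp: trunc_def single_def fun_eq_iff)
    qed
    ultimately show "ideal_generated P ?S \<subseteq> ?K"
      unfolding ideal_generated_def by blast
  qed
qed

definition trivial_path :: "'a \<Rightarrow> ('a, 'b) path \<Rightarrow> 'k::field" where
  "trivial_path v = single (v, [])"

definition cyclic_quiver :: "nat \<Rightarrow> (nat, nat) pre_digraph" where
  "cyclic_quiver s = \<lparr>verts = {..<s}, arcs = {..<s}, tail = (\<lambda>i. i), head = (\<lambda>i. Suc i mod s)\<rparr>"

definition quiver_arrow_number :: "('a, 'b) pre_digraph \<Rightarrow> 'a \<Rightarrow> 'a \<Rightarrow> nat" where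
  "quiver_arrow_number G i j = card {a \<in> arcs G. tail G a = i \<and> head G a = j}"


section \<open>The grading on the second Hochschild homology\<close>

text \<open>\<open>tens_basis G n i q\<close> is the basis of the degree \<open>q\<close> part of \<open>A \<otimes> KG\<^sub>i\<close> over \<open>KG\<^sub>0\<^sup>e\<close>.\<close>

definition tens_basis ::
  "('a, 'b) pre_digraph \<Rightarrow> nat \<Rightarrow> nat \<Rightarrow> nat \<Rightarrow> (('a, 'b) path \<times> ('a, 'b) path) set" where
  "tens_basis G n i q = {(u, v). u \<in> short_paths G n \<and> v \<in> paths G \<and> plen v = i \<and>
    ptarget G u = fst v \<and> ptarget G v = fst u \<and> plen u + plen v = q}"

definition tens :: "nat \<Rightarrow> ('a, 'b) path \<Rightarrow> ('a, 'b) path \<Rightarrow> ('a, 'b) path \<times> ('a, 'b) path \<Rightarrow> 'k::field"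
  where "tens n u v = (if plen u < n then single (u, v) else 0)"

definition d3 :: "('a, 'b) pre_digraph \<Rightarrow> nat \<Rightarrow> nat \<Rightarrow>
    (('a, 'b) path \<times> ('a, 'b) path \<Rightarrow> 'k::field) \<Rightarrow> ('a, 'b) path \<times> ('a, 'b) path \<Rightarrow> 'k" where
  "d3 G n q = lin_ext (tens_basis G n (n + 1) q) (\<lambda>((i, us), (j, vs)).
      tens n (i, us @ [hd vs]) (head G (hd vs), tl vs)
      - tens n (tail G (last vs), last vs # us) (j, butlast vs))"

definition d2 :: "('a, 'b) pre_digraph \<Rightarrow> nat \<Rightarrow> nat \<Rightarrow>
    (('a, 'b) path \<times> ('a, 'b) path \<Rightarrow> 'k::field) \<Rightarrow> ('a, 'b) path \<times> ('a, 'b) path \<Rightarrow> 'k" where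
  "d2 G n q = lin_ext (tens_basis G n n q) (\<lambda>((i, us), (j, vs)).
      \<Sum>l<n. tens n (head G (vs ! l), drop (Suc l) vs @ us @ take l vs) (tail G (vs ! l), [vs ! l]))"

text \<open>\<open>D(HH\<^sub>2\<^sub>,\<^sub>q(A))\<close>, as the quotient of \<open>Ker D(d3)\<close> by \<open>Im D(d2)\<close>, i.e. as a set of cosets.\<close>

definition ker_D_d3 :: "('a, 'b) pre_digraph \<Rightarrow> nat \<Rightarrow> nat \<Rightarrow>
    ((('a, 'b) path \<times> ('a, 'b) path \<Rightarrow> 'k::field) \<Rightarrow> 'k) set" where
  "ker_D_d3 G n q = {\<phi> \<in> dual_space fscale (free_space (tens_basis G n n q)).
    dual_map (free_space (tens_basis G n (n + 1) q)) (d3 G n q) \<phi> = 0}"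

definition im_D_d2 :: "('a, 'b) pre_digraph \<Rightarrow> nat \<Rightarrow> nat \<Rightarrow>
    ((('a, 'b) path \<times> ('a, 'b) path \<Rightarrow> 'k::field) \<Rightarrow> 'k) set" where
  "im_D_d2 G n q = dual_map (free_space (tens_basis G n n q)) (d2 G n q) `
    dual_space fscale (free_space (tens_basis G n 1 q))"

definition D_HH2 :: "('a, 'b) pre_digraph \<Rightarrow> nat \<Rightarrow> nat \<Rightarrow>
    ((('a, 'b) path \<times> ('a, 'b) path \<Rightarrow> 'k::field) \<Rightarrow> 'k) set set" where
  "D_HH2 G n q = ker_D_d3 G n q //
    {(\<phi>, \<psi>). \<phi> \<in> ker_D_d3 G n q \<and> \<psi> \<in> ker_D_d3 G n q \<and> \<phi> - \<psi> \<in> im_D_d2 G n q}"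

text \<open>
  The value of \<open>\<Theta>(u\<^sup>*)\<close>, \<open>u = w \<otimes> v\<close>, on a pair \<open>b, b'\<close> of paths. The list \<open>as\<close> is
  \<open>a\<^sub>1, \<dots>, a\<^sub>r\<close>; the remaining path \<open>a\<^sub>m\<^sub>+\<^sub>1 \<cdots> a\<^sub>r\<close> starts at the target of \<open>b'\<close>, which
  for \<open>m = r\<close> is the target of \<open>a\<^sub>r\<close>.
\<close>

definition theta_val :: "('a, 'b) pre_digraph \<Rightarrow> nat \<Rightarrow> ('a, 'b) path \<times> ('a, 'b) path \<Rightarrow>
    ('a, 'b) path \<Rightarrow> ('a, 'b) path \<Rightarrow> (('a, 'b) path \<Rightarrow> 'k::field) \<Rightarrow> 'k" where
  "theta_val G n = (\<lambda>(w, v) b b'.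
    let as = snd v @ snd w; m = plen b + plen b' in
      if plen b \<noteq> 0 \<and> plen b' \<noteq> 0 \<and> n \<le> m \<and> m \<le> length as \<and> snd b @ snd b' = take m as
      then dual_basis (short_paths G n) (ptarget G b', drop m as)
      else 0)"

text \<open>\<open>\<phi> = (\<Sum>u. \<phi>(u) u\<^sup>*)\<close> is sent to the bilinear map \<open>\<Sum>u. \<phi>(u) \<Theta>(u\<^sup>*)\<close>.\<close>

definition Theta :: "('a, 'b) pre_digraph \<Rightarrow> nat \<Rightarrow> nat \<Rightarrow>
    ((('a, 'b) path \<times> ('a, 'b) path \<Rightarrow> 'k::field) \<Rightarrow> 'k) \<Rightarrow>
    (('a, 'b) path \<Rightarrow> 'k) \<Rightarrow> (('a, 'b) path \<Rightarrow> 'k) \<Rightarrow> (('a, 'b) path \<Rightarrow> 'k) \<Rightarrow> 'k" where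
  "Theta G n q \<phi> = (\<lambda>x y. \<Sum>u\<in>tens_basis G n n q. \<Sum>b\<in>short_paths G n. \<Sum>b'\<in>short_paths G n.
    fscale (\<phi> (single u) * x b * y b') (theta_val G n u b b'))"

text \<open>The map induced on cosets; a coset is sent to the common class of the images of its elements.\<close>

definition Theta_class :: "('a, 'b) pre_digraph \<Rightarrow> nat \<Rightarrow> nat \<Rightarrow>
    ((('a, 'b) path \<times> ('a, 'b) path \<Rightarrow> 'k::field) \<Rightarrow> 'k) set \<Rightarrow>
    ((('a, 'b) path \<Rightarrow> 'k) \<Rightarrow> (('a, 'b) path \<Rightarrow> 'k) \<Rightarrow> (('a, 'b) path \<Rightarrow> 'k) \<Rightarrow> 'k) set" where
  "Theta_class G n q F = (\<Union>\<phi>\<in>F. coh_class (truncated_path_algebra G n) (Theta G n q \<phi>))"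

end

theory Submission
  imports Defs
begin

text \<open>
  Write \<open>T = T\<^sub>\<alpha>(A)\<close> and \<open>J\<close> for its radical, which consists of the pairs \<open>(a, x)\<close> with \<open>a\<close> in the
  arrow ideal. The products \<open>(a, 0)(0, \<phi>)\<close> show that \<open>J\<^sup>2\<close> contains all functionals vanishing on the
  paths of length \<open>n - 1\<close>, so \<open>J/J\<^sup>2\<close> is spanned by the arrows and the functionals dual to these longest
  paths, and only the values of \<open>\<alpha>\<close> on the longest paths matter. A coboundary \<open>\<delta>f\<close> contributes
  \<open>- f(ab)\<close> there, which is undone by the shift \<open>(a, x) \<mapsto> (a, x + f(a))\<close>, and \<open>\<Theta>\<close> of degree \<open>q < 2n - 1\<close>
  contributes nothing. In degree \<open>2n - 1\<close> an element of the kernel of \<open>D(d\<^sub>3)\<close> is constant, with value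
  \<open>c\<close>, on the cycles of length \<open>2n - 1\<close>. If \<open>c \<noteq> 0\<close>, an arrow and a path of length \<open>n - 1\<close> with product
  zero in \<open>A\<close> multiply in \<open>T\<close> to \<open>c\<close> times the dual of a longest path, so only the arrows survive in
  \<open>J/J\<^sup>2\<close>. The same evaluation is zero on coboundaries, so the class is nonzero exactly when \<open>c \<noteq> 0\<close>.
\<close>

text \<open>Longest paths are the right test elements because the arrow ideal annihilates them on
  both sides: for two radical elements of \<open>T\<close>, the bimodule terms of the product vanish
  there, and so do the outer terms of a coboundary. That J^2 contains the duals of all shorter paths
  depends on the quiver having no sinks: a path p of length below n - 1 extends by an arrow e, and e
  (pe)^* = p^*. Degree 2n - 1 is exceptional because \<Theta> in degree q only produces duals of
  paths of length at most q - n. In that degree cycles exist only if s divides 2n - 1, and they are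
  the rotations of a single one; the differential compares neighbouring rotations, whence the
  constancy. If s does not divide 2n - 1, the conditions are vacuous and the class is zero. The
  quiver is defined through an arbitrary lift of the idempotents, so the count has to cover every
  lift and one lift has to be constructed. The resulting formula depends on \<alpha> only through
  one truth value, which makes the comparison with the trivial extension immediate.\<close>

lemma vector_space_fscale: "vector_space (fscale :: 'k::field \<Rightarrow> ('x \<Rightarrow> 'k) \<Rightarrow> 'x \<Rightarrow> 'k)"
  by unfold_locales (auto simp: fscale_def algebra_simps)

lemma fscale_zero: "fscale c 0 = 0"
  by (auto simp: fscale_def)

lemma fscale_one: "fscale 1 f = f"
  by (simp add: fscale_def)

section \<open>Associative algebras\<close>

locale assoc_kalgebra = vector_space "kscale A" for A :: "('k::field, 'v::ab_group_add) kalg" +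
  assumes subspace_kspace: "subspace (kspace A)"
    and mul_closed: "\<lbrakk>x \<in> kspace A; y \<in> kspace A\<rbrakk> \<Longrightarrow> kmul A x y \<in> kspace A"
    and one_closed: "kone A \<in> kspace A"
    and mul_add_left: "\<lbrakk>x \<in> kspace A; y \<in> kspace A; z \<in> kspace A\<rbrakk> \<Longrightarrow>
      kmul A (x + y) z = kmul A x z + kmul A y z"
    and mul_add_right: "\<lbrakk>x \<in> kspace A; y \<in> kspace A; z \<in> kspace A\<rbrakk> \<Longrightarrow>
      kmul A x (y + z) = kmul A x y + kmul A x z"
    and mul_scale_left: "\<lbrakk>x \<in> kspace A; y \<in> kspace A\<rbrakk> \<Longrightarrow>
      kmul A (kscale A c x) y = kscale A c (kmul A x y)"
    and mul_scale_right: "\<lbrakk>x \<in> kspace A; y \<in> kspace A\<rbrakk> \<Longrightarrow>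
      kmul A x (kscale A c y) = kscale A c (kmul A x y)"
    and mul_assoc: "\<lbrakk>x \<in> kspace A; y \<in> kspace A; z \<in> kspace A\<rbrakk> \<Longrightarrow>
      kmul A (kmul A x y) z = kmul A x (kmul A y z)"
    and one_left: "x \<in> kspace A \<Longrightarrow> kmul A (kone A) x = x"
    and one_right: "x \<in> kspace A \<Longrightarrow> kmul A x (kone A) = x"
begin

lemma zero_closed: "0 \<in> kspace A"
  by (rule subspace_0[OF subspace_kspace])

lemma add_closed: "\<lbrakk>x \<in> kspace A; y \<in> kspace A\<rbrakk> \<Longrightarrow> x + y \<in> kspace A"
  by (rule subspace_add[OF subspace_kspace])

lemma diff_closed: "\<lbrakk>x \<in> kspace A; y \<in> kspace A\<rbrakk> \<Longrightarrow> x - y \<in> kspace A"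
  by (rule subspace_diff[OF subspace_kspace])

lemma scale_closed: "x \<in> kspace A \<Longrightarrow> kscale A c x \<in> kspace A"
  by (rule subspace_scale[OF subspace_kspace])

lemma mul_zero_left: "x \<in> kspace A \<Longrightarrow> kmul A 0 x = 0"
  using mul_add_left[of 0 0 x] zero_closed by simp

lemma mul_zero_right: "x \<in> kspace A \<Longrightarrow> kmul A x 0 = 0"
  using mul_add_right[of x 0 0] zero_closed by simp

lemma mul_diff_left:
  "\<lbrakk>x \<in> kspace A; y \<in> kspace A; z \<in> kspace A\<rbrakk> \<Longrightarrow> kmul A (x - y) z = kmul A x z - kmul A y z"
  using mul_add_left[of "x - y" y z] diff_closed by (simp add: eq_diff_eq)

section \<open>Right ideals and the Jacobson radical\<close>

lemma one_mem_right_ideal: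
  assumes "right_ideal A I" and "kone A \<in> I"
  shows "I = kspace A"
proof
  show "kspace A \<subseteq> I"
  proof
    fix x assume "x \<in> kspace A"
    with assms have "kmul A (kone A) x \<in> I" by (simp add: right_ideal_def)
    with \<open>x \<in> kspace A\<close> show "x \<in> I" by (simp add: one_left)
  qed
qed (use assms in \<open>simp add: right_ideal_def\<close>)

lemma right_ideal_add:
  assumes "right_ideal A I" "x \<in> I" "y \<in> I"
  shows "x + y \<in> I"
proof -
  have "x - (0 - y) \<in> I" using assms unfolding right_ideal_def by blast
  then show ?thesis by simp
qed

text \<open>If N escaped a maximal right ideal I, then I + N would be everything and 1 = i + x with
  x in N nilpotent; but 1 - x in I forces 1 - x^k in I for all k, hence 1 in I. Powers are iterated
  left multiplications applied to \<open>kone A\<close>.\<close>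

lemma nil_right_ideal_le_jacobson:
  assumes N: "right_ideal A N"
    and nil: "\<And>x. x \<in> N \<Longrightarrow> \<exists>k. ((kmul A x) ^^ k) (kone A) = 0"
  shows "N \<subseteq> jacobson_radical A"
proof -
  have "N \<subseteq> I" if max: "maximal_right_ideal A I" for I
  proof (rule ccontr)
    assume not: "\<not> N \<subseteq> I"
    have I: "right_ideal A I" "I \<noteq> kspace A"
      using max by (auto simp: maximal_right_ideal_def)
    have sub: "I \<subseteq> kspace A" "N \<subseteq> kspace A" using I N by (auto simp: right_ideal_def)
    define S where "S = {x + y | x y. x \<in> I \<and> y \<in> N}"
    have SI: "x + y \<in> S" if "x \<in> I" "y \<in> N" for x y using that by (auto simp: S_def)
    have "right_ideal A S"
      unfolding right_ideal_def
    proof (intro conjI ballI)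
      show "S \<subseteq> kspace A" using sub by (auto simp: S_def intro!: add_closed)
      show "0 \<in> S" using SI[of 0 0] I N by (simp add: right_ideal_def)
    next
      fix a b assume "a \<in> S" "b \<in> S"
      then obtain x y x' y' where *: "a = x + y" "b = x' + y'" "x \<in> I" "y \<in> N" "x' \<in> I" "y' \<in> N"
        by (auto simp: S_def)
      then have "(x - x') + (y - y') \<in> S" using I N by (intro SI) (auto simp: right_ideal_def)
      then show "a - b \<in> S" by (simp add: * algebra_simps)
    next
      fix a r assume "a \<in> S" and r: "r \<in> kspace A"
      then obtain x y where *: "a = x + y" "x \<in> I" "y \<in> N" by (auto simp: S_def)
      with r have "kmul A x r + kmul A y r \<in> S" using I N by (intro SI) (auto simp: right_ideal_def)
      moreover have "kmul A a r = kmul A x r + kmul A y r"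
        unfolding *(1) by (rule mul_add_left) (use * r sub in auto)
      ultimately show "kmul A a r \<in> S" by simp
    qed
    moreover have "I \<subseteq> S" using SI[of _ 0] N by (auto simp: right_ideal_def)
    moreover have "S \<noteq> I"
    proof -
      from not obtain y where "y \<in> N" "y \<notin> I" by auto
      with SI[of 0 y] I show ?thesis by (auto simp: right_ideal_def)
    qed
    ultimately have "S = kspace A" using max by (auto simp: maximal_right_ideal_def)
    then have "kone A \<in> S" using one_closed by simp
    then obtain i x where ix: "kone A = i + x" "i \<in> I" "x \<in> N" by (auto simp: S_def)
    then have i: "i = kone A - x" and x: "x \<in> kspace A" using sub by auto
    have pw: "((kmul A x) ^^ k) (kone A) \<in> kspace A" for k
      by (induction k) (auto simp: one_closed mul_closed x)
    \<comment> \<open>Telescoping: (1 - x) x^k = x^k - x^(k+1) lies in the right ideal I, which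
      contains i = 1 - x.\<close>
    have "kone A - ((kmul A x) ^^ k) (kone A) \<in> I" for k
    proof (induction k)
      case 0
      then show ?case using I by (simp add: right_ideal_def)
    next
      case (Suc k)
      let ?p = "((kmul A x) ^^ k) (kone A)"
      have "kmul A i ?p \<in> I" using I ix pw by (simp add: right_ideal_def)
      also have "kmul A i ?p = ?p - kmul A x ?p"
        unfolding i by (simp add: mul_diff_left one_closed x pw one_left)
      finally have "(kone A - ?p) + (?p - kmul A x ?p) \<in> I"
        using Suc right_ideal_add[OF I(1)] by blast
      then show ?case by simp
    qed
    moreover obtain k where "((kmul A x) ^^ k) (kone A) = 0" using nil[OF ix(3)] by auto
    ultimately have "kone A \<in> I" by (metis diff_zero)
    with I one_mem_right_ideal show False by blast
  qed
  then show ?thesis using N by (auto simp: jacobson_radical_def right_ideal_def)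
qed

text \<open>Meant for the extension: the n-th power of a radical element falls into D(A), which
  squares to zero, so doubling the exponent suffices.\<close>

lemma nilpotent_if_pow_square_zero:
  assumes x: "x \<in> kspace A" and k: "((kmul A x) ^^ k) (kone A) = m" and m: "kmul A m m = 0"
  shows "((kmul A x) ^^ (k + k)) (kone A) = 0"
proof -
  have pw: "((kmul A x) ^^ j) (kone A) \<in> kspace A" for j
    by (induction j) (auto simp: one_closed mul_closed x)
  have "((kmul A x) ^^ (j + l)) (kone A) =
      kmul A (((kmul A x) ^^ j) (kone A)) (((kmul A x) ^^ l) (kone A))" for j l
    by (induction j) (simp_all add: one_left pw mul_assoc x)
  then show ?thesis using k m by simp
qed

end


section \<open>The dual bimodule and Hochschild extensions\<close>

context assoc_kalgebra
begin

lemma D_add: "\<lbrakk>\<phi> \<in> D A; x \<in> kspace A; y \<in> kspace A\<rbrakk> \<Longrightarrow> \<phi> (x + y) = \<phi> x + \<phi> y"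
  by (simp add: D_def dual_space_def k_linear_def)

lemma D_scale: "\<lbrakk>\<phi> \<in> D A; x \<in> kspace A\<rbrakk> \<Longrightarrow> \<phi> (kscale A c x) = c * \<phi> x"
  by (simp add: D_def dual_space_def k_linear_def)

lemma D_outside: "\<lbrakk>\<phi> \<in> D A; x \<notin> kspace A\<rbrakk> \<Longrightarrow> \<phi> x = 0"
  by (simp add: D_def dual_space_def)

lemma D_zero: "\<phi> \<in> D A \<Longrightarrow> \<phi> 0 = 0"
  using D_scale[of \<phi> 0 0] zero_closed by simp

lemma D_I:
  assumes "\<And>x y. \<lbrakk>x \<in> kspace A; y \<in> kspace A\<rbrakk> \<Longrightarrow> \<phi> (x + y) = \<phi> x + \<phi> y"
    and "\<And>c x. x \<in> kspace A \<Longrightarrow> \<phi> (kscale A c x) = c * \<phi> x"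
    and "\<And>x. x \<notin> kspace A \<Longrightarrow> \<phi> x = 0"
  shows "\<phi> \<in> D A"
  using assms by (auto simp: D_def dual_space_def k_linear_def)

lemma D_eqI:
  assumes "\<phi> \<in> D A" "\<psi> \<in> D A" "\<And>x. x \<in> kspace A \<Longrightarrow> \<phi> x = \<psi> x"
  shows "\<phi> = \<psi>"
  using assms D_outside by (metis ext)

lemma zero_mem_D: "0 \<in> D A"
  by (rule D_I) auto

lemma add_mem_D: "\<lbrakk>\<phi> \<in> D A; \<psi> \<in> D A\<rbrakk> \<Longrightarrow> \<phi> + \<psi> \<in> D A"
  by (rule D_I) (auto simp: D_add D_scale D_outside algebra_simps)

lemma fscale_mem_D: "\<phi> \<in> D A \<Longrightarrow> fscale c \<phi> \<in> D A"
  by (rule D_I) (auto simp: D_add D_scale D_outside fscale_def algebra_simps)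

lemma uminus_mem_D: "\<phi> \<in> D A \<Longrightarrow> - \<phi> \<in> D A"
  by (rule D_I) (auto simp: D_add D_scale D_outside)

lemma lact_mem_D: "\<lbrakk>a \<in> kspace A; \<phi> \<in> D A\<rbrakk> \<Longrightarrow> lact A a \<phi> \<in> D A"
  by (rule D_I)
    (auto simp: lact_def D_add D_scale mul_add_left mul_scale_left mul_closed add_closed scale_closed)

lemma ract_mem_D: "\<lbrakk>a \<in> kspace A; \<phi> \<in> D A\<rbrakk> \<Longrightarrow> ract A \<phi> a \<in> D A"
  by (rule D_I)
    (auto simp: ract_def D_add D_scale mul_add_right mul_scale_right mul_closed add_closed scale_closed)

lemma cocycle_mem_D:
  "\<lbrakk>\<alpha> \<in> cocycles2 A; a \<in> kspace A; b \<in> kspace A\<rbrakk> \<Longrightarrow> \<alpha> a b \<in> D A"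
  by (simp add: cocycles2_def k_linear_def)

lemma cocycle_add_left:
  "\<lbrakk>\<alpha> \<in> cocycles2 A; a \<in> kspace A; b \<in> kspace A; c \<in> kspace A\<rbrakk> \<Longrightarrow> \<alpha> (a + b) c = \<alpha> a c + \<alpha> b c"
  by (simp add: cocycles2_def k_linear_def)

lemma cocycle_add_right:
  "\<lbrakk>\<alpha> \<in> cocycles2 A; a \<in> kspace A; b \<in> kspace A; c \<in> kspace A\<rbrakk> \<Longrightarrow> \<alpha> a (b + c) = \<alpha> a b + \<alpha> a c"
  by (simp add: cocycles2_def k_linear_def)

lemma cocycle_scale_left:
  "\<lbrakk>\<alpha> \<in> cocycles2 A; a \<in> kspace A; b \<in> kspace A\<rbrakk> \<Longrightarrow> \<alpha> (kscale A c a) b = fscale c (\<alpha> a b)"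
  by (simp add: cocycles2_def k_linear_def)

lemma cocycle_scale_right:
  "\<lbrakk>\<alpha> \<in> cocycles2 A; a \<in> kspace A; b \<in> kspace A\<rbrakk> \<Longrightarrow> \<alpha> a (kscale A c b) = fscale c (\<alpha> a b)"
  by (simp add: cocycles2_def k_linear_def)

lemma cocycle_identity:
  "\<lbrakk>\<alpha> \<in> cocycles2 A; a \<in> kspace A; b \<in> kspace A; c \<in> kspace A\<rbrakk> \<Longrightarrow>
    lact A a (\<alpha> b c) + \<alpha> a (kmul A b c) = \<alpha> (kmul A a b) c + ract A (\<alpha> a b) c"
  by (simp add: cocycles2_def) (simp add: algebra_simps)

lemma cocycle_zero_left: "\<lbrakk>\<alpha> \<in> cocycles2 A; a \<in> kspace A\<rbrakk> \<Longrightarrow> \<alpha> 0 a = 0"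
  using cocycle_add_left[of \<alpha> 0 0 a] zero_closed by simp

lemma cocycle_zero_right: "\<lbrakk>\<alpha> \<in> cocycles2 A; a \<in> kspace A\<rbrakk> \<Longrightarrow> \<alpha> a 0 = 0"
  using cocycle_add_right[of \<alpha> a 0 0] zero_closed by simp

lemma lact_zero [simp]: "lact A a 0 = 0"
  by (auto simp: lact_def)

lemma ract_zero [simp]: "ract A 0 a = 0"
  by (auto simp: ract_def)

lemma lact_zero_left: "\<phi> \<in> D A \<Longrightarrow> lact A 0 \<phi> = 0"
  by (rule ext) (simp add: lact_def mul_zero_right D_zero)

lemma lact_add: "lact A a (\<phi> + \<psi>) = lact A a \<phi> + lact A a \<psi>"
  by (auto simp: lact_def)

lemma ract_add: "ract A (\<phi> + \<psi>) a = ract A \<phi> a + ract A \<psi> a"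
  by (auto simp: ract_def)

lemma lact_fscale: "lact A a (fscale c \<phi>) = fscale c (lact A a \<phi>)"
  by (auto simp: lact_def fscale_def)

lemma ract_fscale: "ract A (fscale c \<phi>) a = fscale c (ract A \<phi> a)"
  by (auto simp: ract_def fscale_def)

lemma lact_add_left:
  "\<lbrakk>a \<in> kspace A; b \<in> kspace A; \<phi> \<in> D A\<rbrakk> \<Longrightarrow> lact A (a + b) \<phi> = lact A a \<phi> + lact A b \<phi>"
  by (auto simp: lact_def mul_add_right D_add mul_closed)

lemma ract_add_right:
  "\<lbrakk>a \<in> kspace A; b \<in> kspace A; \<phi> \<in> D A\<rbrakk> \<Longrightarrow> ract A \<phi> (a + b) = ract A \<phi> a + ract A \<phi> b"
  by (auto simp: ract_def mul_add_left D_add mul_closed)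

lemma lact_scale_left:
  "\<lbrakk>a \<in> kspace A; \<phi> \<in> D A\<rbrakk> \<Longrightarrow> lact A (kscale A c a) \<phi> = fscale c (lact A a \<phi>)"
  by (auto simp: lact_def mul_scale_right D_scale mul_closed fscale_def)

lemma ract_scale_right:
  "\<lbrakk>a \<in> kspace A; \<phi> \<in> D A\<rbrakk> \<Longrightarrow> ract A \<phi> (kscale A c a) = fscale c (ract A \<phi> a)"
  by (auto simp: ract_def mul_scale_left D_scale mul_closed fscale_def)

lemma lact_lact:
  "\<lbrakk>a \<in> kspace A; b \<in> kspace A\<rbrakk> \<Longrightarrow> lact A a (lact A b \<phi>) = lact A (kmul A a b) \<phi>"
  by (auto simp: lact_def mul_closed mul_assoc)

lemma ract_ract:
  "\<lbrakk>a \<in> kspace A; b \<in> kspace A\<rbrakk> \<Longrightarrow> ract A (ract A \<phi> a) b = ract A \<phi> (kmul A a b)"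
  by (auto simp: ract_def mul_closed mul_assoc)

lemma ract_lact:
  "\<lbrakk>a \<in> kspace A; b \<in> kspace A\<rbrakk> \<Longrightarrow> ract A (lact A a \<phi>) b = lact A a (ract A \<phi> b)"
  by (auto simp: ract_def lact_def mul_closed mul_assoc)

lemma lact_one: "\<phi> \<in> D A \<Longrightarrow> lact A (kone A) \<phi> = \<phi>"
  by (auto simp: lact_def one_right D_outside)

lemma ract_one: "\<phi> \<in> D A \<Longrightarrow> ract A \<phi> (kone A) = \<phi>"
  by (auto simp: ract_def one_left D_outside)

text \<open>Beyond the bimodule laws, associativity is exactly the cocycle identity. For the unit,
  that identity at (1, 1, a) and (a, 1, 1) gives \<alpha>(1, a) = \<alpha>(1, 1) a and \<alpha>(a,
  1) = a \<alpha>(1, 1), which the second component of \<open>kone\<close> cancels.\<close>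

lemma assoc_kalgebra_hochschild_ext:
  assumes \<alpha>: "\<alpha> \<in> cocycles2 A"
  shows "assoc_kalgebra (hochschild_ext A \<alpha>)"
proof -
  interpret F: vector_space "fscale :: 'k \<Rightarrow> ('v \<Rightarrow> 'k) \<Rightarrow> 'v \<Rightarrow> 'k" by (rule vector_space_fscale)
  note \<alpha>simps = cocycle_add_left[OF \<alpha>] cocycle_add_right[OF \<alpha>] cocycle_scale_left[OF \<alpha>]
    cocycle_scale_right[OF \<alpha>] cocycle_mem_D[OF \<alpha>]
  note closed = mul_closed add_closed scale_closed one_closed lact_mem_D ract_mem_D add_mem_D fscale_mem_D uminus_mem_D
  interpret T: vector_space "kscale (hochschild_ext A \<alpha>)"
    by unfold_locales
      (auto simp: hochschild_ext_def scale_right_distrib scale_left_distrib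
        F.scale_right_distrib F.scale_left_distrib)
  show ?thesis
  proof (unfold_locales, goal_cases)
    case 1
    show ?case
        unfolding T.subspace_def
      by (auto simp: hochschild_ext_def zero_prod_def zero_closed zero_mem_D closed)
  next
    case (2 x y)
    then show ?case by (auto simp: hochschild_ext_def closed \<alpha>simps)
  next
    case 3
    then show ?case by (auto simp: hochschild_ext_def closed \<alpha>simps)
  next
    case (4 x y z)
    then show ?case
      by (auto simp: hochschild_ext_def mul_add_left lact_add_left ract_add \<alpha>simps)
  next
    case (5 x y z)
    then show ?case
      by (auto simp: hochschild_ext_def mul_add_right lact_add ract_add_right \<alpha>simps)
  next
    case (6 x y c)
    then show ?case
      by (auto simp: hochschild_ext_def mul_scale_left lact_scale_left ract_fscale \<alpha>simps
          F.scale_right_distrib)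
  next
    case (7 x y c)
    then show ?case
      by (auto simp: hochschild_ext_def mul_scale_right ract_scale_right lact_fscale \<alpha>simps
          F.scale_right_distrib)
  next
    case (8 x y z)
    then show ?case
    proof (cases x, cases y, cases z)
      fix a u b v c w
      assume [simp]: "x = (a, u)" "y = (b, v)" "z = (c, w)"
      from 8 have mem: "a \<in> kspace A" "b \<in> kspace A" "c \<in> kspace A" "u \<in> D A" "v \<in> D A" "w \<in> D A"
        by (auto simp: hochschild_ext_def)
      have "ract A (\<alpha> a b) c + \<alpha> (kmul A a b) c = lact A a (\<alpha> b c) + \<alpha> a (kmul A b c)"
        using cocycle_identity[OF \<alpha> mem(1-3)] by (simp add: add.commute)
      then show ?thesis
        using mem by (simp add: hochschild_ext_def mul_assoc lact_add ract_add lact_lact ract_ract ract_lact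
            add.assoc)
    qed
  next
    case (9 x)
    then obtain a u where [simp]: "x = (a, u)" and mem: "a \<in> kspace A" "u \<in> D A"
      by (auto simp: hochschild_ext_def)
    have "\<alpha> (kone A) a = ract A (\<alpha> (kone A) (kone A)) a"
      using cocycle_identity[OF \<alpha> one_closed one_closed mem(1)] mem
      by (simp add: one_left lact_one \<alpha>simps one_closed)
    moreover have "ract A (- \<phi>) a = - ract A \<phi> a" for \<phi> by (auto simp: ract_def)
    ultimately show ?case
      using mem by (simp add: hochschild_ext_def one_left lact_one)
  next
    case (10 x)
    then obtain a u where [simp]: "x = (a, u)" and mem: "a \<in> kspace A" "u \<in> D A"
      by (auto simp: hochschild_ext_def)
    have "\<alpha> a (kone A) = lact A a (\<alpha> (kone A) (kone A))"
      using cocycle_identity[OF \<alpha> mem(1) one_closed one_closed] mem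
      by (simp add: one_right one_left ract_one \<alpha>simps one_closed)
    moreover have "lact A a (- \<phi>) = - lact A a \<phi>" for \<phi> by (auto simp: lact_def)
    ultimately show ?case
      using mem by (simp add: hochschild_ext_def one_right ract_one)
  qed
qed

end

section \<open>Dimensions of quotients\<close>

lemma free_space_finite:
  assumes "finite M"
  shows "f \<in> free_space M \<longleftrightarrow> (\<forall>m. f m \<noteq> 0 \<longrightarrow> m \<in> M)"
proof -
  have "finite {m. f m \<noteq> 0}" if "\<forall>m. f m \<noteq> 0 \<longrightarrow> m \<in> M"
    using that by (intro finite_subset[OF _ assms]) auto
  then show ?thesis by (auto simp: free_space_def)
qed

lemma span_single:
  assumes "finite M"
  shows "module.span fscale (single ` M) = (free_space M :: ('m \<Rightarrow> 'k::field) set)"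
proof -
  interpret F: vector_space "fscale :: 'k \<Rightarrow> ('m \<Rightarrow> 'k) \<Rightarrow> 'm \<Rightarrow> 'k" by (rule vector_space_fscale)
  have "F.subspace (free_space M)"
    unfolding F.subspace_def
  proof (intro conjI ballI allI)
    fix x y :: "'m \<Rightarrow> 'k" assume "x \<in> free_space M" "y \<in> free_space M"
    then show "x + y \<in> free_space M"
      unfolding free_space_finite[OF assms] by (metis add_0 plus_fun_apply)
  next
    fix c and x :: "'m \<Rightarrow> 'k" assume "x \<in> free_space M"
    then show "fscale c x \<in> free_space M"
      unfolding free_space_finite[OF assms] by (auto simp: fscale_def)
  qed (simp add: free_space_def)
  moreover have "single ` M \<subseteq> free_space M"
    by (auto simp: free_space_def single_def split: if_splits)
  moreover have "x \<in> F.span (single ` M)" if x: "x \<in> free_space M" for x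
  proof -
    have "x = (\<Sum>m\<in>M. fscale (x m) (single m))"
    proof
      fix q
      have "(\<Sum>m\<in>M. fscale (x m) (single m)) q = (\<Sum>m\<in>M. if m = q then x m else 0)"
        by (subst sum_fun_apply) (auto simp: fscale_def single_def intro!: sum.cong)
      also have "\<dots> = x q" using assms x by (auto simp: sum.delta free_space_def)
      finally show "x q = (\<Sum>m\<in>M. fscale (x m) (single m)) q" by simp
    qed
    also have "\<dots> \<in> F.span (single ` M)"
      by (intro F.span_sum F.span_scale F.span_base) auto
    finally show ?thesis .
  qed
  ultimately show ?thesis using F.span_minimal by blast
qed

lemma inj_single: "inj_on (single :: 'm \<Rightarrow> 'm \<Rightarrow> 'k::field) M"
  by (rule inj_onI) (metis single_def zero_neq_one)

lemma independent_single:
  assumes "finite M"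
  shows "\<not> module.dependent fscale ((single :: 'm \<Rightarrow> 'm \<Rightarrow> 'k::field) ` M)"
proof -
  interpret F: vector_space "fscale :: 'k \<Rightarrow> ('m \<Rightarrow> 'k) \<Rightarrow> 'm \<Rightarrow> 'k" by (rule vector_space_fscale)
  show ?thesis
  proof (rule F.independent_if_scalars_zero)
    fix c :: "('m \<Rightarrow> 'k) \<Rightarrow> 'k" and x :: "'m \<Rightarrow> 'k"
    assume z: "(\<Sum>x\<in>single ` M. fscale (c x) x) = 0" and "x \<in> single ` M"
    then obtain m where m: "m \<in> M" "x = single m" by auto
    have "(\<Sum>x\<in>single ` M. fscale (c x) x) m = (\<Sum>k\<in>M. fscale (c (single k)) (single k)) m"
      by (subst sum.reindex[OF inj_single]) simp
    also have "\<dots> = (\<Sum>k\<in>M. if k = m then c (single k) else 0)"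
      by (subst sum_fun_apply) (auto simp: fscale_def single_def intro!: sum.cong)
    also have "\<dots> = c x" using m assms by (simp add: sum.delta)
    finally show "c x = 0" using z by simp
  qed (use assms in auto)
qed

text \<open>The functionals \<open>\<Phi> _ m\<close> have common kernel W and admit dual vectors,
  so they identify V/W with K^M. As \<open>dim_quot\<close> takes the cardinality of an unspecified
  basis, a basis must be exhibited and all bases must be shown to have \<open>card M\<close>
  elements.\<close>

lemma dim_quot_eq_card:
  fixes \<Phi> :: "'v::ab_group_add \<Rightarrow> 'm \<Rightarrow> 'k::field"
  assumes "vector_space s"
    and fin: "finite M"
    and V: "module.subspace s V"
    and add: "\<And>x y m. \<lbrakk>x \<in> V; y \<in> V; m \<in> M\<rbrakk> \<Longrightarrow> \<Phi> (x + y) m = \<Phi> x m + \<Phi> y m"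
    and scale: "\<And>c x m. \<lbrakk>x \<in> V; m \<in> M\<rbrakk> \<Longrightarrow> \<Phi> (s c x) m = c * \<Phi> x m"
    and W: "W = {x \<in> V. \<forall>m\<in>M. \<Phi> x m = 0}"
    and surj: "\<And>m. m \<in> M \<Longrightarrow> \<exists>x\<in>V. \<forall>m'\<in>M. \<Phi> x m' = (if m' = m then 1 else 0)"
  shows "dim_quot s V W = card M"
proof -
  interpret vector_space s by fact
  interpret F: vector_space "fscale :: 'k \<Rightarrow> ('m \<Rightarrow> 'k) \<Rightarrow> 'm \<Rightarrow> 'k" by (rule vector_space_fscale)
  have sumV: "(\<Sum>b\<in>B. s (c b) b) \<in> V" if "B \<subseteq> V" for B and c
    using that by (intro subspace_sum subspace_scale V) auto
  have \<Phi>0: "\<Phi> 0 m = 0" if "m \<in> M" for m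
    using scale[of 0 m 0] subspace_0[OF V] that by simp
  have diff: "\<Phi> (x - y) m = \<Phi> x m - \<Phi> y m" if "x \<in> V" "y \<in> V" "m \<in> M" for x y m
    using add[of "x - y" y m] subspace_diff[OF V] that by simp
  have sum: "\<Phi> (\<Sum>b\<in>B. s (c b) b) m = (\<Sum>b\<in>B. c b * \<Phi> b m)" if "finite B" "B \<subseteq> V" "m \<in> M" for B c m
    using that
  proof (induction B)
    case (insert b B)
    then have "\<Phi> (s (c b) b + (\<Sum>b\<in>B. s (c b) b)) m = \<Phi> (s (c b) b) m + \<Phi> (\<Sum>b\<in>B. s (c b) b) m"
      by (intro add sumV subspace_scale V) auto
    with insert show ?case by (simp add: scale)
  qed (simp add: \<Phi>0)
  \<comment> \<open>Values of \<open>\<Phi>\<close> off M are unconstrained; cutting them to zero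
    places \<open>\<Phi>' x\<close> in \<open>free_space M\<close> and turns membership in W into an
    equation of functions.\<close>
  define \<Phi>' where "\<Phi>' x m = (if m \<in> M then \<Phi> x m else 0)" for x m
  have memW: "x - (\<Sum>b\<in>B. s (c b) b) \<in> W \<longleftrightarrow> \<Phi>' x = (\<Sum>b\<in>B. fscale (c b) (\<Phi>' b))"
    if x: "x \<in> V" and B: "finite B" "B \<subseteq> V" for x B c
  proof -
    have "x - (\<Sum>b\<in>B. s (c b) b) \<in> W \<longleftrightarrow> (\<forall>m\<in>M. \<Phi> x m - \<Phi> (\<Sum>b\<in>B. s (c b) b) m = 0)"
      unfolding W using subspace_diff[OF V x sumV[OF B(2)]] diff[OF x sumV[OF B(2)]] by simp
    also have "\<dots> \<longleftrightarrow> (\<forall>m\<in>M. \<Phi> x m = (\<Sum>b\<in>B. c b * \<Phi> b m))"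
      using sum[OF B] by simp
    also have "\<dots> \<longleftrightarrow> \<Phi>' x = (\<Sum>b\<in>B. fscale (c b) (\<Phi>' b))"
      unfolding fun_eq_iff sum_fun_apply by (auto simp: \<Phi>'_def fscale_def)
    finally show ?thesis .
  qed
  have "\<exists>B. basis_mod s B V W"
  proof -
    from surj obtain w where w: "\<And>m. m \<in> M \<Longrightarrow> w m \<in> V"
      "\<And>m m'. \<lbrakk>m \<in> M; m' \<in> M\<rbrakk> \<Longrightarrow> \<Phi> (w m) m' = (if m' = m then 1 else 0)" by metis
    have inj: "inj_on w M" by (rule inj_onI) (metis w(2) zero_neq_one)
    have B: "finite (w ` M)" "w ` M \<subseteq> V" using fin w by auto
    have eval: "(\<Sum>b\<in>w ` M. fscale (c b) (\<Phi>' b)) = (\<lambda>m. if m \<in> M then c (w m) else 0)" for c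
    proof
      fix m
      have "(\<Sum>b\<in>w ` M. fscale (c b) (\<Phi>' b)) m = (\<Sum>k\<in>M. c (w k) * \<Phi>' (w k) m)"
        by (simp add: sum_fun_apply sum.reindex[OF inj] fscale_def)
      also have "\<dots> = (\<Sum>k\<in>M. if k = m then c (w k) else 0)"
        using w(2) by (intro sum.cong) (auto simp: \<Phi>'_def)
      finally show "(\<Sum>b\<in>w ` M. fscale (c b) (\<Phi>' b)) m = (if m \<in> M then c (w m) else 0)"
        using fin by (simp add: sum.delta)
    qed
    have "basis_mod s (w ` M) V W"
      unfolding basis_mod_def
    proof (intro conjI ballI B)
      fix v assume v: "v \<in> V"
      show "\<exists>!c. (\<forall>b. b \<notin> w ` M \<longrightarrow> c b = 0) \<and> v - (\<Sum>b\<in>w ` M. s (c b) b) \<in> W"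
        unfolding memW[OF v B] eval
      proof (rule ex1I[of _ "\<lambda>b. if b \<in> w ` M then \<Phi> v (the_inv_into M w b) else 0"])
        show "(\<forall>b. b \<notin> w ` M \<longrightarrow> (if b \<in> w ` M then \<Phi> v (the_inv_into M w b) else 0) = 0) \<and>
          \<Phi>' v = (\<lambda>m. if m \<in> M then
            if w m \<in> w ` M then \<Phi> v (the_inv_into M w (w m)) else 0 else 0)"
          by (auto simp: \<Phi>'_def the_inv_into_f_f[OF inj])
      next
        fix c assume c: "(\<forall>b. b \<notin> w ` M \<longrightarrow> c b = 0) \<and> \<Phi>' v = (\<lambda>m. if m \<in> M then c (w m) else 0)"
        then have "c (w m) = \<Phi> v m" if "m \<in> M" for m
          using that by (auto simp: \<Phi>'_def fun_eq_iff dest: spec[of _ m])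
        with c show "c = (\<lambda>b. if b \<in> w ` M then \<Phi> v (the_inv_into M w b) else 0)"
          by (intro ext) (auto simp: the_inv_into_f_f[OF inj])
      qed
    qed
    then show ?thesis ..
  qed
  moreover have "card B = card M" if basis: "basis_mod s B V W" for B
  proof -
    have B: "finite B" "B \<subseteq> V" using basis by (simp_all add: basis_mod_def)
    have ex1: "\<exists>!c. (\<forall>b. b \<notin> B \<longrightarrow> c b = 0) \<and> \<Phi>' v = (\<Sum>b\<in>B. fscale (c b) (\<Phi>' b))"
      if v: "v \<in> V" for v
      using conjunct2[OF conjunct2[OF basis[unfolded basis_mod_def]], THEN bspec, OF v]
      unfolding memW[OF v B] .
    have \<Phi>'0: "\<Phi>' 0 = 0" by (auto simp: \<Phi>'_def \<Phi>0)
    have zero: "c b = 0"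
      if "(\<Sum>b\<in>B. fscale (c b) (\<Phi>' b)) = 0" "b \<in> B" for c b
    proof -
      \<comment> \<open>Uniqueness in \<open>basis_mod\<close> concerns coefficients supported on B,
        so c is cut off before it is compared with the zero expansion of 0.\<close>
      let ?c = "\<lambda>b. if b \<in> B then c b else 0"
      have "(\<Sum>b\<in>B. fscale (?c b) (\<Phi>' b)) = 0" using that(1) by (auto cong: sum.cong)
      moreover have "\<exists>d. \<forall>c. (\<forall>b. b \<notin> B \<longrightarrow> c b = 0) \<and> \<Phi>' 0 = (\<Sum>b\<in>B. fscale (c b) (\<Phi>' b)) \<longrightarrow> c = d"
        using ex1[OF subspace_0[OF V]] by (elim ex1E exI)
      then obtain d where d: "\<And>c. (\<forall>b. b \<notin> B \<longrightarrow> c b = 0) \<and>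
          \<Phi>' 0 = (\<Sum>b\<in>B. fscale (c b) (\<Phi>' b)) \<Longrightarrow> c = d" by iprover
      ultimately have "?c = d" by (intro d) (simp add: \<Phi>'0)
      moreover have "(\<lambda>b. 0) = d" by (rule d) (simp add: \<Phi>'0)
      ultimately have "?c = (\<lambda>b. 0)" by simp
      with that(2) show ?thesis by (metis (full_types))
    qed
    have inj: "inj_on \<Phi>' B"
    proof (rule inj_onI, rule ccontr)
      fix x y assume xy: "x \<in> B" "y \<in> B" "\<Phi>' x = \<Phi>' y" "x \<noteq> y"
      \<comment> \<open>A collision would be a nontrivial relation between the images.\<close>
      let ?c = "\<lambda>b. if b = x then 1 else if b = y then - 1 else 0"
      have "(\<Sum>b\<in>B. fscale (?c b) (\<Phi>' b)) = (\<Sum>b\<in>{x, y}. fscale (?c b) (\<Phi>' b))"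
        using xy B by (intro sum.mono_neutral_right) (auto simp: fscale_def)
      also have "\<dots> = 0" using xy by (auto simp: fscale_def)
      finally show False using zero[of ?c x] xy by simp
    qed
    have "card (\<Phi>' ` B) = F.dim (F.span (\<Phi>' ` B))"
    proof -
      have "F.independent (\<Phi>' ` B)"
      proof (rule F.independent_if_scalars_zero)
        fix c x assume "(\<Sum>x\<in>\<Phi>' ` B. fscale (c x) x) = 0" and "x \<in> \<Phi>' ` B"
        then show "c x = 0"
          using zero[of "\<lambda>b. c (\<Phi>' b)"] by (auto simp: sum.reindex[OF inj])
      qed (use B in auto)
      then show ?thesis by (simp add: F.dim_eq_card_independent)
    qed
    also have "F.span (\<Phi>' ` B) = F.span (single ` M)"
    proof (rule antisym)
      have "\<Phi>' ` B \<subseteq> free_space M"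
        unfolding image_subset_iff free_space_finite[OF fin] by (simp add: \<Phi>'_def)
      then show "F.span (\<Phi>' ` B) \<subseteq> F.span (single ` M)"
        unfolding span_single[OF fin, symmetric] by (rule F.span_minimal) simp
      have "single m \<in> F.span (\<Phi>' ` B)" if m: "m \<in> M" for m
      proof -
        from surj[OF m] obtain x where x: "x \<in> V" "\<forall>m'\<in>M. \<Phi> x m' = (if m' = m then 1 else 0)" by auto
        then have "single m = \<Phi>' x" using m by (auto simp: \<Phi>'_def single_def)
        also obtain c where "\<Phi>' x = (\<Sum>b\<in>B. fscale (c b) (\<Phi>' b))" using ex1[OF x(1)] by auto
        also have "(\<Sum>b\<in>B. fscale (c b) (\<Phi>' b)) \<in> F.span (\<Phi>' ` B)"
          by (intro F.span_sum F.span_scale F.span_base) auto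
        finally show ?thesis .
      qed
      then show "F.span (single ` M) \<subseteq> F.span (\<Phi>' ` B)"
        by (intro F.span_minimal) auto
    qed
    also have "F.dim (F.span (single ` M)) = card M"
      using F.dim_eq_card_independent[OF independent_single[OF fin]]
      by (simp add: card_image[OF inj_single])
    finally show ?thesis by (simp add: card_image[OF inj])
  qed
  ultimately show ?thesis
    unfolding dim_quot_def by (metis someI)
qed


section \<open>Truncated path algebras\<close>

lemma ptarget_Nil [simp]: "ptarget G (u, []) = u"
  by (simp add: ptarget_def pre_digraph.awalk_verts.simps)

lemma ptarget_append [simp]: "ptarget G (u, es @ fs) = ptarget G (ptarget G (u, es), fs)"
  by (simp add: ptarget_def pre_digraph.awalk_verts_conv)

lemma ptarget_Cons [simp]: "ptarget G (u, e # es) = ptarget G (head G e, es)"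
  by (simp add: ptarget_def pre_digraph.awalk_verts_conv)

lemma ptarget_take_drop:
  "ptarget G (ptarget G (u, take k es), take l (drop k es)) = ptarget G (u, take (k + l) es)"
  by (simp add: take_add)

lemma (in wf_digraph) Nil_mem_paths [simp]: "(u, []) \<in> paths G \<longleftrightarrow> u \<in> verts G"
  by (auto simp: paths_def awalk_Nil_iff)

lemma (in wf_digraph) Cons_mem_paths [simp]:
  "(u, e # es) \<in> paths G \<longleftrightarrow> e \<in> arcs G \<and> tail G e = u \<and> (head G e, es) \<in> paths G"
  by (auto simp: paths_def awalk_Cons_iff)

lemma (in wf_digraph) ptarget_mem_verts: "p \<in> paths G \<Longrightarrow> ptarget G p \<in> verts G"
  by (cases p) (auto simp: paths_def ptarget_def)

lemma (in wf_digraph) source_mem_verts: "p \<in> paths G \<Longrightarrow> fst p \<in> verts G"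
  by (cases p) (auto simp: paths_def)

lemma (in wf_digraph) append_mem_paths:
  "(u, es @ fs) \<in> paths G \<longleftrightarrow> (u, es) \<in> paths G \<and> (ptarget G (u, es), fs) \<in> paths G"
  using path_splitE[OF wf_digraph_axioms, of u "es @ fs" "length es"]
    path_joinI[OF wf_digraph_axioms, of u es fs] by auto

locale trunc_path_algebra = fin_digraph G for G :: "('a, 'b) pre_digraph" +
  fixes n :: nat and A :: "('k::field, ('a, 'b) path \<Rightarrow> 'k) kalg"
  assumes A_def: "A = truncated_path_algebra G n"
begin

abbreviation "Sh \<equiv> short_paths G n"

lemma finite_short_paths: "finite Sh"
proof (rule finite_subset)
  show "Sh \<subseteq> verts G \<times> {es. set es \<subseteq> arcs G \<and> length es \<le> n}"
    by (auto simp: short_paths_def paths_def plen_def)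
  show "finite (verts G \<times> {es. set es \<subseteq> arcs G \<and> length es \<le> n})"
    by (intro finite_cartesian_product finite_lists_length_le) auto
qed

lemma kspace_eq: "kspace A = free_space Sh"
  by (simp add: A_def truncated_path_algebra_def)

lemma mem_kspace: "a \<in> kspace A \<longleftrightarrow> (\<forall>p. a p \<noteq> 0 \<longrightarrow> p \<in> Sh)"
  unfolding kspace_eq by (rule free_space_finite[OF finite_short_paths])

lemma kspace_ends:
  "\<lbrakk>a \<in> kspace A; a (u, es) \<noteq> 0\<rbrakk> \<Longrightarrow> u \<in> verts G \<and> ptarget G (u, es) \<in> verts G"
  using source_mem_verts[of "(u, es)"] ptarget_mem_verts[of "(u, es)"]
  by (auto simp: mem_kspace short_paths_def)

lemma kscale_eq: "kscale A = fscale"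
  by (simp add: A_def truncated_path_algebra_def)

lemma kmul_apply: "kmul A a b (u, es) = (if length es < n then
    \<Sum>k\<le>length es. a (u, take k es) * b (ptarget G (u, take k es), drop k es) else 0)"
  by (simp add: A_def truncated_path_algebra_def trunc_def path_mul_def plen_def)

lemma kone_apply: "kone A (u, es) = (if es = [] \<and> u \<in> verts G \<and> 0 < n then 1 else 0)"
proof -
  have "single (v, []) (u, es) = (if v = u then (if es = [] then 1 else 0) else (0::'k))" for v
    by (auto simp: single_def)
  then show ?thesis
    by (auto simp: A_def truncated_path_algebra_def trunc_def path_one_def plen_def sum_fun_apply sum.delta)
qed

lemma kmul_mem: 
  assumes "a \<in> kspace A" "b \<in> kspace A" shows "kmul A a b \<in> kspace A"
  unfolding mem_kspace
proof (intro allI impI)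
  fix p assume nz: "kmul A a b p \<noteq> 0"
  obtain u es where [simp]: "p = (u, es)" by (cases p)
  from nz have len: "length es < n" by (auto simp: kmul_apply split: if_splits)
  with nz have "(\<Sum>k\<le>length es. a (u, take k es) * b (ptarget G (u, take k es), drop k es)) \<noteq> 0"
    by (simp add: kmul_apply)
  then obtain k where "a (u, take k es) * b (ptarget G (u, take k es), drop k es) \<noteq> 0"
    by (auto elim: sum.not_neutral_contains_not_neutral)
  with assms have "(u, take k es) \<in> paths G" "(ptarget G (u, take k es), drop k es) \<in> paths G"
    by (auto simp: mem_kspace short_paths_def)
  then have "(u, take k es @ drop k es) \<in> paths G" by (simp only: append_mem_paths)
  then show "p \<in> Sh" using len by (simp add: short_paths_def plen_def)
qed

text \<open>Both sides sum over all ways to cut \<open>es\<close> into three consecutive pieces, at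
  k and k + l; only the order of summation differs. Truncation is harmless because pieces of a short
  path are short.\<close>

lemma kmul_assoc: "kmul A (kmul A a b) c = kmul A a (kmul A b c)"
proof
  fix p :: "('a, 'b) path"
  obtain u es where [simp]: "p = (u, es)" by (cases p)
  show "kmul A (kmul A a b) c p = kmul A a (kmul A b c) p"
  proof (cases "length es < n")
    case len: True
    define T where "T k l = a (u, take k es) * b (ptarget G (u, take k es), take l (drop k es)) *
      c (ptarget G (u, take (k + l) es), drop (k + l) es)" for k l
    let ?N = "length es"
    have "kmul A (kmul A a b) c p = (\<Sum>m\<le>?N. (\<Sum>k\<le>m. T k (m - k)))"
      using len
      by (auto simp: kmul_apply T_def sum_distrib_right min_def drop_take mult.assoc
          intro!: sum.cong)
    also have "\<dots> = (\<Sum>k\<le>?N. \<Sum>l\<le>?N - k. T k l)"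
    proof -
      have "(\<Sum>k\<le>?N. \<Sum>l\<le>?N - k. T k l) = sum (\<lambda>(k, l). T k l) (SIGMA k:{..?N}. {..?N - k})"
        by (rule sum.Sigma) auto
      also have "(SIGMA k:{..?N}. {..?N - k}) = {(k, l). k + l \<le> ?N}" by auto
      finally show ?thesis by (simp add: sum.triangle_reindex_eq)
    qed
    also have "\<dots> = kmul A a (kmul A b c) p"
      using len
      by (auto simp: kmul_apply T_def sum_distrib_left ptarget_take_drop mult.assoc add.commute
          intro!: sum.cong)
    finally show ?thesis .
  qed (simp add: kmul_apply)
qed

sublocale assoc_kalgebra A
proof -
  have ks: "kscale A = fscale" by (rule kscale_eq)
  interpret F: vector_space "fscale :: 'k \<Rightarrow> (('a, 'b) path \<Rightarrow> 'k) \<Rightarrow> ('a, 'b) path \<Rightarrow> 'k"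
    by (rule vector_space_fscale)
  interpret V: vector_space "kscale A" by (simp add: ks vector_space_fscale)
  show "assoc_kalgebra A"
  proof (unfold_locales, goal_cases)
    case 1
    show ?case
      unfolding ks F.subspace_def mem_kspace
    proof (intro conjI ballI allI impI)
      fix x y p assume "x \<in> kspace A" "y \<in> kspace A" "(x + y) p \<noteq> 0"
      then show "p \<in> Sh" unfolding mem_kspace by (metis add_0 plus_fun_apply)
    next
      fix c x p assume "x \<in> kspace A" "fscale c x p \<noteq> 0"
      then show "p \<in> Sh" unfolding mem_kspace by (auto simp: fscale_def simp del: split_paired_All)
    qed simp
  next
    case (2 x y)
    then show ?case by (rule kmul_mem)
  next
    case 3
    show ?case
      by (auto simp: mem_kspace kone_apply short_paths_def plen_def split: if_splits)
  next
    case (4 x y z)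
    show ?case by (auto simp: fun_eq_iff kmul_apply algebra_simps sum.distrib)
  next
    case (5 x y z)
    show ?case by (auto simp: fun_eq_iff kmul_apply algebra_simps sum.distrib)
  next
    case (6 x y c)
    show ?case by (auto simp: fun_eq_iff kmul_apply ks fscale_def algebra_simps sum_distrib_left)
  next
    case (7 x y c)
    show ?case by (auto simp: fun_eq_iff kmul_apply ks fscale_def algebra_simps sum_distrib_left)
  next
    case (8 x y z)
    show ?case by (rule kmul_assoc)
  next
    case (9 x)
    show ?case
    proof
      fix p :: "('a, 'b) path"
      obtain u es where [simp]: "p = (u, es)" by (cases p)
      show "kmul A (kone A) x p = x p"
      proof (cases "x p = 0 \<and> \<not> length es < n")
        case False
        with 9 have len: "length es < n" by (auto simp: mem_kspace short_paths_def plen_def)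
        then have "kmul A (kone A) x p =
            (\<Sum>k\<le>length es. kone A (u, take k es) * x (ptarget G (u, take k es), drop k es))"
          by (simp add: kmul_apply)
        also have "\<dots> = (\<Sum>k\<in>{0}. kone A (u, take k es) * x (ptarget G (u, take k es), drop k es))"
          by (intro sum.mono_neutral_right) (auto simp: kone_apply)
        also have "\<dots> = x p"
          using kspace_ends[OF 9, of u es] len by (auto simp: kone_apply)
        finally show ?thesis .
      qed (simp add: kmul_apply)
    qed
  next
    case (10 x)
    show ?case
    proof
      fix p :: "('a, 'b) path"
      obtain u es where [simp]: "p = (u, es)" by (cases p)
      show "kmul A x (kone A) p = x p"
      proof (cases "x p = 0 \<and> \<not> length es < n")
        case False
        with 10 have len: "length es < n" by (auto simp: mem_kspace short_paths_def plen_def)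
        then have "kmul A x (kone A) p =
            (\<Sum>k\<le>length es. x (u, take k es) * kone A (ptarget G (u, take k es), drop k es))"
          by (simp add: kmul_apply)
        also have "\<dots> = (\<Sum>k\<in>{length es}. x (u, take k es) * kone A (ptarget G (u, take k es), drop k es))"
          by (intro sum.mono_neutral_right) (auto simp: kone_apply)
        also have "\<dots> = x p"
          using kspace_ends[OF 10, of u es] len by (auto simp: kone_apply)
        finally show ?thesis .
      qed (simp add: kmul_apply)
    qed
  qed
qed

end

section \<open>Products with basis paths, and dual bases\<close>

lemma single_apply [simp]: "single p q = (if q = p then 1 else 0)"
  by (simp add: single_def)

context trunc_path_algebra
begin

lemma single_mem: "p \<in> Sh \<Longrightarrow> single p \<in> kspace A"
  by (simp add: mem_kspace del: split_paired_All)

lemma kmul_single_left: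
  "kmul A (single (v, fs)) a (u, es) =
    (if u = v \<and> length fs \<le> length es \<and> take (length fs) es = fs \<and> length es < n
     then a (ptarget G (v, fs), drop (length fs) es) else 0)"
proof (cases "u = v \<and> length fs \<le> length es \<and> take (length fs) es = fs \<and> length es < n")
  case True
  have "(\<Sum>k\<le>length es. single (v, fs) (u, take k es) * a (ptarget G (u, take k es), drop k es)) =
      (\<Sum>k\<in>{length fs}. single (v, fs) (u, take k es) * a (ptarget G (u, take k es), drop k es))"
    using True by (intro sum.mono_neutral_right) auto
  then show ?thesis using True by (simp add: kmul_apply)
next
  case False
  have "single (v, fs) (u, take k es) * a (ptarget G (u, take k es), drop k es) = 0"
    if "length es < n" "k \<le> length es" for k
    using that False by auto
  then show ?thesis using False by (auto simp: kmul_apply intro!: sum.neutral)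
qed

lemma kmul_single_right:
  "kmul A a (single (v, fs)) (u, es) =
    (if length fs \<le> length es \<and> drop (length es - length fs) es = fs \<and>
        ptarget G (u, take (length es - length fs) es) = v \<and> length es < n
     then a (u, take (length es - length fs) es) else 0)"
proof (cases "length fs \<le> length es \<and> drop (length es - length fs) es = fs \<and>
        ptarget G (u, take (length es - length fs) es) = v \<and> length es < n")
  case True
  have "(\<Sum>k\<le>length es. a (u, take k es) * single (v, fs) (ptarget G (u, take k es), drop k es)) =
      (\<Sum>k\<in>{length es - length fs}. a (u, take k es) * single (v, fs) (ptarget G (u, take k es), drop k es))"
  proof (intro sum.mono_neutral_right ballI)
    fix k assume "k \<in> {..length es} - {length es - length fs}"
    then have "length (drop k es) \<noteq> length fs" by auto
    then have "drop k es \<noteq> fs" by blast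
    then show "a (u, take k es) * single (v, fs) (ptarget G (u, take k es), drop k es) = 0"
      by simp
  qed auto
  then show ?thesis using True by (simp add: kmul_apply)
next
  case False
  have "a (u, take k es) * single (v, fs) (ptarget G (u, take k es), drop k es) = 0"
    if "length es < n" "k \<le> length es" for k
  proof (cases "ptarget G (u, take k es) = v \<and> drop k es = fs")
    case True
    then have "length es - length fs = k" using that(2) by auto
    with True False that show ?thesis by auto
  qed auto
  then show ?thesis using False by (auto simp: kmul_apply intro!: sum.neutral)
qed

lemma kmul_single_single:
  assumes "length es + length fs < n"
  shows "kmul A (single (u, es)) (single (ptarget G (u, es), fs)) = single (u, es @ fs)"
proof -
  have "path_mul G (single (u, es)) (single (ptarget G (u, es), fs)) = (single (u, es @ fs) :: _ \<Rightarrow> 'k)"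
    using path_mul_single[of G u es 1 fs] by (simp only: fscale_one)
  then show ?thesis
    using assms by (auto simp: A_def truncated_path_algebra_def trunc_def plen_def)
qed

lemma kmul_trivial_left:
  "a \<in> kspace A \<Longrightarrow> kmul A (single (v, [])) a (u, es) = (if u = v then a (u, es) else 0)"
  by (auto simp: kmul_single_left mem_kspace short_paths_def plen_def)

lemma kmul_trivial_right:
  "a \<in> kspace A \<Longrightarrow> kmul A a (single (v, [])) (u, es) = (if ptarget G (u, es) = v then a (u, es) else 0)"
  by (auto simp: kmul_single_right mem_kspace short_paths_def plen_def)

lemma kone_eq: "0 < n \<Longrightarrow> kone A = (\<Sum>v\<in>verts G. single (v, []))"
proof
  fix p :: "('a, 'b) path"
  obtain u es where [simp]: "p = (u, es)" by (cases p)
  have "single (v, []) (u, es) = (if v = u then (if es = [] then 1 else 0) else (0::'k))" for v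
    by (auto simp: single_def)
  then show "kone A p = (\<Sum>v\<in>verts G. single (v, [])) p" if "0 < n"
    using that by (simp add: kone_apply sum_fun_apply sum.delta del: single_apply)
qed

lemma kspace_expansion:
  assumes "a \<in> kspace A"
  shows "a = (\<Sum>p\<in>Sh. fscale (a p) (single p))"
proof
  fix q
  have "(\<Sum>p\<in>Sh. fscale (a p) (single p)) q = (\<Sum>p\<in>Sh. if p = q then a p else 0)"
    by (subst sum_fun_apply) (auto simp: fscale_def intro!: sum.cong)
  also have "\<dots> = a q"
    using assms finite_short_paths by (auto simp: sum.delta mem_kspace simp del: split_paired_All)
  finally show "a q = (\<Sum>p\<in>Sh. fscale (a p) (single p)) q" by simp
qed

lemma sum_mem_kspace: "(\<And>i. i \<in> I \<Longrightarrow> f i \<in> kspace A) \<Longrightarrow> (\<Sum>i\<in>I. f i) \<in> kspace A"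
  by (rule subspace_sum[OF subspace_kspace])

lemma D_sum:
  assumes "\<phi> \<in> D A" and "\<And>i. i \<in> I \<Longrightarrow> f i \<in> kspace A"
  shows "\<phi> (\<Sum>i\<in>I. f i) = (\<Sum>i\<in>I. \<phi> (f i))"
  using assms(2)
  by (induction I rule: infinite_finite_induct)
    (auto simp: D_zero[OF assms(1)] D_add[OF assms(1)] sum_mem_kspace)

lemma D_expansion:
  assumes "\<phi> \<in> D A" and a: "a \<in> kspace A"
  shows "\<phi> a = (\<Sum>p\<in>Sh. a p * \<phi> (single p))"
proof -
  have "\<phi> a = \<phi> (\<Sum>p\<in>Sh. fscale (a p) (single p))" using kspace_expansion[OF a] by simp
  also have "\<dots> = (\<Sum>p\<in>Sh. \<phi> (fscale (a p) (single p)))"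
    by (rule D_sum[OF assms(1)]) (use scale_closed single_mem in \<open>auto simp: kscale_eq\<close>)
  also have "\<dots> = (\<Sum>p\<in>Sh. a p * \<phi> (single p))"
    using D_scale[OF assms(1)] single_mem by (intro sum.cong) (auto simp: kscale_eq)
  finally show ?thesis .
qed

lemma dual_basis_mem_D: "dual_basis Sh p \<in> D A"
  by (rule D_I) (auto simp: dual_basis_def kspace_eq[symmetric] add_closed scale_closed, simp add: kscale_eq fscale_def)

lemma dual_basis_apply: "a \<in> kspace A \<Longrightarrow> dual_basis Sh p a = a p"
  by (simp add: dual_basis_def kspace_eq)

section \<open>The radical of the truncated path algebra and of its extensions\<close>

text \<open>The image of the arrow ideal in A.\<close>

definition radical :: "(('a, 'b) path \<Rightarrow> 'k) set" where
  "radical = {a \<in> kspace A. \<forall>u. a (u, []) = 0}"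

text \<open>A left factor without trivial paths consumes at least one arrow, so the lowest length
  occurring in b goes up by one. Iteration makes a^n zero.\<close>

lemma kmul_vanish:
  assumes a: "a \<in> radical" and b: "\<forall>u es. length es < k \<longrightarrow> b (u, es) = 0" and "length es \<le> k"
  shows "kmul A a b (u, es) = 0"
proof -
  have "a (u, take l es) * b (ptarget G (u, take l es), drop l es) = 0" if "l \<le> length es" for l
    using a b assms(3) that by (cases "l = 0") (auto simp: radical_def)
  then show ?thesis by (auto simp: kmul_apply intro!: sum.neutral)
qed

lemma kmul_radical_vanish:
  assumes "a \<in> radical" "b \<in> radical" "length es \<le> 1"
  shows "kmul A a b (u, es) = 0"
  using assms by (intro kmul_vanish[of a 1 b]) (auto simp: radical_def)

lemma kmul_Nil: "kmul A a b (u, []) = (if 0 < n then a (u, []) * b (u, []) else 0)"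
  by (simp add: kmul_apply)

lemma kmul_radical_left: "\<lbrakk>a \<in> radical; b \<in> kspace A\<rbrakk> \<Longrightarrow> kmul A a b \<in> radical"
  by (auto simp: radical_def kmul_mem kmul_Nil)

lemma kmul_radical_right: "\<lbrakk>a \<in> kspace A; b \<in> radical\<rbrakk> \<Longrightarrow> kmul A a b \<in> radical"
  by (auto simp: radical_def kmul_mem kmul_Nil)

lemma radical_pow_vanish:
  assumes "a \<in> radical"
  shows "length es < k \<Longrightarrow> ((kmul A a) ^^ k) (kone A) (u, es) = 0"
proof (induction k arbitrary: u es)
  case (Suc k)
  then show ?case by (auto intro!: kmul_vanish[OF assms, of k])
qed simp

lemma radical_pow_zero:
  assumes "a \<in> radical"
  shows "((kmul A a) ^^ n) (kone A) = 0"
proof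
  fix p :: "('a, 'b) path"
  obtain u es where [simp]: "p = (u, es)" by (cases p)
  have "((kmul A a) ^^ k) (kone A) \<in> kspace A" for k
    using assms by (induction k) (auto simp: one_closed mul_closed radical_def)
  then show "((kmul A a) ^^ n) (kone A) p = 0 p"
    using radical_pow_vanish[OF assms, of es n u]
    by (cases "length es < n") (auto simp: mem_kspace short_paths_def plen_def)
qed

text \<open>An idempotent equals its positive powers, and a^n = 0. For n = 0 there are no short
  paths and A itself is zero.\<close>

lemma radical_idempotent:
  assumes "a \<in> radical" and "kmul A a a = a"
  shows "a = 0"
proof -
  have "a \<in> kspace A" using assms by (simp add: radical_def)
  then have "((kmul A a) ^^ Suc k) (kone A) = a" for k
    by (induction k) (simp_all add: one_right assms(2))
  then have "((kmul A a) ^^ n) (kone A) = a \<or> n = 0" by (cases n) auto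
  moreover have "a = 0" if "n = 0"
    using that \<open>a \<in> kspace A\<close> by (auto simp: mem_kspace short_paths_def)
  ultimately show ?thesis using radical_pow_zero[OF assms(1)] by auto
qed

text \<open>One more arrow would bring the length to n, so longest paths lie in both socles of
  A.\<close>

lemma kmul_long_radical:
  assumes "a \<in> radical" and "plen p = n - 1" and "0 < n"
  shows "kmul A (single p) a = 0" and "kmul A a (single p) = 0"
proof -
  obtain v fs where p: "p = (v, fs)" by (cases p)
  have fs: "length es - length fs = 0" if "length es < n" for es :: "'b list"
    using that assms(2) by (simp add: p plen_def)
  show "kmul A (single p) a = 0"
  proof
    fix q :: "('a, 'b) path"
    obtain u es where "q = (u, es)" by (cases q)
    then show "kmul A (single p) a q = 0 q"
      using assms(1) fs[of es] by (auto simp: p kmul_single_left radical_def)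
  qed
  show "kmul A a (single p) = 0"
  proof
    fix q :: "('a, 'b) path"
    obtain u es where "q = (u, es)" by (cases q)
    then show "kmul A a (single p) q = 0 q"
      using assms(1) fs[of es] by (auto simp: p kmul_single_right radical_def)
  qed
qed

lemma trivial_path_mem: "\<lbrakk>v \<in> verts G; 0 < n\<rbrakk> \<Longrightarrow> trivial_path v \<in> kspace A"
  by (auto simp: trivial_path_def short_paths_def plen_def intro!: single_mem)

lemma trivial_path_mul:
  "0 < n \<Longrightarrow> kmul A (trivial_path u) (trivial_path v) = (if u = v then trivial_path u else 0)"
proof
  fix q :: "('a, 'b) path"
  obtain w es where "q = (w, es)" by (cases q)
  then show "kmul A (trivial_path u) (trivial_path v) q = (if u = v then trivial_path u else 0) q" if "0 < n"
    using that by (auto simp: trivial_path_def kmul_single_left)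
qed

text \<open>At each vertex the coefficients of f and g have product 0, and their sum is 1 at v and 0
  elsewhere. So one of f, g has no trivial component at all; it is an idempotent of the arrow ideal
  and vanishes.\<close>

lemma trivial_path_split:
  assumes n: "0 < n" and f: "idempotent A f" and g: "idempotent A g" and fg: "kmul A f g = 0"
    and sum: "trivial_path v = f + g"
  shows "f = 0 \<or> g = 0"
proof -
  have idem: "h (u, []) * h (u, []) = h (u, [])" if "idempotent A h" for h u
    using that kmul_Nil[of h h u] n by (auto simp: idempotent_def)
  have prod: "f (u, []) * g (u, []) = 0" for u
    using kmul_Nil[of f g u] n fg by simp
  have add: "f (u, []) + g (u, []) = (if u = v then 1 else 0)" for u
    using fun_cong[OF sum, of "(u, [])"] by (simp add: trivial_path_def)
  have other: "f (u, []) = 0 \<and> g (u, []) = 0" if "u \<noteq> v" for u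
    using prod[of u] add[of u] that by auto
  have "(\<forall>u. f (u, []) = 0) \<or> (\<forall>u. g (u, []) = 0)"
  proof (cases "f (v, []) = 0")
    case True
    then show ?thesis using other by metis
  next
    case False
    then have "g (v, []) = 0" using prod[of v] by simp
    then show ?thesis using other by metis
  qed
  then have "f \<in> radical \<or> g \<in> radical" using f g by (auto simp: radical_def idempotent_def)
  then show ?thesis using radical_idempotent f g by (auto simp: idempotent_def)
qed

end

section \<open>The radical and the primitive idempotents of the extension\<close>

locale trunc_path_extension = trunc_path_algebra G n A
  for G :: "('a, 'b) pre_digraph" and n and A :: "('k::field, ('a, 'b) path \<Rightarrow> 'k) kalg" +
  fixes \<alpha> :: "(('a, 'b) path \<Rightarrow> 'k) \<Rightarrow> (('a, 'b) path \<Rightarrow> 'k) \<Rightarrow> (('a, 'b) path \<Rightarrow> 'k) \<Rightarrow> 'k"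
    and T :: "('k, (('a, 'b) path \<Rightarrow> 'k) \<times> ((('a, 'b) path \<Rightarrow> 'k) \<Rightarrow> 'k)) kalg"
  assumes cocycle: "\<alpha> \<in> cocycles2 A" and n_pos: "0 < n"
    and T_def: "T = hochschild_ext A \<alpha>"
begin

sublocale T: assoc_kalgebra T
  unfolding T_def by (rule assoc_kalgebra_hochschild_ext[OF cocycle])

lemma T_mem: "y \<in> kspace T \<longleftrightarrow> fst y \<in> kspace A \<and> snd y \<in> D A"
  by (cases y) (simp add: T_def hochschild_ext_def)

lemma T_scale: "kscale T c y = (fscale c (fst y), fscale c (snd y))"
  by (cases y) (simp add: T_def hochschild_ext_def kscale_eq)

lemma T_mul: "kmul T y z = (kmul A (fst y) (fst z),
    lact A (fst y) (snd z) + ract A (snd y) (fst z) + \<alpha> (fst y) (fst z))"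
  by (cases y, cases z) (simp add: T_def hochschild_ext_def)

lemma T_one: "kone T = (kone A, - \<alpha> (kone A) (kone A))"
  by (simp add: T_def hochschild_ext_def)

lemma T_mul_zero_zero: "\<lbrakk>x \<in> D A; y \<in> D A\<rbrakk> \<Longrightarrow> kmul T (0, x) (0, y) = 0"
  using cocycle_zero_left[OF cocycle zero_closed] zero_closed
  by (auto simp: T_mul zero_prod_def mul_zero_left lact_def ract_def D_zero mul_zero_right fun_eq_iff)

definition rad_ext :: "((('a, 'b) path \<Rightarrow> 'k) \<times> ((('a, 'b) path \<Rightarrow> 'k) \<Rightarrow> 'k)) set" where
  "rad_ext = radical \<times> D A"

lemma rad_ext_right_ideal: "right_ideal T rad_ext"
  unfolding right_ideal_def
proof (intro conjI ballI)
  show "rad_ext \<subseteq> kspace T" by (auto simp: rad_ext_def T_mem radical_def)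
  then have sub: "y \<in> kspace T" if "y \<in> rad_ext" for y using that by auto
  show "0 \<in> rad_ext" by (simp add: rad_ext_def zero_prod_def radical_def zero_closed zero_mem_D)
  fix x assume x: "x \<in> rad_ext"
  show "x - y \<in> rad_ext" if "y \<in> rad_ext" for y
    using x that T.diff_closed[OF sub[OF x] sub[OF that]]
    by (auto simp: rad_ext_def T_mem radical_def)
  show "kmul T x r \<in> rad_ext" if "r \<in> kspace T" for r
    using x that T.mul_closed[OF sub[OF x] that] kmul_radical_left
    by (auto simp: rad_ext_def T_mem T_mul)
qed

text \<open>One inclusion holds because elements of \<open>rad_ext\<close> are nilpotent: the n-th
  power lands in D(A), which squares to zero. For the other, each vertex yields a maximal right
  ideal, and the radical lies in all of them.\<close>

lemma jacobson_radical_eq: "jacobson_radical T = rad_ext"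
proof
  show "rad_ext \<subseteq> jacobson_radical T"
  proof (rule T.nil_right_ideal_le_jacobson[OF rad_ext_right_ideal])
    fix y assume y: "y \<in> rad_ext"
    have "fst (((kmul T y) ^^ k) (kone T)) = ((kmul A (fst y)) ^^ k) (kone A)" for k
      by (induction k) (auto simp: T_mul T_one)
    then have "fst (((kmul T y) ^^ n) (kone T)) = 0"
      using y radical_pow_zero by (auto simp: rad_ext_def)
    then obtain x where x: "((kmul T y) ^^ n) (kone T) = (0, x)" by (metis prod.collapse)
    have yT: "y \<in> kspace T" using y rad_ext_right_ideal by (auto simp: right_ideal_def)
    have "((kmul T y) ^^ k) (kone T) \<in> kspace T" for k
      by (induction k) (auto simp: T.one_closed T.mul_closed yT)
    from this[of n] have "x \<in> D A" by (simp add: x T_mem)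
    from T_mul_zero_zero[OF this this]
    have "kmul T (0, x) (0, x) = 0" .
    from T.nilpotent_if_pow_square_zero[OF yT x this]
    show "\<exists>k. ((kmul T y) ^^ k) (kone T) = 0" by blast
  qed
  show "jacobson_radical T \<subseteq> rad_ext"
  proof
    fix y assume y: "y \<in> jacobson_radical T"
    then have yT: "y \<in> kspace T" by (simp add: jacobson_radical_def)
    have "fst y (v, []) = 0" if v: "v \<in> verts G" for v
    proof -
      \<comment> \<open>The kernel of the character reading off the coefficient at v; it has
        codimension one, hence is maximal.\<close>
      define I where "I = {z \<in> kspace T. fst z (v, []) = 0}"
      have I: "right_ideal T I"
        unfolding right_ideal_def I_def
        by (auto simp: T.zero_closed T.diff_closed T.mul_closed) (auto simp: T_mul kmul_Nil)
      have v1: "kone A (v, []) = 1" using v n_pos by (simp add: kone_apply)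
      have "J = I \<or> J = kspace T" if J: "right_ideal T J" "I \<subseteq> J" for J
      proof (cases "J = I")
        case False
        with J obtain z where z: "z \<in> J" "fst z (v, []) \<noteq> 0" "z \<in> kspace T"
          by (auto simp: I_def right_ideal_def)
        \<comment> \<open>Scaled to have coefficient one at v, z differs from 1 by an element of I,
          so that 1 lies in J.\<close>
        let ?c = "inverse (fst z (v, []))"
        have "kmul T z (kscale T ?c (kone T)) \<in> J"
          using J z T.scale_closed[OF T.one_closed] by (simp add: right_ideal_def)
        then have cz: "kscale T ?c z \<in> J"
          using z by (simp add: T.mul_scale_right T.one_closed T.one_right)
        moreover have "kone T - kscale T ?c z \<in> I"
          using z v1 T.diff_closed[OF T.one_closed T.scale_closed[OF z(3)]]
          by (simp add: I_def) (simp add: T_scale T_one fscale_def)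
        ultimately have "(kone T - kscale T ?c z) + kscale T ?c z \<in> J"
          using T.right_ideal_add[OF J(1)] J(2) by blast
        then show ?thesis using T.one_mem_right_ideal[OF J(1)] by simp
      qed simp
      moreover have "kone T \<notin> I" by (simp add: I_def T_one v1)
      ultimately have "maximal_right_ideal T I"
        using I T.one_closed by (auto simp: maximal_right_ideal_def)
      then have "y \<in> I" using y by (auto simp: jacobson_radical_def)
      then show ?thesis by (simp add: I_def)
    qed
    moreover have "fst y (v, []) = 0" if "v \<notin> verts G" for v
      using yT that kspace_ends[of "fst y" v "[]"] by (auto simp: T_mem)
    ultimately show "y \<in> rad_ext"
      using yT by (cases y) (auto simp: rad_ext_def T_mem radical_def)
  qed
qed

text \<open>A decomposition of e projects to one of the trivial path, so one summand has first
  component 0. That summand is an idempotent of D(A), where all products vanish.\<close>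

lemma primitive_lift:
  assumes v: "v \<in> verts G" and e: "idempotent T e" "fst e = trivial_path v"
  shows "primitive_idempotent T e"
  unfolding primitive_idempotent_def
proof (intro conjI allI impI)
  show "idempotent T e" by fact
  have "trivial_path v (v, [] :: 'b list) \<noteq> (0::'k)" by (simp add: trivial_path_def)
  then show "e \<noteq> 0" using e(2) by auto
  fix f g assume fg: "idempotent T f \<and> idempotent T g \<and> kmul T f g = 0 \<and> kmul T g f = 0 \<and> e = f + g"
  have idem: "idempotent A (fst h)" if "idempotent T h" for h
    using that by (cases h) (auto simp: idempotent_def T_mem T_mul)
  have zero: "h = 0" if h: "idempotent T h" "fst h = 0" for h
  proof -
    have "kmul T (0, snd h) (0, snd h) = 0"
      using h by (intro T_mul_zero_zero) (auto simp: idempotent_def T_mem)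
    then have "kmul T h h = 0" using h(2) by (metis prod.collapse)
    then show ?thesis using h by (simp add: idempotent_def)
  qed
  have "kmul A (fst f) (fst g) = 0" using fg by (metis T_mul fst_conv fst_zero)
  then have "fst f = 0 \<or> fst g = 0"
    using trivial_path_split[OF n_pos idem idem, of f g v] fg e(2) by auto
  then show "f = 0 \<or> g = 0" using zero fg by blast
qed

end

section \<open>The ordinary quiver of an extension\<close>

context trunc_path_algebra
begin

lemma dual_expansion:
  assumes "\<phi> \<in> D A"
  shows "\<phi> = (\<Sum>p\<in>Sh. fscale (\<phi> (single p)) (dual_basis Sh p))"
proof
  fix a
  show "\<phi> a = (\<Sum>p\<in>Sh. fscale (\<phi> (single p)) (dual_basis Sh p)) a"
  proof (cases "a \<in> kspace A")
    case True
    then show ?thesis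
      unfolding sum_fun_apply
      by (simp add: D_expansion[OF assms] fscale_def dual_basis_apply mult.commute)
  next
    case False
    then show ?thesis
      unfolding sum_fun_apply
      by (simp add: D_outside[OF assms] fscale_def dual_basis_def kspace_eq)
  qed
qed

lemma single_trivial_right:
  "p \<in> Sh \<Longrightarrow> kmul A (single p) (trivial_path v) = (if ptarget G p = v then single p else 0)"
  using kmul_trivial_right[OF single_mem[of p], of v]
  by (auto simp: trivial_path_def fun_eq_iff)

lemma single_trivial_left:
  "p \<in> Sh \<Longrightarrow> kmul A (trivial_path v) (single p) = (if fst p = v then single p else 0)"
  using kmul_trivial_left[OF single_mem[of p], of v]
  by (auto simp: trivial_path_def fun_eq_iff)

definition long_paths :: "('a, 'b) path set" where
  "long_paths = {p \<in> Sh. plen p = n - 1}"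

lemma finite_long_paths: "finite long_paths"
  using finite_short_paths by (simp add: long_paths_def)

definition arcs_between :: "'a \<Rightarrow> 'a \<Rightarrow> 'b set" where
  "arcs_between i j = {e \<in> arcs G. tail G e = i \<and> head G e = j}"

end

text \<open>
  The flag \<open>thin\<close> will mean \<open>[\<beta>\<^sub>2\<^sub>n\<^sub>-\<^sub>1] = 0\<close>. It decides whether the
  functionals dual to the longest paths lie outside the square of the radical.
\<close>

locale decomposed_extension = trunc_path_extension G n A \<alpha> T
  for G :: "('a, 'b) pre_digraph" and n and A :: "('k::field, ('a, 'b) path \<Rightarrow> 'k) kalg" and \<alpha> T +
  fixes f :: "(('a, 'b) path \<Rightarrow> 'k) \<Rightarrow> (('a, 'b) path \<Rightarrow> 'k) \<Rightarrow> 'k"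
    and \<gamma> :: "(('a, 'b) path \<Rightarrow> 'k) \<Rightarrow> (('a, 'b) path \<Rightarrow> 'k) \<Rightarrow> (('a, 'b) path \<Rightarrow> 'k) \<Rightarrow> 'k"
    and thin :: bool
  assumes n_ge_2: "2 \<le> n"
    and no_sinks: "v \<in> verts G \<Longrightarrow> \<exists>e\<in>arcs G. tail G e = v"
    and f_linear: "k_linear (kscale A) fscale (kspace A) (D A) f"
    and decomposition: "\<lbrakk>a \<in> kspace A; b \<in> kspace A\<rbrakk> \<Longrightarrow> \<alpha> a b = \<gamma> a b + coboundary2 A f a b"
    and \<gamma>_left: "\<lbrakk>v \<in> verts G; a \<in> kspace A\<rbrakk> \<Longrightarrow> \<gamma> (trivial_path v) a = 0"
    and \<gamma>_right: "\<lbrakk>v \<in> verts G; a \<in> kspace A\<rbrakk> \<Longrightarrow> \<gamma> a (trivial_path v) = 0"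
    and thin: "\<lbrakk>thin; a \<in> radical; b \<in> radical; p \<in> long_paths\<rbrakk> \<Longrightarrow> \<gamma> a b (single p) = 0"
    and not_thin: "\<lbrakk>\<not> thin; p \<in> long_paths\<rbrakk> \<Longrightarrow> \<exists>a\<in>radical. \<exists>b\<in>radical. kmul A a b = 0 \<and>
      (\<exists>c. c \<noteq> 0 \<and> (\<forall>q\<in>long_paths. \<gamma> a b (single q) = (if q = p then c else 0)))"
begin

section \<open>Straightening the extension by the cochain f\<close>

lemma f_mem: "a \<in> kspace A \<Longrightarrow> f a \<in> D A"
  using f_linear by (simp add: k_linear_def)

lemma f_add: "\<lbrakk>a \<in> kspace A; b \<in> kspace A\<rbrakk> \<Longrightarrow> f (a + b) = f a + f b"
  using f_linear by (simp add: k_linear_def)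

lemma f_scale: "a \<in> kspace A \<Longrightarrow> f (fscale c a) = fscale c (f a)"
  using f_linear by (simp add: k_linear_def kscale_eq)

lemma f_zero: "f 0 = 0"
  using f_add[OF zero_closed zero_closed] by simp

lemma f_sum:
  "(\<And>i. i \<in> I \<Longrightarrow> g i \<in> kspace A) \<Longrightarrow> f (\<Sum>i\<in>I. g i) = (\<Sum>i\<in>I. f (g i))"
  by (induction I rule: infinite_finite_induct) (auto simp: f_zero f_add sum_mem_kspace)

lemma coboundary_apply: "c \<in> kspace A \<Longrightarrow>
    coboundary2 A f a b c = f b (kmul A c a) - f (kmul A a b) c + f a (kmul A b c)"
  by (simp add: coboundary2_def lact_def ract_def)

text \<open>
  \<open>\<Psi>\<close> is the second projection after the isomorphism that removes the coboundary of \<open>f\<close>.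
\<close>

definition \<Psi> :: "(('a, 'b) path \<Rightarrow> 'k) \<times> ((('a, 'b) path \<Rightarrow> 'k) \<Rightarrow> 'k) \<Rightarrow> (('a, 'b) path \<Rightarrow> 'k) \<Rightarrow> 'k" where
  "\<Psi> y = snd y + f (fst y)"

lemma \<Psi>_mem: "y \<in> kspace T \<Longrightarrow> \<Psi> y \<in> D A"
  by (simp add: \<Psi>_def T_mem add_mem_D f_mem)

lemma \<Psi>_add: "\<lbrakk>y \<in> kspace T; z \<in> kspace T\<rbrakk> \<Longrightarrow> \<Psi> (y + z) = \<Psi> y + \<Psi> z"
  by (simp add: \<Psi>_def T_mem f_add)

lemma \<Psi>_scale: "y \<in> kspace T \<Longrightarrow> \<Psi> (kscale T c y) = fscale c (\<Psi> y)"
  by (simp add: \<Psi>_def T_mem f_scale T_scale) (simp add: fscale_def algebra_simps fun_eq_iff)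

section \<open>Longest paths as test elements\<close>

lemma long_single_mem: "p \<in> long_paths \<Longrightarrow> single p \<in> kspace A"
  by (simp add: long_paths_def single_mem)

lemma long_mul_radical:
  assumes "p \<in> long_paths" "a \<in> radical"
  shows "kmul A (single p) a = 0" "kmul A a (single p) = 0"
  using kmul_long_radical[OF assms(2), of p] assms(1) n_pos by (auto simp: long_paths_def)

lemma rad_ext_mem: "y \<in> rad_ext \<longleftrightarrow> fst y \<in> radical \<and> snd y \<in> D A"
  by (cases y) (simp add: rad_ext_def)

lemma radical_mem_kspace: "a \<in> radical \<Longrightarrow> a \<in> kspace A"
  by (simp add: radical_def)

lemma rad_ext_mem_T: "y \<in> rad_ext \<Longrightarrow> y \<in> kspace T"
  by (simp add: rad_ext_mem T_mem radical_mem_kspace)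

lemma rad_ext_subspace: "T.subspace rad_ext"
  unfolding T.subspace_def
proof (intro conjI ballI allI)
  show "kscale T c x \<in> rad_ext" if "x \<in> rad_ext" for c x
    using that scale_closed[of "fst x" c]
    by (simp add: rad_ext_mem radical_def T_scale fscale_mem_D kscale_eq) (simp add: fscale_def)
qed (simp_all add: rad_ext_mem radical_def zero_closed zero_mem_D add_closed add_mem_D)

lemma rad_ext_left:
  assumes "z \<in> kspace T" "y \<in> rad_ext"
  shows "kmul T z y \<in> rad_ext"
  using T.mul_closed[OF assms(1) rad_ext_mem_T[OF assms(2)]] assms
  by (simp add: rad_ext_mem T_mem T_mul kmul_radical_right)

text \<open>On p the bimodule terms and both outer terms of the coboundary vanish, since the arrow
  ideal kills p; the remaining - f(ab) cancels against the f(ab) that \<open>\<Psi>\<close>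
  adds.\<close>

lemma \<Psi>_mul_radical:
  assumes "y \<in> rad_ext" "z \<in> rad_ext" "p \<in> long_paths"
  shows "\<Psi> (kmul T y z) (single p) = \<gamma> (fst y) (fst z) (single p)"
  using assms
  by (simp add: \<Psi>_def T_mul rad_ext_mem radical_mem_kspace decomposition coboundary_apply
      long_single_mem lact_def ract_def long_mul_radical D_zero f_mem)

text \<open>Since (a \<phi>)(c) = \<phi>(ca), a lifted idempotent acting on the left keeps the
  longest paths that end at v, and on the right those that start there. The D(A)-component of the
  lift is invisible: it is evaluated at a product of p with an element of the arrow ideal.\<close>

lemma \<Psi>_idem_left:
  assumes "e \<in> kspace T" "fst e = trivial_path v" "v \<in> verts G" "y \<in> rad_ext" "p \<in> long_paths"
  shows "\<Psi> (kmul T e y) (single p) = (if ptarget G p = v then \<Psi> y (single p) else 0)"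
proof -
  have "\<Psi> (kmul T e y) (single p) = \<Psi> y (kmul A (single p) (trivial_path v))"
    using assms trivial_path_mem[OF assms(3) n_pos]
    by (simp add: \<Psi>_def T_mul rad_ext_mem radical_mem_kspace decomposition coboundary_apply \<gamma>_left
        long_single_mem lact_def ract_def long_mul_radical D_zero f_mem T_mem)
  also have "\<dots> = (if ptarget G p = v then \<Psi> y (single p) else 0)"
    using assms D_zero[OF \<Psi>_mem[OF rad_ext_mem_T]]
    by (subst single_trivial_right) (auto simp: long_paths_def)
  finally show ?thesis .
qed

lemma \<Psi>_idem_right:
  assumes "e \<in> kspace T" "fst e = trivial_path v" "v \<in> verts G" "y \<in> rad_ext" "p \<in> long_paths"
  shows "\<Psi> (kmul T y e) (single p) = (if fst p = v then \<Psi> y (single p) else 0)"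
proof -
  have "\<Psi> (kmul T y e) (single p) = \<Psi> y (kmul A (trivial_path v) (single p))"
    using assms trivial_path_mem[OF assms(3) n_pos]
    by (simp add: \<Psi>_def T_mul rad_ext_mem radical_mem_kspace decomposition coboundary_apply \<gamma>_right
        long_single_mem lact_def ract_def long_mul_radical D_zero f_mem T_mem)
  also have "\<dots> = (if fst p = v then \<Psi> y (single p) else 0)"
    using assms D_zero[OF \<Psi>_mem[OF rad_ext_mem_T]]
    by (subst single_trivial_left) (auto simp: long_paths_def)
  finally show ?thesis .
qed

text \<open>The expected value of J^2, given by the vanishing of exactly those functionals that
  later serve as coordinates on J/J^2.\<close>

definition rad_square :: "((('a, 'b) path \<Rightarrow> 'k) \<times> ((('a, 'b) path \<Rightarrow> 'k) \<Rightarrow> 'k)) set" where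
  "rad_square = {y \<in> rad_ext. (\<forall>u es. length es \<le> 1 \<longrightarrow> fst y (u, es) = 0) \<and>
    (thin \<longrightarrow> (\<forall>p\<in>long_paths. \<Psi> y (single p) = 0))}"

lemma rad_square_subspace: "T.subspace rad_square"
  unfolding T.subspace_def
proof (intro conjI ballI allI)
  show "0 \<in> rad_square"
    using T.subspace_0[OF rad_ext_subspace] by (simp add: rad_square_def \<Psi>_def f_zero)
  show "x + y \<in> rad_square" if "x \<in> rad_square" "y \<in> rad_square" for x y
    using that T.subspace_add[OF rad_ext_subspace]
    by (auto simp: rad_square_def \<Psi>_add rad_ext_mem_T)
  show "kscale T c x \<in> rad_square" if "x \<in> rad_square" for c x
    using that T.subspace_scale[OF rad_ext_subspace]
    by (simp add: rad_square_def \<Psi>_scale rad_ext_mem_T) (simp add: T_scale fscale_def)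
qed

section \<open>Generators of the square of the radical\<close>

abbreviation "prods \<equiv> {kmul T x y | x y. x \<in> rad_ext \<and> y \<in> rad_ext}"

lemma prod_mem_span: "\<lbrakk>x \<in> rad_ext; y \<in> rad_ext\<rbrakk> \<Longrightarrow> kmul T x y \<in> T.span prods"
  by (rule T.span_base) blast

lemma span_le_rad_square: "T.span prods \<subseteq> rad_square"
proof (rule T.span_minimal[OF _ rad_square_subspace], rule subsetI)
  fix z assume "z \<in> prods"
  then obtain x y where xy: "x \<in> rad_ext" "y \<in> rad_ext" and z: "z = kmul T x y" by blast
  have "z \<in> rad_ext"
    unfolding z using xy rad_ext_right_ideal rad_ext_mem_T by (simp add: right_ideal_def)
  moreover have "fst z (u, es) = 0" if "length es \<le> 1" for u es
    using that xy kmul_radical_vanish by (simp add: z T_mul rad_ext_mem)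
  moreover have "\<Psi> z (single p) = 0" if thin "p \<in> long_paths" for p
    using that xy thin by (simp add: z \<Psi>_mul_radical rad_ext_mem)
  ultimately show "z \<in> rad_square" by (simp add: rad_square_def)
qed

lemma arrow_mem_rad_ext: "e \<in> arcs G \<Longrightarrow> (single (tail G e, [e]), 0) \<in> rad_ext"
  using n_ge_2 by (auto simp: rad_ext_mem radical_def zero_mem_D single_mem short_paths_def plen_def)

lemma dual_mem_rad_ext: "x \<in> D A \<Longrightarrow> (0, x) \<in> rad_ext"
  by (simp add: rad_ext_mem radical_def zero_closed)

text \<open>The target of p is not a sink and p is shorter than n - 1, so p extends by an arrow e to
  a path pe that is nonzero in A. Acting with e from the left on the dual of pe gives the dual of p,
  and the cocycle term of this product is \<alpha>(e, 0) = 0.\<close>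

lemma dual_basis_mem_span:
  assumes p: "p \<in> Sh" "plen p < n - 1"
  shows "(0, dual_basis Sh p) \<in> T.span prods"
proof -
  obtain u es where ues: "p = (u, es)" by (cases p)
  have "ptarget G (u, es) \<in> verts G" using p ptarget_mem_verts by (simp add: short_paths_def ues)
  then obtain e where e: "e \<in> arcs G" "tail G e = ptarget G (u, es)" using no_sinks by blast
  have mem: "single (tail G e, [e]) \<in> kspace A"
    using arrow_mem_rad_ext[OF e(1)] by (simp add: rad_ext_mem radical_mem_kspace)
  let ?q = "(u, es @ [e])"
  have "kmul T (single (tail G e, [e]), 0) (0, dual_basis Sh ?q) \<in> T.span prods"
    by (intro prod_mem_span arrow_mem_rad_ext e dual_mem_rad_ext dual_basis_mem_D)
  moreover have "lact A (single (tail G e, [e])) (dual_basis Sh ?q) = dual_basis Sh p"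
  proof (rule D_eqI)
    fix c assume c: "c \<in> kspace A"
    then have "lact A (single (tail G e, [e])) (dual_basis Sh ?q) c = kmul A c (single (tail G e, [e])) ?q"
      by (simp add: lact_def dual_basis_apply kmul_mem mem)
    also have "\<dots> = c p"
    proof -
      have "Suc (length es) < n" using p(2) by (simp add: ues plen_def)
      then show ?thesis using e by (simp add: kmul_single_right ues)
    qed
    finally show "lact A (single (tail G e, [e])) (dual_basis Sh ?q) c = dual_basis Sh p c"
      using c by (simp add: dual_basis_apply)
  qed (auto intro: lact_mem_D mem dual_basis_mem_D)
  moreover have "ract A 0 (0 :: ('a, 'b) path \<Rightarrow> 'k) = 0" by (auto simp: ract_def)
  ultimately show ?thesis
    using cocycle_zero_right[OF cocycle mem] by (simp add: T_mul mul_zero_right mem)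
qed

lemma dual_vanishing_mem_span:
  assumes x: "x \<in> D A" "\<And>p. p \<in> long_paths \<Longrightarrow> x (single p) = 0"
  shows "(0, x) \<in> T.span prods"
proof -
  have "(0, x) = (\<Sum>p\<in>Sh. kscale T (x (single p)) (0, dual_basis Sh p))"
  proof (rule prod_eqI)
    show "fst (0, x) = fst (\<Sum>p\<in>Sh. kscale T (x (single p)) (0, dual_basis Sh p))"
      by (simp add: fst_sum T_scale fscale_zero)
    show "snd (0, x) = snd (\<Sum>p\<in>Sh. kscale T (x (single p)) (0, dual_basis Sh p))"
      unfolding snd_sum T_scale snd_conv by (rule dual_expansion[OF x(1)])
  qed
  also have "\<dots> \<in> T.span prods"
  proof (rule T.span_sum)
    fix p assume p: "p \<in> Sh"
    show "kscale T (x (single p)) (0, dual_basis Sh p) \<in> T.span prods"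
    proof (cases "p \<in> long_paths")
      case True
      then show ?thesis using x by (simp add: T.span_zero)
    next
      case False
      with p have "plen p < n - 1" by (auto simp: long_paths_def short_paths_def)
      then show ?thesis using p dual_basis_mem_span by (intro T.span_scale)
    qed
  qed
  finally show ?thesis .
qed

text \<open>When \<open>thin\<close> fails, the span contains elements \<open>(0, g p)\<close> dual
  to the longest paths; subtracting a combination of them from x leaves a functional that vanishes
  on these paths.\<close>

lemma dual_mem_span:
  assumes x: "x \<in> D A" and thin0: "thin \<Longrightarrow> \<forall>p\<in>long_paths. x (single p) = 0"
  shows "(0, x) \<in> T.span prods"
proof (cases thin)
  case True
  then show ?thesis using dual_vanishing_mem_span x thin0 by blast
next
  case False
  have "\<exists>g. (0, g) \<in> T.span prods \<and> (\<forall>q\<in>long_paths. g (single q) = (if q = p then 1 else 0))"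
    if p: "p \<in> long_paths" for p
  proof -
    obtain a b c where ab: "a \<in> radical" "b \<in> radical" "kmul A a b = 0" "c \<noteq> 0"
      and c: "\<And>q. q \<in> long_paths \<Longrightarrow> \<gamma> a b (single q) = (if q = p then c else 0)"
      using not_thin[OF False p] by blast
    have mem: "a \<in> kspace A" "b \<in> kspace A" using ab by (auto simp: radical_def)
    have "kmul T (a, 0) (b, 0) \<in> T.span prods"
      using ab by (intro prod_mem_span) (simp_all add: rad_ext_mem zero_mem_D)
    also have "kmul T (a, 0) (b, 0) = (0, \<alpha> a b)"
      by (simp add: T_mul ab)
    finally have "kscale T (inverse c) (0, \<alpha> a b) \<in> T.span prods" by (rule T.span_scale)
    then have "(0, fscale (inverse c) (\<alpha> a b)) \<in> T.span prods" by (simp add: T_scale fscale_zero)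
    \<comment> \<open>As ab = 0, even the middle term of the coboundary disappears, so \<alpha>
      agrees with \<gamma> on longest paths.\<close>
    moreover have "\<alpha> a b (single q) = (if q = p then c else 0)" if "q \<in> long_paths" for q
      using that c[OF that] ab
      by (simp add: decomposition mem coboundary_apply long_single_mem long_mul_radical f_mem f_zero D_zero)
    ultimately show ?thesis
      using ab(4) by (intro exI[of _ "fscale (inverse c) (\<alpha> a b)"]) (auto simp: fscale_def)
  qed
  then have "\<forall>p\<in>long_paths. \<exists>g. (0, g) \<in> T.span prods \<and>
      (\<forall>q\<in>long_paths. g (single q) = (if q = p then 1 else 0))" by (rule ballI)
  from bchoice[OF this] obtain g where g: "\<forall>p\<in>long_paths. (0, g p) \<in> T.span prods \<and>
      (\<forall>q\<in>long_paths. g p (single q) = (if q = p then 1 else 0))" ..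
  define z where "z = (\<Sum>p\<in>long_paths. kscale T (x (single p)) (0, g p))"
  have z: "z \<in> T.span prods"
    unfolding z_def using g by (intro T.span_sum T.span_scale) auto
  have fst_z: "fst z = 0" by (simp add: z_def fst_sum T_scale fscale_zero)
  have "z \<in> kspace T"
    using z span_le_rad_square by (auto simp: rad_square_def intro: rad_ext_mem_T)
  then have zD: "snd z \<in> D A" by (simp add: T_mem)
  have "snd z (single q) = x (single q)" if q: "q \<in> long_paths" for q
  proof -
    have "snd z (single q) = (\<Sum>p\<in>long_paths. if p = q then x (single p) else 0)"
      unfolding z_def snd_sum sum_fun_apply
      using g q by (intro sum.cong) (auto simp: T_scale fscale_def)
    then show ?thesis using q finite_long_paths by (simp add: sum.delta)
  qed
  then have "(0, x + - snd z) \<in> T.span prods"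
    by (intro dual_vanishing_mem_span add_mem_D uminus_mem_D x zD) simp
  from T.span_add[OF this z] show ?thesis
    using fst_z by (simp add: plus_prod_def)
qed

text \<open>Splitting off the first arrow realises p as a product up to a value of \<alpha> in D(A),
  which is left unspecified.\<close>

lemma path_mem_span:
  assumes p: "p \<in> Sh" "2 \<le> plen p"
  shows "\<exists>x. (single p, x) \<in> T.span prods"
proof -
  obtain u e es where ues: "p = (u, e # es)" "es \<noteq> []"
    using p(2) by (cases p; cases "snd p") (auto simp: plen_def numeral_2_eq_2 Suc_le_length_iff)
  have e: "e \<in> arcs G" "tail G e = u" "(head G e, es) \<in> Sh"
    using p by (auto simp: ues short_paths_def plen_def)
  have "(single (head G e, es), 0) \<in> rad_ext"
    using e ues by (auto simp: rad_ext_mem radical_def single_mem zero_mem_D)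
  then have "kmul T (single (u, [e]), 0) (single (head G e, es), 0) \<in> T.span prods"
    using prod_mem_span arrow_mem_rad_ext[OF e(1)] e(2) by blast
  moreover have "kmul A (single (u, [e])) (single (ptarget G (u, [e]), es)) = single (u, [e] @ es)"
    using p by (intro kmul_single_single) (simp add: ues short_paths_def plen_def)
  ultimately show ?thesis by (auto simp: T_mul ues)
qed

lemma ideal_square_eq: "ideal_square T (jacobson_radical T) = rad_square"
proof -
  have "y \<in> T.span prods" if y: "y \<in> rad_square" for y
  proof -
    have yA: "fst y \<in> kspace A" using y by (simp add: rad_square_def rad_ext_mem radical_mem_kspace)
    let ?P = "{p \<in> Sh. 2 \<le> plen p}"
    obtain X where X: "\<And>p. p \<in> ?P \<Longrightarrow> (single p, X p) \<in> T.span prods"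
      using path_mem_span by (metis (no_types, lifting) mem_Collect_eq)
    \<comment> \<open>z matches y in the A-component, so the unknown errors \<open>X p\<close> end
      up in y - z = (0, x). This difference still satisfies the linear conditions of
      \<open>rad_square\<close>, and \<open>dual_mem_span\<close> applies to it.\<close>
    define z where "z = (\<Sum>p\<in>?P. kscale T (fst y p) (single p, X p))"
    have z: "z \<in> T.span prods"
      unfolding z_def using X by (intro T.span_sum T.span_scale) auto
    have "fst z = (\<Sum>p\<in>?P. fscale (fst y p) (single p))" by (simp add: z_def fst_sum T_scale)
    also have "\<dots> = (\<Sum>p\<in>Sh. fscale (fst y p) (single p))"
    proof (intro sum.mono_neutral_left finite_short_paths ballI)
      fix p assume p: "p \<in> Sh - ?P"
      obtain u es where "p = (u, es)" by (cases p)
      with p y have "fst y p = 0" by (auto simp: rad_square_def plen_def)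
      then show "fscale (fst y p) (single p) = 0" by (auto simp: fscale_def)
    qed auto
    also have "\<dots> = fst y" by (rule kspace_expansion[OF yA, symmetric])
    finally have "fst (y - z) = 0" by simp
    then obtain x where x: "y - z = (0, x)" by (metis prod.collapse)
    have "(0, x) \<in> rad_square"
      unfolding x[symmetric]
      using y z span_le_rad_square T.subspace_diff[OF rad_square_subspace] by blast
    then have "x \<in> D A" "thin \<longrightarrow> (\<forall>p\<in>long_paths. x (single p) = 0)"
      by (simp_all add: rad_square_def rad_ext_mem \<Psi>_def f_zero)
    then have "y - z \<in> T.span prods"
      unfolding x using dual_mem_span by blast
    from T.span_add[OF this z] show ?thesis by simp
  qed
  then show ?thesis
    using span_le_rad_square by (auto simp: ideal_square_def jacobson_radical_eq)
qed

text \<open>Duality reverses direction: a longest path from j to i contributes an arrow from i to j.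
  The lift e is arbitrary because its D(A)-components never show up in the coordinates.\<close>

lemma arrow_number_eq:
  assumes e: "complete_primitive_orthogonal T (verts G) e" "\<And>v. v \<in> verts G \<Longrightarrow> fst (e v) = trivial_path v"
    and ij: "i \<in> verts G" "j \<in> verts G"
  shows "arrow_number T e i j = card (arcs_between i j <+>
    (if thin then {p \<in> long_paths. fst p = j \<and> ptarget G p = i} else {}))"
proof -
  define M where "M = arcs_between i j <+>
    (if thin then {p \<in> long_paths. fst p = j \<and> ptarget G p = i} else {})"
  define \<Phi> where "\<Phi> y m = (case m of Inl a \<Rightarrow> fst y (i, [a]) | Inr p \<Rightarrow> \<Psi> y (single p))" for y m
  \<comment> \<open>Corners are images of this idempotent linear map, so the quotient is computed by
    coordinates on its image.\<close>
  define c where "c y = kmul T (kmul T (e i) y) (e j)" for y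
  have eT: "e i \<in> kspace T" "e j \<in> kspace T" "kmul T (e i) (e i) = e i" "kmul T (e j) (e j) = e j"
    using e(1) ij by (auto simp: complete_primitive_orthogonal_def primitive_idempotent_def idempotent_def)
  note mc = T.mul_closed
  have c_mem: "c y \<in> rad_ext" if "y \<in> rad_ext" for y
    using that eT rad_ext_left rad_ext_right_ideal by (simp add: c_def right_ideal_def)
  have c_idem: "c (c y) = c y" if "y \<in> kspace T" for y
  proof -
    have "c (c y) = kmul T (kmul T (kmul T (e i) (e i)) y) (kmul T (e j) (e j))"
      using that eT(1,2) by (simp add: c_def T.mul_assoc mc)
    then show ?thesis by (simp add: eT c_def)
  qed
  have fst_c: "fst (c y) (u, es) = (if u = i \<and> ptarget G (u, es) = j then fst y (u, es) else 0)"
    if "y \<in> kspace T" for y u es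
  proof -
    have "fst (c y) = kmul A (kmul A (trivial_path i) (fst y)) (trivial_path j)"
      using e(2) ij by (simp add: c_def T_mul)
    then show ?thesis
      using that by (simp add: trivial_path_def T_mem kmul_trivial_right kmul_trivial_left kmul_mem
          trivial_path_mem[OF ij(1) n_pos, unfolded trivial_path_def])
  qed
  have \<Psi>_c: "\<Psi> (c y) (single p) = (if fst p = j \<and> ptarget G p = i then \<Psi> y (single p) else 0)"
    if y: "y \<in> rad_ext" and p: "p \<in> long_paths" for y p
  proof -
    have "kmul T (e i) y \<in> rad_ext" by (rule rad_ext_left[OF eT(1) y])
    then show ?thesis
      unfolding c_def using e(2) ij eT p y by (simp add: \<Psi>_idem_left \<Psi>_idem_right)
  qed
  have c_lin: "c (x + y) = c x + c y" "c (kscale T k x) = kscale T k (c x)"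
    if "x \<in> rad_ext" "y \<in> rad_ext" for x y k
    using that eT by (simp_all add: c_def T.mul_add_left T.mul_add_right T.mul_scale_left
        T.mul_scale_right mc rad_ext_mem_T)
  have sq_le: "rad_square \<subseteq> rad_ext" by (auto simp: rad_square_def)
  have fin: "finite M"
    unfolding M_def by (intro finite_Plus) (auto simp: arcs_between_def finite_long_paths)
  have "dim_quot (kscale T) (c ` rad_ext) (c ` rad_square) = card M"
  proof (rule dim_quot_eq_card[where \<Phi> = \<Phi>])
    show "vector_space (kscale T)" by (rule T.vector_space_axioms)
    show "finite M" by fact
    show "T.subspace (c ` rad_ext)"
      unfolding T.subspace_def
    proof (intro conjI ballI allI)
      have "c 0 = 0"
        using c_lin(2)[of 0 0 0] T.subspace_0[OF rad_ext_subspace] by simp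
      then show "0 \<in> c ` rad_ext"
        using T.subspace_0[OF rad_ext_subspace] by (metis image_eqI)
    next
      fix x y assume "x \<in> c ` rad_ext" "y \<in> c ` rad_ext"
      then obtain x' y' where "x' \<in> rad_ext" "y' \<in> rad_ext" "x = c x'" "y = c y'" by blast
      then show "x + y \<in> c ` rad_ext"
        using c_lin(1) T.subspace_add[OF rad_ext_subspace] by (intro image_eqI[of _ _ "x' + y'"]) simp_all
    next
      fix k x assume "x \<in> c ` rad_ext"
      then obtain x' where "x' \<in> rad_ext" "x = c x'" by blast
      then show "kscale T k x \<in> c ` rad_ext"
        using c_lin(2) T.subspace_scale[OF rad_ext_subspace]
        by (intro image_eqI[of _ _ "kscale T k x'"]) simp_all
    qed
    fix m
    show "\<Phi> (x + y) m = \<Phi> x m + \<Phi> y m" if "x \<in> c ` rad_ext" "y \<in> c ` rad_ext" for x y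
      using that by (cases m) (auto simp: \<Phi>_def \<Psi>_add c_mem rad_ext_mem_T)
    show "\<Phi> (kscale T k x) m = k * \<Phi> x m" if "x \<in> c ` rad_ext" for k x
      using that by (cases m) (auto simp: \<Phi>_def \<Psi>_scale c_mem rad_ext_mem_T fscale_def, simp add: T_scale fscale_def)
    show "\<exists>x\<in>c ` rad_ext. \<forall>m'\<in>M. \<Phi> x m' = (if m' = m then 1 else 0)" if m: "m \<in> M"
    proof (cases m)
      case (Inl a)
      with m have a: "a \<in> arcs G" "tail G a = i" "head G a = j" by (auto simp: M_def arcs_between_def)
      \<comment> \<open>The second component makes \<open>\<Psi> y\<close> zero, so all dual
        coordinates of this representative of the arrow vanish.\<close>
      define y where "y = (single (i, [a]) :: ('a, 'b) path \<Rightarrow> 'k, - f (single (i, [a])))"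
      have sa: "single (i, [a]) \<in> radical"
        using arrow_mem_rad_ext[OF a(1)] a(2) by (simp add: rad_ext_mem)
      then have y: "y \<in> rad_ext"
        by (simp add: y_def rad_ext_mem uminus_mem_D f_mem radical_mem_kspace)
      have "\<Phi> (c y) m' = (if m' = m then 1 else 0)" if "m' \<in> M" for m'
      proof (cases m')
        case (Inl b)
        then show ?thesis
          using that \<open>m = Inl a\<close> y by (auto simp: \<Phi>_def fst_c rad_ext_mem_T M_def arcs_between_def y_def)
      next
        case (Inr p)
        then have "p \<in> long_paths" using that by (auto simp: M_def split: if_splits)
        then show ?thesis
          using \<open>m = Inl a\<close> Inr y by (simp add: \<Phi>_def \<Psi>_c) (simp add: y_def \<Psi>_def)
      qed
      then show ?thesis using y by blast
    next
      case (Inr p)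
      with m have p: "p \<in> long_paths" "fst p = j" "ptarget G p = i" by (auto simp: M_def split: if_splits)
      define y where "y = (0 :: ('a, 'b) path \<Rightarrow> 'k, dual_basis Sh p :: (('a, 'b) path \<Rightarrow> 'k) \<Rightarrow> 'k)"
      have y: "y \<in> rad_ext" by (simp add: y_def dual_mem_rad_ext dual_basis_mem_D)
      have "\<Phi> (c y) m' = (if m' = m then 1 else 0)" if "m' \<in> M" for m'
      proof (cases m')
        case (Inl b)
        then show ?thesis
          using \<open>m = Inr p\<close> y by (auto simp: \<Phi>_def fst_c rad_ext_mem_T y_def)
      next
        case (Inr q)
        then have q: "q \<in> long_paths" using that by (auto simp: M_def split: if_splits)
        have "\<Psi> y (single q) = (if q = p then 1 else 0)"
          by (auto simp: y_def \<Psi>_def f_zero dual_basis_apply long_single_mem q)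
        then show ?thesis
          using \<open>m = Inr p\<close> Inr q p y by (auto simp: \<Phi>_def \<Psi>_c)
      qed
      then show ?thesis using y by blast
    qed
  next
    show "c ` rad_square = {x \<in> c ` rad_ext. \<forall>m\<in>M. \<Phi> x m = 0}"
    proof (intro equalityI subsetI)
      fix x assume "x \<in> c ` rad_square"
      then obtain y where y: "y \<in> rad_square" "x = c y" by auto
      have "\<Phi> x m = 0" if m: "m \<in> M" for m
      proof (cases m)
        case (Inl a)
        then show ?thesis using y sq_le by (auto simp: \<Phi>_def fst_c rad_ext_mem_T rad_square_def)
      next
        case (Inr p)
        then have "p \<in> long_paths" thin using m by (auto simp: M_def split: if_splits)
        then have "\<Psi> y (single p) = 0" using y(1) unfolding rad_square_def by blast
        with \<open>p \<in> long_paths\<close> show ?thesis using y sq_le Inr by (auto simp: \<Phi>_def \<Psi>_c)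
      qed
      then show "x \<in> {x \<in> c ` rad_ext. \<forall>m\<in>M. \<Phi> x m = 0}" using y sq_le by auto
    next
      fix x assume x: "x \<in> {x \<in> c ` rad_ext. \<forall>m\<in>M. \<Phi> x m = 0}"
      then obtain y where y: "y \<in> rad_ext" "x = c y" by auto
      have xr: "x \<in> rad_ext" using y c_mem by simp
      have xc: "c x = x" using y c_idem rad_ext_mem_T by simp
      have "fst x (u, es) = 0" if "length es \<le> 1" for u es
      proof (rule ccontr)
        assume nz: "fst x (u, es) \<noteq> 0"
        then have "es \<noteq> []" using xr by (auto simp: rad_ext_mem radical_def)
        with that obtain a where a: "es = [a]" by (cases es) auto
        have "(u, [a]) \<in> Sh" using nz xr by (auto simp: a rad_ext_mem radical_def mem_kspace)
        moreover have "u = i" "head G a = j"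
          using nz y fst_c[OF rad_ext_mem_T[OF y(1)], of u es] by (auto simp: a split: if_splits)
        ultimately have "Inl a \<in> M" by (auto simp: M_def arcs_between_def short_paths_def)
        then have "\<Phi> x (Inl a) = 0" using x by blast
        with nz \<open>u = i\<close> show False by (simp add: \<Phi>_def a)
      qed
      moreover have "\<Psi> x (single p) = 0" if "thin" and p: "p \<in> long_paths" for p
      proof (cases "fst p = j \<and> ptarget G p = i")
        case True
        then have "Inr p \<in> M" using that by (auto simp: M_def)
        then have "\<Phi> x (Inr p) = 0" using x by blast
        then show ?thesis by (simp add: \<Phi>_def)
      next
        case False
        then show ?thesis using \<Psi>_c[OF xr p] unfolding xc by argo
      qed
      ultimately have "x \<in> rad_square" using xr by (auto simp: rad_square_def)
      then show "x \<in> c ` rad_square" using xc by (metis image_eqI)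
    qed
  qed
  moreover have "corner T (e i) S (e j) = c ` S" for S by (auto simp: corner_def c_def)
  ultimately show ?thesis
    by (simp add: arrow_number_def jacobson_radical_eq ideal_square_eq[unfolded jacobson_radical_eq] M_def)
qed

text \<open>As \<gamma> vanishes on trivial paths, the pairs (v, 0) are orthogonal idempotents for
  the multiplication built from \<gamma>; undoing the shift by f turns them into (v, -
  f(v)).\<close>

lemma lift_exists:
  "\<exists>e. complete_primitive_orthogonal T (verts G) e \<and> (\<forall>v\<in>verts G. fst (e v) = trivial_path v)"
proof -
  define e :: "'a \<Rightarrow> (('a, 'b) path \<Rightarrow> 'k) \<times> ((('a, 'b) path \<Rightarrow> 'k) \<Rightarrow> 'k)"
    where "e v = (trivial_path v, - f (trivial_path v))" for v
  have mem: "trivial_path v \<in> kspace A" if "v \<in> verts G" for v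
    using that n_pos by (rule trivial_path_mem)
  have neg: "lact A a (- \<phi>) = - lact A a \<phi>" "ract A (- \<phi>) a = - ract A \<phi> a" for a \<phi>
    by (auto simp: lact_def ract_def)
  have mul: "kmul T (e u) (e v) = (if u = v then e u else 0)" if uv: "u \<in> verts G" "v \<in> verts G" for u v
    using trivial_path_mul[OF n_pos, of u v]
    by (auto simp: T_mul e_def decomposition mem uv \<gamma>_left coboundary2_def neg f_zero zero_prod_def)
  have "idempotent T (e v)" if "v \<in> verts G" for v
    using that mul by (simp add: idempotent_def T_mem e_def mem uminus_mem_D f_mem)
  moreover have "(\<Sum>v\<in>verts G. e v) = kone T"
  proof -
    have one: "kone A = (\<Sum>v\<in>verts G. trivial_path v)"
      using kone_eq[OF n_pos] by (simp add: trivial_path_def)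
    have "\<alpha> (kone A) (kone A) = (\<Sum>v\<in>verts G. \<alpha> (trivial_path v) (kone A))"
    proof -
      have "\<alpha> (\<Sum>v\<in>V. trivial_path v) (kone A) = (\<Sum>v\<in>V. \<alpha> (trivial_path v) (kone A))"
        if "finite V" "V \<subseteq> verts G" for V
        using that
        by (induction V) (auto simp: cocycle_zero_left[OF cocycle] cocycle_add_left[OF cocycle]
            one_closed mem sum_mem_kspace subset_iff)
      from this[of "verts G"] show ?thesis by (simp add: one)
    qed
    also have "\<dots> = (\<Sum>v\<in>verts G. lact A (trivial_path v) (f (kone A)))"
      by (intro sum.cong refl)
        (simp add: decomposition mem one_closed \<gamma>_left coboundary2_def one_right ract_one f_mem)
    also have "\<dots> = lact A (kone A) (f (kone A))"
    proof -
      have "lact A (\<Sum>v\<in>V. trivial_path v) \<phi> = (\<Sum>v\<in>V. lact A (trivial_path v) \<phi>)"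
        if "finite V" "V \<subseteq> verts G" "\<phi> \<in> D A" for V \<phi>
        using that
      proof (induction V)
        case empty
        then show ?case by (simp only: sum.empty lact_zero_left)
      next
        case (insert v V)
        then have V: "trivial_path v \<in> kspace A" "(\<Sum>v\<in>V. trivial_path v) \<in> kspace A"
          using mem by (auto intro: sum_mem_kspace)
        show ?case
          unfolding sum.insert[OF insert.hyps] lact_add_left[OF V insert.prems(2)]
          using insert by simp
      qed
      from this[of "verts G"] show ?thesis by (simp add: one f_mem one_closed[unfolded one])
    qed
    \<comment> \<open>Thus the second component of \<open>kone T\<close> is - f(1), the sum of the
      components - f(v).\<close>
    finally have "\<alpha> (kone A) (kone A) = f (kone A)" by (simp add: lact_one f_mem one_closed)
    then show ?thesis
      using f_sum[of "verts G" trivial_path] mem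
      by (simp add: T_one prod_eq_iff fst_sum snd_sum e_def one sum_negf)
  qed
  ultimately have "complete_primitive_orthogonal T (verts G) e"
    unfolding complete_primitive_orthogonal_def
    using mul primitive_lift[of _ "e _"] by (simp add: e_def)
  then show ?thesis by (intro exI[of _ e]) (simp add: e_def)
qed

text \<open>The definite description demands one lift and a number common to all lifts.\<close>

theorem ordinary_quiver_ext_eq:
  assumes "i \<in> verts G" "j \<in> verts G"
  shows "ordinary_quiver_ext A (verts G) trivial_path \<alpha> i j = card (arcs_between i j <+>
    (if thin then {p \<in> long_paths. fst p = j \<and> ptarget G p = i} else {}))"
  unfolding ordinary_quiver_ext_def T_def[symmetric]
proof (rule the_equality)
  obtain e where "complete_primitive_orthogonal T (verts G) e" "\<forall>v\<in>verts G. fst (e v) = trivial_path v"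
    using lift_exists by blast
  then show "\<exists>e'. complete_primitive_orthogonal T (verts G) e' \<and> (\<forall>v\<in>verts G. fst (e' v) = trivial_path v) \<and>
    card (arcs_between i j <+> (if thin then {p \<in> long_paths. fst p = j \<and> ptarget G p = i} else {})) =
    arrow_number T e' i j"
    using arrow_number_eq[OF _ _ assms, of e] by (intro exI[of _ e]) simp
qed (use arrow_number_eq[OF _ _ assms] in auto)

end

section \<open>Cohomologous cocycles\<close>

lemma (in assoc_kalgebra) D_k_linear_zero: "k_linear (kscale A) fscale (kspace A) (D A) 0"
  by (simp add: k_linear_def zero_mem_D fscale_zero)

lemma (in assoc_kalgebra) D_k_linear_add:
  "\<lbrakk>k_linear (kscale A) fscale (kspace A) (D A) f; k_linear (kscale A) fscale (kspace A) (D A) g\<rbrakk> \<Longrightarrow>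
    k_linear (kscale A) fscale (kspace A) (D A) (f + g)"
  by (auto simp: k_linear_def add_mem_D fscale_def algebra_simps fun_eq_iff)

lemma (in assoc_kalgebra) D_k_linear_uminus:
  "k_linear (kscale A) fscale (kspace A) (D A) f \<Longrightarrow> k_linear (kscale A) fscale (kspace A) (D A) (- f)"
  by (auto simp: k_linear_def uminus_mem_D fscale_def fun_eq_iff)

lemma coboundary2_zero: "coboundary2 A 0 a b = 0"
  by (auto simp: coboundary2_def lact_def ract_def)

lemma coboundary2_add: "coboundary2 A (f + g) a b = coboundary2 A f a b + coboundary2 A g a b"
  by (auto simp: coboundary2_def lact_def ract_def)

lemma coboundary2_uminus: "coboundary2 A (- f) a b = - coboundary2 A f a b"
  by (auto simp: coboundary2_def lact_def ract_def)

context assoc_kalgebra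
begin

lemma zero_cocycle: "0 \<in> cocycles2 A"
  by (auto simp: cocycles2_def k_linear_def zero_mem_D fscale_zero)

lemma cohomologous_refl: "\<alpha> \<in> cocycles2 A \<Longrightarrow> (\<alpha>, \<alpha>) \<in> cohomologous A"
  using D_k_linear_zero by (auto simp: cohomologous_def coboundary2_zero intro!: exI[of _ 0])

lemma cohomologous_sym: "(\<alpha>, \<beta>) \<in> cohomologous A \<Longrightarrow> (\<beta>, \<alpha>) \<in> cohomologous A"
proof -
  assume "(\<alpha>, \<beta>) \<in> cohomologous A"
  then obtain f where f: "k_linear (kscale A) fscale (kspace A) (D A) f"
    "\<And>a b. \<lbrakk>a \<in> kspace A; b \<in> kspace A\<rbrakk> \<Longrightarrow> \<alpha> a b - \<beta> a b = coboundary2 A f a b"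
    and mem: "\<alpha> \<in> cocycles2 A" "\<beta> \<in> cocycles2 A" by (auto simp: cohomologous_def)
  have "\<beta> a b - \<alpha> a b = coboundary2 A (- f) a b" if "a \<in> kspace A" "b \<in> kspace A" for a b
    using f(2)[OF that] by (simp add: coboundary2_uminus flip: f(2)[OF that])
  then show ?thesis
    using mem D_k_linear_uminus[OF f(1)] unfolding cohomologous_def by blast
qed

lemma cohomologous_trans:
  assumes "(\<alpha>, \<beta>) \<in> cohomologous A" "(\<beta>, \<delta>) \<in> cohomologous A"
  shows "(\<alpha>, \<delta>) \<in> cohomologous A"
proof -
  from assms obtain f g where f: "k_linear (kscale A) fscale (kspace A) (D A) f"
    "\<And>a b. \<lbrakk>a \<in> kspace A; b \<in> kspace A\<rbrakk> \<Longrightarrow> \<alpha> a b - \<beta> a b = coboundary2 A f a b"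
    and g: "k_linear (kscale A) fscale (kspace A) (D A) g"
    "\<And>a b. \<lbrakk>a \<in> kspace A; b \<in> kspace A\<rbrakk> \<Longrightarrow> \<beta> a b - \<delta> a b = coboundary2 A g a b"
    and mem: "\<alpha> \<in> cocycles2 A" "\<delta> \<in> cocycles2 A" by (auto simp: cohomologous_def)
  have "\<alpha> a b - \<delta> a b = coboundary2 A (f + g) a b" if "a \<in> kspace A" "b \<in> kspace A" for a b
    by (simp add: coboundary2_add flip: f(2)[OF that] g(2)[OF that])
  then show ?thesis
    using mem D_k_linear_add[OF f(1) g(1)] unfolding cohomologous_def by blast
qed

lemma coh_class_eq_if: "(\<alpha>, \<beta>) \<in> cohomologous A \<Longrightarrow> coh_class A \<alpha> = coh_class A \<beta>"
  unfolding coh_class_def using cohomologous_sym cohomologous_trans by blast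

lemma coh_class_eqD: "\<lbrakk>coh_class A \<alpha> = coh_class A \<beta>; \<beta> \<in> cocycles2 A\<rbrakk> \<Longrightarrow> (\<alpha>, \<beta>) \<in> cohomologous A"
  unfolding coh_class_def using cohomologous_refl by blast

text \<open>The later splitting of \<alpha> consumes the cochain itself, so it is exhibited in place
  of an equality of classes.\<close>

lemma sum_cohomologous:
  assumes "finite Q" and "\<And>q. q \<in> Q \<Longrightarrow> (\<eta> q, \<beta> q) \<in> cohomologous A"
  shows "\<exists>f. k_linear (kscale A) fscale (kspace A) (D A) f \<and>
    (\<forall>a\<in>kspace A. \<forall>b\<in>kspace A. (\<Sum>q\<in>Q. \<eta> q) a b - (\<Sum>q\<in>Q. \<beta> q) a b = coboundary2 A f a b)"
  using assms
proof (induction Q)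
  case empty
  show ?case
    by (intro exI[of _ 0] conjI ballI D_k_linear_zero ext)
      (simp add: coboundary2_def lact_def ract_def)
next
  case (insert q Q)
  have "\<exists>f. k_linear (kscale A) fscale (kspace A) (D A) f \<and>
    (\<forall>a\<in>kspace A. \<forall>b\<in>kspace A. (\<Sum>q\<in>Q. \<eta> q) a b - (\<Sum>q\<in>Q. \<beta> q) a b = coboundary2 A f a b)"
    by (rule insert.IH) (rule insert.prems, simp)
  then obtain f where f: "k_linear (kscale A) fscale (kspace A) (D A) f"
    "\<And>a b. \<lbrakk>a \<in> kspace A; b \<in> kspace A\<rbrakk> \<Longrightarrow> (\<Sum>q\<in>Q. \<eta> q) a b - (\<Sum>q\<in>Q. \<beta> q) a b = coboundary2 A f a b"
    by blast
  from insert.prems[of q] obtain g where g: "k_linear (kscale A) fscale (kspace A) (D A) g"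
    "\<And>a b. \<lbrakk>a \<in> kspace A; b \<in> kspace A\<rbrakk> \<Longrightarrow> \<eta> q a b - \<beta> q a b = coboundary2 A g a b"
    by (auto simp: cohomologous_def)
  have "(\<Sum>q\<in>insert q Q. \<eta> q) a b - (\<Sum>q\<in>insert q Q. \<beta> q) a b = coboundary2 A (g + f) a b"
    if "a \<in> kspace A" "b \<in> kspace A" for a b
    using insert.hyps by (simp add: coboundary2_add flip: f(2)[OF that] g(2)[OF that])
  then show ?case using D_k_linear_add[OF g(1) f(1)] by blast
qed

end


section \<open>The cocycles \<open>\<Theta>\<close>\<close>

context trunc_path_algebra
begin

text \<open>\<beta> lies in its own class, hence in that of some \<Theta>(\<phi>). Since
  \<open>cohomologous\<close> relates cocycles only, \<Theta>(\<phi>) is thereby known to be a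
  cocycle without computation.\<close>

lemma Theta_class_representative:
  assumes \<beta>: "\<beta> \<in> cocycles2 A" and cl: "coh_class A \<beta> \<in> Theta_class G n q ` D_HH2 G n q"
  obtains \<phi> where "\<phi> \<in> ker_D_d3 G n q" "(Theta G n q \<phi>, \<beta>) \<in> cohomologous A"
proof -
  from cl obtain F where F: "F \<in> D_HH2 G n q" "coh_class A \<beta> = Theta_class G n q F" by auto
  have "\<beta> \<in> coh_class A \<beta>" using cohomologous_refl[OF \<beta>] by (simp add: coh_class_def)
  with F obtain \<phi> where "\<phi> \<in> F" "\<beta> \<in> coh_class A (Theta G n q \<phi>)"
    by (auto simp: Theta_class_def A_def)
  moreover have "F \<subseteq> ker_D_d3 G n q" using F(1) by (auto simp: D_HH2_def quotient_def)
  ultimately show thesis using that by (auto simp: coh_class_def)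
qed

text \<open>The outer terms multiply p by elements of the arrow ideal and the middle term is h(0).
  Hence evaluation at such a, b and p depends only on the cohomology class.\<close>

lemma coboundary2_long:
  assumes h: "k_linear (kscale A) fscale (kspace A) (D A) h" and n: "0 < n"
    and ab: "a \<in> radical" "b \<in> radical" "kmul A a b = 0" and p: "p \<in> long_paths"
  shows "coboundary2 A h a b (single p) = 0"
proof -
  have hD: "h x \<in> D A" if "x \<in> kspace A" for x using h that by (simp add: k_linear_def)
  have "h (kscale A 0 0) = fscale 0 (h 0)" using h zero_closed unfolding k_linear_def by blast
  then have "h 0 = 0" by (auto simp: fscale_def)
  moreover have "single p \<in> kspace A" "plen p = n - 1" using p by (simp_all add: long_paths_def single_mem)
  moreover have "a \<in> kspace A" "b \<in> kspace A" using ab by (auto simp: radical_def)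
  ultimately show ?thesis
    using ab kmul_long_radical[of _ p] n hD
    by (simp add: coboundary2_def lact_def ract_def D_zero)
qed

text \<open>A second factor of length i is a short path for the truncation at i + 1.\<close>

lemma finite_tens_basis: "finite (tens_basis G n i q)"
proof -
  interpret B: trunc_path_algebra G "Suc i" "truncated_path_algebra G (Suc i) :: ('k, ('a, 'b) path \<Rightarrow> 'k) kalg"
    by unfold_locales simp
  show ?thesis
    by (rule finite_subset[OF _ finite_cartesian_product[OF finite_short_paths B.finite_short_paths]])
      (auto simp: tens_basis_def short_paths_def)
qed

lemma Theta_zero:
  assumes "\<And>u. u \<in> tens_basis G n n q \<Longrightarrow> \<phi> (single u) = 0"
  shows "Theta G n q \<phi> = (0 :: (('a, 'b) path \<Rightarrow> 'k) \<Rightarrow> (('a, 'b) path \<Rightarrow> 'k) \<Rightarrow> (('a, 'b) path \<Rightarrow> 'k) \<Rightarrow> 'k)"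
  unfolding Theta_def
  by (intro ext) (auto simp: assms fscale_def sum_fun_apply intro!: sum.neutral)

section \<open>Theta on trivial paths and on longest paths\<close>

lemma Theta_trivial_left: "Theta G n q \<phi> (trivial_path v) y = (0 :: (('a, 'b) path \<Rightarrow> 'k) \<Rightarrow> 'k)"
  unfolding Theta_def
  by (intro sum.neutral ballI) (auto simp: trivial_path_def fscale_def theta_val_def plen_def)

lemma Theta_trivial_right: "Theta G n q \<phi> x (trivial_path v) = (0 :: (('a, 'b) path \<Rightarrow> 'k) \<Rightarrow> 'k)"
  unfolding Theta_def
  by (intro sum.neutral ballI) (auto simp: trivial_path_def fscale_def theta_val_def plen_def)

text \<open>The remaining functional is dual to a path of length q - m with m at least n, which is
  below n - 1. For m > q truncated subtraction gives 0, still different from n - 1 because n is at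
  least 2.\<close>

lemma theta_val_long:
  assumes u: "u \<in> tens_basis G n n q" and q: "q < 2 * n - 1" and p: "p \<in> long_paths" and n: "2 \<le> n"
  shows "theta_val G n u b b' (single p) = (0 :: 'k)"
proof -
  obtain w v where u': "u = (w, v)" by (cases u)
  have len: "length (snd v @ snd w) = q" using u by (simp add: u' tens_basis_def plen_def)
  have "dual_basis Sh (t, drop m (snd v @ snd w)) (single p) = (0 :: 'k)" if "n \<le> m" for t m
  proof -
    have "plen (t, drop m (snd v @ snd w)) = q - m" using len by (simp only: plen_def snd_conv length_drop)
    then have "plen (t, drop m (snd v @ snd w)) \<noteq> plen p"
      using that p q n by (auto simp: long_paths_def)
    then have "(t, drop m (snd v @ snd w)) \<noteq> p" by metis
    then show ?thesis using p by (simp add: dual_basis_apply long_paths_def single_mem)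
  qed
  then show ?thesis by (simp add: theta_val_def u' Let_def)
qed

lemma Theta_long:
  "\<lbrakk>q < 2 * n - 1; p \<in> long_paths; 2 \<le> n\<rbrakk> \<Longrightarrow> Theta G n q \<phi> x y (single p) = (0 :: 'k)"
  unfolding Theta_def sum_fun_apply by (intro sum.neutral ballI) (simp add: fscale_def theta_val_long)

lemma Theta_single:
  assumes "b \<in> Sh" "b' \<in> Sh"
  shows "Theta G n q \<phi> (single b) (single b') =
    (\<Sum>u\<in>tens_basis G n n q. fscale (\<phi> (single u) :: 'k) (theta_val G n u b b'))"
  unfolding Theta_def
proof (intro sum.cong refl)
  fix u
  have "(\<Sum>c\<in>Sh. \<Sum>c'\<in>Sh. fscale (\<phi> (single u) * single b c * single b' c') (theta_val G n u c c')) =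
      (\<Sum>c\<in>Sh. if c = b then \<Sum>c'\<in>Sh. if c' = b' then fscale (\<phi> (single u)) (theta_val G n u c c') else 0 else 0)"
    by (intro sum.cong refl) (auto simp: fscale_def zero_fun_def intro!: sum.neutral sum.cong)
  also have "\<dots> = fscale (\<phi> (single u) :: 'k) (theta_val G n u b b')"
    using assms finite_short_paths by (simp add: sum.delta)
  finally show "(\<Sum>c\<in>Sh. \<Sum>c'\<in>Sh. fscale (\<phi> (single u) * single b c * single b' c') (theta_val G n u c c')) =
    fscale (\<phi> (single u) :: 'k) (theta_val G n u b b')" .
qed

lemma single_mem_free_space: "u \<in> B \<Longrightarrow> single u \<in> free_space B"
  by (auto simp: free_space_def)

lemma d3_single:
  "u \<in> tens_basis G n (n + 1) q \<Longrightarrow> d3 G n q (single u) = ((case u of ((i, us), (j, vs)) \<Rightarrow>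
      tens n (i, us @ [hd vs]) (head G (hd vs), tl vs)
      - tens n (tail G (last vs), last vs # us) (j, butlast vs)) :: _ \<Rightarrow> 'k)"
  unfolding d3_def lin_ext_def
  by (subst sum.remove[OF finite_tens_basis])
    (auto simp: fscale_def fun_eq_iff sum_fun_apply split: prod.splits intro!: sum.neutral)

lemma ker_D_d3_single:
  assumes \<phi>: "\<phi> \<in> ker_D_d3 G n q" and u: "u \<in> tens_basis G n (n + 1) q"
    and d3: "d3 G n q (single u) = (single x - single y :: _ \<Rightarrow> 'k)"
    and xy: "x \<in> tens_basis G n n q" "y \<in> tens_basis G n n q"
  shows "\<phi> (single x :: _ \<Rightarrow> 'k) = \<phi> (single y)"
proof -
  have lin: "k_linear fscale (*) (free_space (tens_basis G n n q)) UNIV \<phi>"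
    and "dual_map (free_space (tens_basis G n (n + 1) q)) (d3 G n q) \<phi> = 0"
    using \<phi> by (auto simp: ker_D_d3_def dual_space_def)
  then have "dual_map (free_space (tens_basis G n (n + 1) q)) (d3 G n q) \<phi> (single u) = 0" by simp
  then have "\<phi> (d3 G n q (single u)) = 0"
    unfolding dual_map_def if_P[OF single_mem_free_space[OF u]] .
  then have "\<phi> (single x - single y) = 0" unfolding d3 .
  \<comment> \<open>Additivity is available on the free space only, so the subtraction is rewritten
    as an addition.\<close>
  moreover have "\<phi> ((single x - single y) + single y) = \<phi> (single x - single y) + \<phi> (single y)"
    using lin xy free_space_diff single_mem_free_space unfolding k_linear_def by metis
  ultimately show ?thesis by simp
qed

end


section \<open>The cyclic quiver\<close>

text \<open>Arrow i starts at vertex i, so the unique path with given source and length runs through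
  consecutive residues. The start u may exceed s, which lets walks be concatenated without reducing
  intermediate vertices.\<close>

definition cyclic_walk :: "nat \<Rightarrow> nat \<Rightarrow> nat \<Rightarrow> nat list" where
  "cyclic_walk s u l = map (\<lambda>k. (u + k) mod s) [0..<l]"

lemma length_cyclic_walk [simp]: "length (cyclic_walk s u l) = l"
  by (simp add: cyclic_walk_def)

lemma cyclic_walk_0 [simp]: "cyclic_walk s u 0 = []"
  by (simp add: cyclic_walk_def)

lemma cyclic_walk_mod [simp]: "cyclic_walk s (u mod s) l = cyclic_walk s u l"
  by (simp add: cyclic_walk_def mod_add_left_eq)

lemma cyclic_walk_add: "cyclic_walk s u (l + m) = cyclic_walk s u l @ cyclic_walk s (u + l) m"
  by (rule nth_equalityI) (auto simp: cyclic_walk_def nth_append add.assoc)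

lemma cyclic_walk_Suc: "cyclic_walk s u (Suc l) = u mod s # cyclic_walk s (Suc u) l"
  using cyclic_walk_add[of s u 1 l] by (simp add: cyclic_walk_def)

lemma cyclic_walk_snoc: "cyclic_walk s u (Suc l) = cyclic_walk s u l @ [(u + l) mod s]"
  by (simp add: cyclic_walk_def)

lemma take_cyclic_walk: "m \<le> l \<Longrightarrow> take m (cyclic_walk s u l) = cyclic_walk s u m"
  using cyclic_walk_add[of s u m "l - m"] by simp

locale cyclic_trunc_path_algebra =
  fixes s n :: nat and A :: "('k::field, (nat, nat) path \<Rightarrow> 'k) kalg"
  assumes s_pos: "1 \<le> s" and n_ge_2: "2 \<le> n"
    and A_eq: "A = truncated_path_algebra (cyclic_quiver s) n"
begin

abbreviation "\<Delta> \<equiv> cyclic_quiver s"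

lemma fin_digraph_cyclic: "fin_digraph \<Delta>"
  using s_pos by unfold_locales (auto simp: cyclic_quiver_def)

sublocale trunc_path_algebra \<Delta> n A
  unfolding trunc_path_algebra_def trunc_path_algebra_axioms_def
  using fin_digraph_cyclic A_eq by simp

lemma cyclic_simps [simp]:
  "verts \<Delta> = {..<s}" "arcs \<Delta> = {..<s}" "tail \<Delta> i = i" "head \<Delta> i = Suc i mod s"
  by (simp_all add: cyclic_quiver_def)

lemma mem_paths: "(u, es) \<in> paths \<Delta> \<longleftrightarrow> u < s \<and> es = cyclic_walk s u (length es)"
proof (induction es arbitrary: u)
  case (Cons e es)
  have "(u, e # es) \<in> paths \<Delta> \<longleftrightarrow> e < s \<and> e = u \<and> es = cyclic_walk s (Suc e) (length es)"
    using Cons.IH[of "Suc e mod s"] s_pos by simp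
  also have "\<dots> \<longleftrightarrow> u < s \<and> e # es = cyclic_walk s u (length (e # es))"
    unfolding list.size(4) add_Suc_right add_0_right cyclic_walk_Suc list.inject
    by (cases "u < s") (auto simp only: mod_less)
  finally show ?case .
qed simp

lemma ptarget_cyclic: "u < s \<Longrightarrow> ptarget \<Delta> (u, cyclic_walk s u l) = (u + l) mod s"
proof (induction l arbitrary: u)
  case (Suc l)
  have "Suc u mod s < s" using s_pos by simp
  from Suc.IH[OF this] Suc.prems show ?case
    by (simp add: cyclic_walk_Suc mod_add_left_eq)
qed simp

lemma mem_long_paths: "p \<in> long_paths \<longleftrightarrow> (\<exists>k<s. p = (k, cyclic_walk s k (n - 1)))"
  using n_ge_2 by (cases p) (auto simp: long_paths_def short_paths_def plen_def mem_paths)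

text \<open>In degree 2n - 1 the A-factor must have its maximal length n - 1, so a basis element is
  determined by the source j of the other factor.\<close>

definition top_cycle :: "nat \<Rightarrow> (nat, nat) path \<times> (nat, nat) path" where
  "top_cycle j = (((j + n) mod s, cyclic_walk s (j + n) (n - 1)), (j, cyclic_walk s j n))"

lemma top_cycle_wrap: "s dvd 2 * n - 1 \<Longrightarrow> (j + (2 * n - 1)) mod s = j mod s"
  by (metis dvd_eq_mod_eq_0 mod_add_right_eq add.right_neutral)

text \<open>Following n + (n - 1) arrows from j leads back to j, which forces the
  divisibility.\<close>

lemma tens_basis_top:
  assumes u: "u \<in> tens_basis \<Delta> n n (2 * n - 1)"
  obtains j where "s dvd 2 * n - 1" "j < s" "u = top_cycle j"
proof -
  obtain i us j vs where u': "u = ((i, us), (j, vs))" by (metis prod.collapse)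
  from u have "(i, us) \<in> paths \<Delta>" "(j, vs) \<in> paths \<Delta>" "length vs = n" "length us = n - 1"
    and t: "ptarget \<Delta> (i, us) = j" "ptarget \<Delta> (j, vs) = i"
    by (auto simp: u' tens_basis_def plen_def short_paths_def)
  then have iu: "i < s" "us = cyclic_walk s i (n - 1)" and jv: "j < s" "vs = cyclic_walk s j n"
    using mem_paths by metis+
  have i: "i = (j + n) mod s" using t(2) jv ptarget_cyclic by simp
  have "j = ((j + n) mod s + (n - 1)) mod s" using t(1) iu ptarget_cyclic i by metis
  also have "\<dots> = (j + (2 * n - 1)) mod s"
    using n_ge_2 unfolding mod_add_left_eq add.assoc by (intro arg_cong[of _ _ "\<lambda>x. x mod s"]) simp
  finally have "(j + (2 * n - 1)) mod s = j mod s" using jv by simp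
  then have "s dvd 2 * n - 1"
    by (metis add_diff_cancel_left' le_add1 mod_eq_dvd_iff_nat)
  moreover have "u = top_cycle j"
    using iu jv by (simp add: u' top_cycle_def i)
  ultimately show thesis using that jv by blast
qed

lemma top_cycle_mem:
  assumes "s dvd 2 * n - 1" "j < s"
  shows "top_cycle j \<in> tens_basis \<Delta> n n (2 * n - 1)"
proof -
  have m: "(j + n) mod s < s" using s_pos by simp
  have "ptarget \<Delta> ((j + n) mod s, cyclic_walk s ((j + n) mod s) (n - 1)) = ((j + n) mod s + (n - 1)) mod s"
    by (rule ptarget_cyclic[OF m])
  also have "\<dots> = (j + (2 * n - 1)) mod s"
    using n_ge_2 unfolding mod_add_left_eq add.assoc by (intro arg_cong[of _ _ "\<lambda>x. x mod s"]) simp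
  also have "\<dots> = j" using top_cycle_wrap[OF assms(1)] assms(2) by simp
  finally show ?thesis
    using m assms(2) n_ge_2
    by (simp add: top_cycle_def tens_basis_def short_paths_def mem_paths plen_def ptarget_cyclic)
qed

text \<open>The differential of the element with factors of length n - 2 and n + 1 moves the first
  or the last arrow of the second factor into the first. The two results are the top cycles at j + 1
  and at j, with opposite signs.\<close>

lemma ker_D_d3_step:
  assumes \<phi>: "\<phi> \<in> ker_D_d3 \<Delta> n (2 * n - 1)" and s: "s dvd 2 * n - 1" and j: "j < s"
  shows "\<phi> (single (top_cycle (Suc j mod s)) :: _ \<Rightarrow> 'k) = \<phi> (single (top_cycle j))"
proof -
  \<comment> \<open>The end of the walk of length n + 1 from j, where the complementary walk has to
    start.\<close>
  define i where "i = (j + n + 1) mod s"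
  have i: "i < s" using s_pos by (simp add: i_def)
  have Sj: "Suc j mod s < s" using s_pos by simp
  let ?u = "((i, cyclic_walk s i (n - 2)), (j, cyclic_walk s j (n + 1)))"
  have wrap: "(i + (n - 2)) mod s = j"
  proof -
    have "(i + (n - 2)) mod s = (j + (2 * n - 1)) mod s"
      using n_ge_2 unfolding i_def mod_add_left_eq by (intro arg_cong[of _ _ "\<lambda>x. x mod s"]) simp
    then show ?thesis using top_cycle_wrap[OF s] j by simp
  qed
  have u: "?u \<in> tens_basis \<Delta> n (n + 1) (2 * n - 1)"
    using i j n_ge_2 wrap
    by (simp add: tens_basis_def short_paths_def mem_paths plen_def ptarget_cyclic) (simp add: i_def)
  have n1: "n - 1 = Suc (n - 2)" and less: "Suc (n - 2) < n" using n_ge_2 by linarith+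
  have snoc: "cyclic_walk s i (n - 2) @ [j] = cyclic_walk s i (n - 1)"
    unfolding n1 cyclic_walk_snoc wrap ..
  have cons: "(j + n) mod s # cyclic_walk s i (n - 2) = cyclic_walk s (j + n) (n - 1)"
    unfolding n1 cyclic_walk_Suc i_def by simp
  have i': "i = (Suc j mod s + n) mod s" by (simp add: i_def mod_add_left_eq)
  have first: "cyclic_walk s j (n + 1) = j # cyclic_walk s (Suc j) n"
    using j by (simp add: cyclic_walk_Suc)
  have final: "cyclic_walk s j (n + 1) = cyclic_walk s j n @ [(j + n) mod s]"
    by (simp add: cyclic_walk_snoc)
  have hd: "hd (cyclic_walk s j (n + 1)) = j" "tl (cyclic_walk s j (n + 1)) = cyclic_walk s (Suc j) n"
    unfolding first by simp_all
  have last: "last (cyclic_walk s j (n + 1)) = (j + n) mod s"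
    "butlast (cyclic_walk s j (n + 1)) = cyclic_walk s j n"
    unfolding final by simp_all
  have top: "((i, cyclic_walk s i (n - 2) @ [j]), (Suc j mod s, cyclic_walk s (Suc j) n)) =
      top_cycle (Suc j mod s)"
    "(((j + n) mod s, (j + n) mod s # cyclic_walk s i (n - 2)), (j, cyclic_walk s j n)) = top_cycle j"
    unfolding snoc cons top_cycle_def by (simp_all add: i')
  have "d3 \<Delta> n (2 * n - 1) (single ?u) = (single (top_cycle (Suc j mod s)) - single (top_cycle j) :: _ \<Rightarrow> 'k)"
    unfolding d3_single[OF u] prod.case hd last cyclic_simps tens_def top
    using less by (simp add: plen_def)
  then show ?thesis
    by (rule ker_D_d3_single[OF \<phi> u _ top_cycle_mem[OF s Sj] top_cycle_mem[OF s j]])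
qed

lemma ker_D_d3_const:
  assumes \<phi>: "\<phi> \<in> ker_D_d3 \<Delta> n (2 * n - 1)" and s: "s dvd 2 * n - 1"
  shows "j < s \<Longrightarrow> \<phi> (single (top_cycle j) :: _ \<Rightarrow> 'k) = \<phi> (single (top_cycle 0))"
proof (induction j)
  case (Suc j)
  then have "Suc j mod s = Suc j" "j < s" by simp_all
  with Suc.IH ker_D_d3_step[OF \<phi> s \<open>j < s\<close>] show ?case by metis
qed simp

text \<open>
  The longest path \<open>p\<close> is completed to a cycle of length \<open>2n - 1\<close> by an arrow \<open>a\<close> and a path \<open>b\<close>
  of length \<open>n - 1\<close>.
\<close>

lemma Theta_top:
  assumes \<phi>: "\<phi> \<in> ker_D_d3 \<Delta> n (2 * n - 1)" and s: "s dvd 2 * n - 1" and p: "p \<in> long_paths"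
  shows "\<exists>a\<in>radical. \<exists>b\<in>radical. kmul A a b = 0 \<and> Theta \<Delta> n (2 * n - 1) \<phi> a b =
    fscale (\<phi> (single (top_cycle 0)) :: 'k) (dual_basis Sh p)"
proof -
  obtain k where k: "k < s" "p = (k, cyclic_walk s k (n - 1))" using p mem_long_paths by blast
  \<comment> \<open>The target of p; by the divisibility, n arrows lead from there back to the
    source k.\<close>
  define j where "j = (k + (n - 1)) mod s"
  have j: "j < s" using s_pos by (simp add: j_def)
  have jk: "(j + n) mod s = k"
  proof -
    have "(j + n) mod s = (k + (2 * n - 1)) mod s"
      using n_ge_2 unfolding j_def mod_add_left_eq by (intro arg_cong[of _ _ "\<lambda>x. x mod s"]) simp
    then show ?thesis using top_cycle_wrap[OF s] k by simp
  qed
  define b where "b = (j, cyclic_walk s j 1)"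
  define b' where "b' = (Suc j mod s, cyclic_walk s (Suc j) (n - 1))"
  have Sj: "Suc j mod s < s" using s_pos by simp
  have Sh: "b \<in> Sh" "b' \<in> Sh"
    using j Sj n_ge_2 by (simp_all add: b_def b'_def short_paths_def mem_paths plen_def)
  have join: "snd b @ snd b' = cyclic_walk s j n"
    using cyclic_walk_add[of s j 1 "n - 1"] n_ge_2 by (simp add: b_def b'_def)
  have "ptarget \<Delta> b' = (Suc j mod s + (n - 1)) mod s"
    using ptarget_cyclic[OF Sj, of "n - 1"] by (simp add: b'_def)
  also have "\<dots> = (j + n) mod s"
    using n_ge_2 unfolding mod_add_left_eq by (intro arg_cong[of _ _ "\<lambda>x. x mod s"]) simp
  also have "\<dots> = k" by (rule jk)
  finally have tgt: "ptarget \<Delta> b' = k" .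
  \<comment> \<open>A walk of length n determines its start, so the product of b and b' matches only
    the top cycle at j, and removing n arrows from that cycle leaves p.\<close>
  have theta: "theta_val \<Delta> n (top_cycle i) b b' = (if i = j then dual_basis Sh p else 0)" if i: "i < s" for i
  proof -
    have as: "cyclic_walk s i n @ cyclic_walk s (i + n) (n - 1) = cyclic_walk s i (2 * n - 1)"
      using cyclic_walk_add[of s i n "n - 1"] n_ge_2 by (simp add: mult_2)
    have "cyclic_walk s j n = cyclic_walk s i n \<longleftrightarrow> i = j"
    proof
      assume "cyclic_walk s j n = cyclic_walk s i n"
      then have "hd (cyclic_walk s j n) = hd (cyclic_walk s i n)" by simp
      then show "i = j" using i j n_ge_2 by (cases n) (simp_all add: cyclic_walk_Suc)
    qed simp
    moreover have "cyclic_walk s (j + n) (n - 1) = cyclic_walk s k (n - 1)" "n \<le> n + n - 1"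
      using n_ge_2 jk cyclic_walk_mod[of s "j + n" "n - 1"] by simp_all
    moreover have "plen b = 1" "plen b' = n - 1" by (simp_all add: b_def b'_def plen_def)
    ultimately show ?thesis
      using n_ge_2 join tgt k
      by (simp add: theta_val_def top_cycle_def as Let_def take_cyclic_walk)
  qed
  have inj: "inj_on top_cycle {..<s}" by (auto simp: inj_on_def top_cycle_def)
  have basis: "tens_basis \<Delta> n n (2 * n - 1) = top_cycle ` {..<s}"
    using tens_basis_top top_cycle_mem[OF s] by blast
  have "Theta \<Delta> n (2 * n - 1) \<phi> (single b) (single b') =
      (\<Sum>i<s. fscale (\<phi> (single (top_cycle i)) :: 'k) (theta_val \<Delta> n (top_cycle i) b b'))"
    unfolding Theta_single[OF Sh] basis sum.reindex[OF inj] o_def by (rule refl)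
  also have "\<dots> = (\<Sum>i<s. if i = j then fscale (\<phi> (single (top_cycle 0)) :: 'k) (dual_basis Sh p) else 0)"
  proof (intro sum.cong refl)
    fix i assume "i \<in> {..<s}"
    then have i: "i < s" by simp
    show "fscale (\<phi> (single (top_cycle i)) :: 'k) (theta_val \<Delta> n (top_cycle i) b b') =
      (if i = j then fscale (\<phi> (single (top_cycle 0)) :: 'k) (dual_basis Sh p) else 0)"
      unfolding ker_D_d3_const[OF \<phi> s i] theta[OF i] by (simp add: fscale_zero)
  qed
  also have "\<dots> = fscale (\<phi> (single (top_cycle 0))) (dual_basis Sh p)"
    using j by (simp add: sum.delta)
  finally have "Theta \<Delta> n (2 * n - 1) \<phi> (single b) (single b') =
    fscale (\<phi> (single (top_cycle 0)) :: 'k) (dual_basis Sh p)" .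
  moreover have "single b \<in> radical" "single b' \<in> radical"
    using single_mem Sh n_ge_2 by (auto simp: radical_def b_def b'_def dest: arg_cong[of _ _ length])
  moreover have "kmul A (single b) (single b') = 0"
  proof
    fix q :: "(nat, nat) path"
    obtain u es where q: "q = (u, es)" by (cases q)
    \<comment> \<open>The product would have length n and is truncated.\<close>
    have "drop 1 es \<noteq> cyclic_walk s (Suc j) (n - 1)" if "length es < n"
    proof -
      have "length (drop 1 es) \<noteq> n - 1" using that n_ge_2 by simp
      then show ?thesis by (metis length_cyclic_walk)
    qed
    then show "kmul A (single b) (single b') q = 0 q"
      by (simp add: q b_def b'_def kmul_single_left)
  qed
  ultimately show ?thesis by blast
qed

text \<open>If the class is zero, \<Theta>(\<phi>) is a coboundary and vanishes at the pair of
  \<open>Theta_top\<close> and p, where its value is the constant of \<phi>. If s does not divide 2n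
  - 1, the basis is empty and both sides hold.\<close>

lemma Theta_top_class:
  assumes \<phi>: "\<phi> \<in> ker_D_d3 \<Delta> n (2 * n - 1)" and \<beta>: "(Theta \<Delta> n (2 * n - 1) \<phi>, \<beta>) \<in> cohomologous A"
  shows "coh_class A \<beta> = coh_class A 0 \<longleftrightarrow>
    (\<forall>u\<in>tens_basis \<Delta> n n (2 * n - 1). \<phi> (single u) = (0 :: 'k))"
proof
  assume "\<forall>u\<in>tens_basis \<Delta> n n (2 * n - 1). \<phi> (single u) = 0"
  then have "Theta \<Delta> n (2 * n - 1) \<phi> = 0" by (intro Theta_zero) simp
  with \<beta> show "coh_class A \<beta> = coh_class A 0" using coh_class_eq_if by metis
next
  assume "coh_class A \<beta> = coh_class A 0"
  then have "(\<beta>, 0) \<in> cohomologous A" by (rule coh_class_eqD[OF _ zero_cocycle])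
  with \<beta> have "(Theta \<Delta> n (2 * n - 1) \<phi>, 0) \<in> cohomologous A" by (rule cohomologous_trans)
  then obtain h where h: "k_linear (kscale A) fscale (kspace A) (D A) h"
    and Th: "\<And>a b. \<lbrakk>a \<in> kspace A; b \<in> kspace A\<rbrakk> \<Longrightarrow> Theta \<Delta> n (2 * n - 1) \<phi> a b = coboundary2 A h a b"
    by (auto simp: cohomologous_def)
  show "\<forall>u\<in>tens_basis \<Delta> n n (2 * n - 1). \<phi> (single u) = 0"
  proof
    fix u assume u: "u \<in> tens_basis \<Delta> n n (2 * n - 1)"
    then obtain j where s: "s dvd 2 * n - 1" and j: "j < s" "u = top_cycle j" by (rule tens_basis_top)
    \<comment> \<open>Any longest path would do; vertex 0 exists since s is at least 1.\<close>
    define p where "p = (0 :: nat, cyclic_walk s 0 (n - 1))"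
    have p: "p \<in> long_paths" using s_pos by (auto simp: mem_long_paths p_def)
    obtain a b where ab: "a \<in> radical" "b \<in> radical" "kmul A a b = 0"
      and T: "Theta \<Delta> n (2 * n - 1) \<phi> a b = fscale (\<phi> (single (top_cycle 0)) :: 'k) (dual_basis Sh p)"
      using Theta_top[OF \<phi> s p] by blast
    have "coboundary2 A h a b (single p) = 0"
      using coboundary2_long[OF h _ ab p] n_ge_2 by simp
    then have "fscale (\<phi> (single (top_cycle 0)) :: 'k) (dual_basis Sh p) (single p) = 0"
      using T Th[of a b] ab by (simp add: radical_def)
    then have "\<phi> (single (top_cycle 0)) = 0"
      using p by (simp add: fscale_def dual_basis_apply single_mem long_paths_def)
    then show "\<phi> (single u) = 0" using ker_D_d3_const[OF \<phi> s j(1)] j(2) by simp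
  qed
qed

text \<open>With the flag expressed on basis elements, its failure supplies a top cycle, hence the
  divisibility that \<open>Theta_top\<close> demands, and constancy moves the nonzero value to
  \<open>top_cycle 0\<close>.\<close>

lemma decomposed_extension_Theta:
  assumes \<alpha>: "\<alpha> \<in> cocycles2 A"
    and \<phi>: "\<And>q. q \<in> {n..2 * n - 1} \<Longrightarrow> \<phi> q \<in> ker_D_d3 \<Delta> n q"
    and f: "k_linear (kscale A) fscale (kspace A) (D A) f"
    and dec: "\<And>a b. \<lbrakk>a \<in> kspace A; b \<in> kspace A\<rbrakk> \<Longrightarrow>
      \<alpha> a b = (\<Sum>q = n..2 * n - 1. Theta \<Delta> n q (\<phi> q)) a b + coboundary2 A f a b"
  shows "decomposed_extension \<Delta> n A \<alpha> (hochschild_ext A \<alpha>) f (\<Sum>q = n..2 * n - 1. Theta \<Delta> n q (\<phi> q))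
    (\<forall>u\<in>tens_basis \<Delta> n n (2 * n - 1). \<phi> (2 * n - 1) (single u) = (0 :: 'k))"
proof -
  have long: "(\<Sum>q = n..2 * n - 1. Theta \<Delta> n q (\<phi> q)) a b (single p) =
      Theta \<Delta> n (2 * n - 1) (\<phi> (2 * n - 1)) a b (single p)" if p: "p \<in> long_paths" for a b p
  proof -
    have "(\<Sum>q = n..2 * n - 1. Theta \<Delta> n q (\<phi> q) a b (single p)) =
        (\<Sum>q\<in>{2 * n - 1}. Theta \<Delta> n q (\<phi> q) a b (single p))"
      using n_ge_2 p by (intro sum.mono_neutral_right) (auto simp: Theta_long)
    then show ?thesis by (simp add: sum_fun_apply)
  qed
  show ?thesis
  proof (unfold_locales, goal_cases)
    case 1
    show ?case by fact
  next
    case 2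
    show ?case using n_ge_2 by simp
  next
    case 3
    show ?case ..
  next
    case 4
    show ?case by (rule n_ge_2)
  next
    case (5 v)
    then show ?case by simp
  next
    case 6
    show ?case by fact
  next
    case (7 a b)
    then show ?case by (rule dec)
  next
    case (8 v a)
    show ?case by (simp add: sum_fun_apply Theta_trivial_left)
  next
    case (9 v a)
    show ?case by (simp add: sum_fun_apply Theta_trivial_right)
  next
    case (10 a b p)
    then have "Theta \<Delta> n (2 * n - 1) (\<phi> (2 * n - 1)) = 0" by (intro Theta_zero) simp
    with 10 long show ?case by simp
  next
    case (11 p)
    then obtain u where u: "u \<in> tens_basis \<Delta> n n (2 * n - 1)" "\<phi> (2 * n - 1) (single u) \<noteq> 0" by auto
    from u(1) obtain j where s: "s dvd 2 * n - 1" and j: "j < s" "u = top_cycle j" by (rule tens_basis_top)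
    have \<phi>top: "\<phi> (2 * n - 1) \<in> ker_D_d3 \<Delta> n (2 * n - 1)" using \<phi> n_ge_2 by simp
    have c: "\<phi> (2 * n - 1) (single (top_cycle 0)) \<noteq> 0"
      using u(2) ker_D_d3_const[OF \<phi>top s j(1)] j(2) by simp
    obtain a b where ab: "a \<in> radical" "b \<in> radical" "kmul A a b = 0"
      and T: "Theta \<Delta> n (2 * n - 1) (\<phi> (2 * n - 1)) a b =
        fscale (\<phi> (2 * n - 1) (single (top_cycle 0)) :: 'k) (dual_basis Sh p)"
      using Theta_top[OF \<phi>top s 11(2)] by blast
    have "(\<Sum>q = n..2 * n - 1. Theta \<Delta> n q (\<phi> q)) a b (single q) =
        (if q = p then \<phi> (2 * n - 1) (single (top_cycle 0)) else 0)" if "q \<in> long_paths" for q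
      using that long[OF that] T by (auto simp: fscale_def dual_basis_apply long_paths_def single_mem)
    then show ?case using ab c by blast
  qed
qed

text \<open>This places the trivial extension under the same counting formula, with the flag
  set.\<close>

lemma decomposed_extension_zero: "decomposed_extension \<Delta> n A 0 (hochschild_ext A 0) 0 0 True"
proof (unfold_locales, goal_cases)
  case 1
  show ?case by (rule zero_cocycle)
next
  case 2
  show ?case using n_ge_2 by simp
next
  case 4
  show ?case by (rule n_ge_2)
next
  case 6
  show ?case by (rule D_k_linear_zero)
qed (simp_all add: coboundary2_zero)

end

section \<open>Comparison with the trivial extension and with the cyclic quiver\<close>

theorem corollary4p4:
  fixes s n :: nat
    and \<Delta> :: "(nat, nat) pre_digraph"
    and A :: "('k::field, (nat, nat) path \<Rightarrow> 'k) kalg"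
    and \<alpha> :: "((nat, nat) path \<Rightarrow> 'k) \<Rightarrow> ((nat, nat) path \<Rightarrow> 'k) \<Rightarrow> ((nat, nat) path \<Rightarrow> 'k) \<Rightarrow> 'k"
    and \<beta> :: "nat \<Rightarrow> ((nat, nat) path \<Rightarrow> 'k) \<Rightarrow> ((nat, nat) path \<Rightarrow> 'k) \<Rightarrow> ((nat, nat) path \<Rightarrow> 'k) \<Rightarrow> 'k"
  assumes "s \<ge> 1" and "n \<ge> 2"
    and \<Delta>: "\<Delta> = cyclic_quiver s"
    and A: "A = truncated_path_algebra \<Delta> n"
    and "\<alpha> \<in> cocycles2 A"
    and "\<And>q. q \<in> {n..2 * n - 1} \<Longrightarrow> \<beta> q \<in> cocycles2 A"
    and "\<And>q. q \<in> {n..2 * n - 1} \<Longrightarrow> coh_class A (\<beta> q) \<in> Theta_class \<Delta> n q ` D_HH2 \<Delta> n q"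
    and "coh_class A \<alpha> = coh_class A (\<Sum>q = n..2 * n - 1. \<beta> q)"
  shows "\<forall>i\<in>verts \<Delta>. \<forall>j\<in>verts \<Delta>.
    ordinary_quiver_ext A (verts \<Delta>) trivial_path \<alpha> i j =
      (if coh_class A (\<beta> (2 * n - 1)) = coh_class A 0
       then ordinary_quiver_ext A (verts \<Delta>) trivial_path 0 i j
       else quiver_arrow_number \<Delta> i j)"
proof (intro ballI)
  fix i j assume ij: "i \<in> verts \<Delta>" "j \<in> verts \<Delta>"
  interpret cyclic_trunc_path_algebra s n A
    using assms(1,2) A \<Delta> by unfold_locales auto
  have "\<exists>\<phi>. \<phi> \<in> ker_D_d3 \<Delta> n q \<and> (Theta \<Delta> n q \<phi>, \<beta> q) \<in> cohomologous A" if q: "q \<in> {n..2 * n - 1}" for q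
    using Theta_class_representative[OF assms(6)[OF q] assms(7)[OF q, unfolded \<Delta>]] by (auto simp: \<Delta>)
  then obtain \<phi> where \<phi>: "\<And>q. q \<in> {n..2 * n - 1} \<Longrightarrow> \<phi> q \<in> ker_D_d3 \<Delta> n q"
    and coh: "\<And>q. q \<in> {n..2 * n - 1} \<Longrightarrow> (Theta \<Delta> n q (\<phi> q), \<beta> q) \<in> cohomologous A" by metis
  obtain f where f: "k_linear (kscale A) fscale (kspace A) (D A) f"
    and f': "\<And>a b. \<lbrakk>a \<in> kspace A; b \<in> kspace A\<rbrakk> \<Longrightarrow>
      (\<Sum>q = n..2 * n - 1. Theta \<Delta> n q (\<phi> q)) a b - (\<Sum>q = n..2 * n - 1. \<beta> q) a b = coboundary2 A f a b"
    using sum_cohomologous[of "{n..2 * n - 1}" "\<lambda>q. Theta \<Delta> n q (\<phi> q)" \<beta>, OF _ coh] by auto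
  obtain g where g: "k_linear (kscale A) fscale (kspace A) (D A) g"
    and g': "\<And>a b. \<lbrakk>a \<in> kspace A; b \<in> kspace A\<rbrakk> \<Longrightarrow>
      (\<Sum>q = n..2 * n - 1. \<beta> q) a b - \<alpha> a b = coboundary2 A g a b"
    using coh_class_eqD[OF assms(8)[symmetric] assms(5)] by (auto simp: cohomologous_def)
  \<comment> \<open>f and g measure the successive differences from the sum of the \<Theta> to the
    sum of the \<beta> and on to \<alpha>, hence the minus sign.\<close>
  have "\<alpha> a b = (\<Sum>q = n..2 * n - 1. Theta \<Delta> n q (\<phi> q)) a b + coboundary2 A (- (f + g)) a b"
    if "a \<in> kspace A" "b \<in> kspace A" for a b
    unfolding coboundary2_uminus coboundary2_add f'[OF that, symmetric] g'[OF that, symmetric] by simp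
  from decomposed_extension_Theta[OF assms(5) \<phi>[unfolded \<Delta>] D_k_linear_uminus[OF D_k_linear_add[OF f g]]
      this[unfolded \<Delta>]]
  interpret E: decomposed_extension \<Delta> n A \<alpha> "hochschild_ext A \<alpha>" "- (f + g)"
    "\<Sum>q = n..2 * n - 1. Theta \<Delta> n q (\<phi> q)" "\<forall>u\<in>tens_basis \<Delta> n n (2 * n - 1). \<phi> (2 * n - 1) (single u) = 0"
    by (simp add: \<Delta>)
  interpret Z: decomposed_extension \<Delta> n A 0 "hochschild_ext A 0" 0 0 True
    using decomposed_extension_zero by (simp add: \<Delta>)
  have top: "2 * n - 1 \<in> {n..2 * n - 1}" using \<open>n \<ge> 2\<close> by auto
  have iff: "coh_class A (\<beta> (2 * n - 1)) = coh_class A 0 \<longleftrightarrow>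
      (\<forall>u\<in>tens_basis \<Delta> n n (2 * n - 1). \<phi> (2 * n - 1) (single u) = 0)"
    using Theta_top_class[OF \<phi>[OF top, unfolded \<Delta>] coh[OF top, unfolded \<Delta>]] by (simp add: \<Delta>)
  show "ordinary_quiver_ext A (verts \<Delta>) trivial_path \<alpha> i j =
      (if coh_class A (\<beta> (2 * n - 1)) = coh_class A 0
       then ordinary_quiver_ext A (verts \<Delta>) trivial_path 0 i j
       else quiver_arrow_number \<Delta> i j)"
    \<comment> \<open>For a nonzero class the set of longest paths drops out and only the arrows of
      the cyclic quiver are counted; otherwise the two formulas coincide.\<close>
    unfolding E.ordinary_quiver_ext_eq[OF ij] Z.ordinary_quiver_ext_eq[OF ij] iff
    by (simp add: card_Plus E.arcs_between_def quiver_arrow_number_def)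
qed

end
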